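(* Let $d\ge 1$ be an integer. There exist a Cantor group $\Omega$ that admits a minimal $\mathbb{Z}^d$ action $\{T^n\}_{n\in\mathbb{Z}^d}$ by translations, a function $f\in C(\Omega,\mathbb{R})$, and constants $r>0$, $C<\infty$ such that for every $\omega\in\Omega$ the Schrödinger operator $H_\omega$ on $\ell^2(\mathbb{Z}^d)$ with potential $V_\omega(n)=f(T^n\omega)$, that is, $$(H_\omega u)(n)=\sum_{|l|_1=1}u(n+l)+f(T^n\omega)\,u(n),\qquad n\in\mathbb{Z}^d,$$ has ULE with decay rate $r$ and constant $C$ (so $r$ and $C$ do not depend on $\omega$). In particular, there are constants $\tilde C,\tilde r\in(0,\infty)$, independent of $\omega$, such that for every $\omega\in\Omega$ and all $n,m\in\mathbb{Z}^d$, $$\sup_{t\in\mathbb{R}}\left|\left\langle\delta_n,e^{-itH_\omega}\delta_m\right\rangle\right|\le \tilde C e^{-\tilde r|n-m|}.$$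
   Context: A Cantor group is an infinite, totally disconnected, metrizable, compact Abelian (topological) group. A $\mathbb{Z}^d$ action by translations on a Cantor group $\Omega$ (written additively) is a family $\{T^n\}_{n\in\mathbb{Z}^d}$ for which there are $\alpha_1,\dots,\alpha_d\in\Omega$ with $T^n\omega=\omega+\sum_{j=1}^d n_j\alpha_j$ for all $\omega\in\Omega$, $n=(n_1,\dots,n_d)\in\mathbb{Z}^d$. The action is minimal if every orbit $\{T^n\omega:n\in\mathbb{Z}^d\}$ is dense in $\Omega$. A family $\{u_n\}\subset\ell^2(\mathbb{Z}^d)$ is uniformly localized, with decay rate $r>0$ and constant $C<\infty$, if for every element $u_n$ of the family there is $m_n\in\mathbb{Z}^d$ (the center of localization) such that $|u_n(k)|\le Ce^{-r|k-m_n|}$ for every $k\in\mathbb{Z}^d$. The operator $H_\omega$ has ULE (with decay rate $r$ and constant $C$) if it has a complete set of eigenfunctions that is uniformly localized (with decay rate $r$ and constant $C$); a set of vectors is complete if its set of finite linear combinations is dense in $\ell^2(\mathbb{Z}^d)$. Here $|l|_1=\sum_j|l_j|$, $|k|=\max_j|k_j|$ for $k\in\mathbb{Z}^d$, and $\{\delta_n\}_{n\in\mathbb{Z}^d}$ is the standard orthonormal basis of $\ell^2(\mathbb{Z}^d)$. *)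

theory Defs
  imports
    "HOL-Analysis.Analysis"
    "HOL-Algebra.FiniteProduct"
begin

section \<open>Cantor groups and actions by translations\<close>

text \<open>Groups are HOL-Algebra records, so the Abelian groups here are written multiplicatively.
  The record carries no topology, so a topological group is a pair of a record and an abstract
  topology on its carrier.\<close>

definition topological_group_on :: "'g monoid \<Rightarrow> 'g topology \<Rightarrow> bool" where
  "topological_group_on G X \<longleftrightarrow>
     group G \<and> topspace X = carrier G \<and>
     continuous_map (prod_topology X X) X (\<lambda>(x, y). x \<otimes>\<^bsub>G\<^esub> y) \<and>
     continuous_map X X (\<lambda>x. inv\<^bsub>G\<^esub> x)"

definition totally_disconnected_space :: "'g topology \<Rightarrow> bool" where
  "totally_disconnected_space X \<longleftrightarrow> (\<forall>S. connectedin X S \<longrightarrow> (\<exists>a. S \<subseteq> {a}))"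

definition cantor_group :: "'g monoid \<Rightarrow> 'g topology \<Rightarrow> bool" where
  "cantor_group G X \<longleftrightarrow>
     topological_group_on G X \<and> comm_group G \<and> infinite (carrier G) \<and>
     totally_disconnected_space X \<and> metrizable_space X \<and> compact_space X"

definition translation_action :: "'g monoid \<Rightarrow> (int ^ 'd \<Rightarrow> 'g \<Rightarrow> 'g) \<Rightarrow> bool" where
  "translation_action G T \<longleftrightarrow>
     (\<exists>\<alpha> :: 'd \<Rightarrow> 'g. (\<forall>j. \<alpha> j \<in> carrier G) \<and>
        (\<forall>n. \<forall>\<omega>\<in>carrier G.
           T n \<omega> = \<omega> \<otimes>\<^bsub>G\<^esub> (\<Otimes>\<^bsub>G\<^esub>j\<in>UNIV. \<alpha> j [^]\<^bsub>G\<^esub> (n $ j))))"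

definition minimal_action :: "'g topology \<Rightarrow> (int ^ 'd \<Rightarrow> 'g \<Rightarrow> 'g) \<Rightarrow> bool" where
  "minimal_action X T \<longleftrightarrow>
     (\<forall>\<omega>\<in>topspace X. X closure_of (range (\<lambda>n. T n \<omega>)) = topspace X)"


section \<open>Norms on the integer lattice\<close>

definition l1_norm :: "int ^ 'd \<Rightarrow> int" where
  "l1_norm l = (\<Sum>j\<in>UNIV. \<bar>l $ j\<bar>)"

definition max_norm :: "int ^ 'd \<Rightarrow> int" where
  "max_norm k = Max (range (\<lambda>j. \<bar>k $ j\<bar>))"

lemma finite_unit_sphere: "finite {l :: int ^ 'd. l1_norm l = 1}"
proof (rule finite_subset)
  let ?B = "PiE (UNIV :: 'd set) (\<lambda>_. {-1..1 :: int})"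
  show "{l :: int ^ 'd. l1_norm l = 1} \<subseteq> vec_lambda ` ?B"
  proof
    fix l :: "int ^ 'd" assume "l \<in> {l. l1_norm l = 1}"
    then have s: "(\<Sum>j\<in>UNIV. \<bar>l $ j\<bar>) = 1" by (simp add: l1_norm_def)
    have "\<bar>l $ j\<bar> \<le> 1" for j
      using member_le_sum[of j UNIV "\<lambda>j. \<bar>l $ j\<bar>"] s by simp
    then have "vec_nth l \<in> ?B" by (auto simp: abs_le_iff minus_le_iff)
    then show "l \<in> vec_lambda ` ?B" by (metis imageI vec_nth_inverse)
  qed
  show "finite (vec_lambda ` ?B)" by (intro finite_imageI finite_PiE) auto
qed


section \<open>The Hilbert space of square summable complex functions\<close>

definition square_summable :: "('a \<Rightarrow> complex) \<Rightarrow> bool" where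
  "square_summable f \<longleftrightarrow> (\<lambda>x. (cmod (f x))\<^sup>2) summable_on UNIV"

definition l2norm :: "('a \<Rightarrow> complex) \<Rightarrow> real" where
  "l2norm f = sqrt (\<Sum>\<^sub>\<infinity>x. (cmod (f x))\<^sup>2)"

lemma l2norm_nonneg: "0 \<le> l2norm f"
  by (simp add: l2norm_def infsum_nonneg)

lemma L2_set_le_l2norm:
  assumes "square_summable f" "finite F"
  shows "L2_set (\<lambda>x. cmod (f x)) F \<le> l2norm f"
  using assms unfolding L2_set_def l2norm_def square_summable_def
  by (intro real_sqrt_le_mono finite_sum_le_infsum) auto

lemma square_summable_bound:
  assumes "\<And>F. finite F \<Longrightarrow> L2_set (\<lambda>x. cmod (f x)) F \<le> b"
  shows "square_summable f" "l2norm f \<le> b"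
proof -
  have b: "0 \<le> b" using assms[of "{}"] by simp
  have le: "(\<Sum>x\<in>F. (cmod (f x))\<^sup>2) \<le> b\<^sup>2" if "finite F" for F
    using assms[OF that] unfolding L2_set_def by (rule sqrt_le_D)
  then show s: "square_summable f"
    unfolding square_summable_def
    by (intro nonneg_bdd_above_summable_on) (auto simp: bdd_above_def)
  then have "(\<Sum>\<^sub>\<infinity>x. (cmod (f x))\<^sup>2) \<le> b\<^sup>2"
    unfolding square_summable_def by (intro infsum_le_finite_sums le) auto
  then show "l2norm f \<le> b"
    unfolding l2norm_def using b by (rule real_le_lsqrt[rotated])
qed

lemma square_summable_add:
  assumes "square_summable f" "square_summable g"
  shows "square_summable (\<lambda>x. f x + g x)"
    and "l2norm (\<lambda>x. f x + g x) \<le> l2norm f + l2norm g"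
proof -
  have "L2_set (\<lambda>x. cmod (f x + g x)) F \<le> l2norm f + l2norm g" if "finite F" for F
  proof -
    have "L2_set (\<lambda>x. cmod (f x + g x)) F \<le> L2_set (\<lambda>x. cmod (f x) + cmod (g x)) F"
      by (intro L2_set_mono norm_triangle_ineq) auto
    also have "\<dots> \<le> L2_set (\<lambda>x. cmod (f x)) F + L2_set (\<lambda>x. cmod (g x)) F"
      by (rule L2_set_triangle_ineq)
    also have "\<dots> \<le> l2norm f + l2norm g"
      using assms that by (intro add_mono L2_set_le_l2norm)
    finally show ?thesis .
  qed
  then show "square_summable (\<lambda>x. f x + g x)"
    and "l2norm (\<lambda>x. f x + g x) \<le> l2norm f + l2norm g"
    by (fact square_summable_bound)+
qed

lemma square_summable_mult:
  assumes "square_summable f" "\<And>x. cmod (v x) \<le> b"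
  shows "square_summable (\<lambda>x. v x * f x)"
  unfolding square_summable_def
proof (rule summable_on_comparison_test)
  show "(\<lambda>x. b\<^sup>2 * (cmod (f x))\<^sup>2) summable_on UNIV"
    using assms(1) unfolding square_summable_def by (rule summable_on_cmult_right)
  fix x
  have "cmod (v x * f x) \<le> b * cmod (f x)"
    by (simp add: norm_mult mult_right_mono assms(2))
  then show "(cmod (v x * f x))\<^sup>2 \<le> b\<^sup>2 * (cmod (f x))\<^sup>2"
    by (metis norm_ge_zero power_mono power_mult_distrib)
qed auto

lemma square_summable_cmult: "square_summable f \<Longrightarrow> square_summable (\<lambda>x. c * f x)"
  by (rule square_summable_mult) auto

lemma l2norm_cmult: "l2norm (\<lambda>x. c * f x) = cmod c * l2norm f"
  by (simp add: l2norm_def norm_mult power_mult_distrib infsum_cmult_right' real_sqrt_mult)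

lemma square_summable_sum:
  assumes "finite I" "\<And>i. i \<in> I \<Longrightarrow> square_summable (f i)"
  shows "square_summable (\<lambda>x. \<Sum>i\<in>I. f i x)"
  using assms
proof (induction I)
  case empty
  then show ?case by (simp add: square_summable_def)
next
  case (insert i I)
  then show ?case by (simp add: square_summable_add)
qed

lemma square_summable_shift:
  fixes f :: "'a :: ab_group_add \<Rightarrow> complex"
  assumes "square_summable f"
  shows "square_summable (\<lambda>x. f (x + l))"
proof -
  have "bij_betw (\<lambda>x. x + l) UNIV UNIV"
    by (rule bij_betw_byWitness[of _ "\<lambda>x. x - l"]) auto
  from summable_on_reindex_bij_betw[OF this, of "\<lambda>x. (cmod (f x))\<^sup>2"] assms
  show ?thesis by (simp add: square_summable_def)
qed

lemma l2norm_eq_0: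
  assumes "square_summable f" "l2norm f = 0"
  shows "f x = 0"
  using L2_set_le_l2norm[OF assms(1), of "{x}"] assms(2) by (simp add: L2_set_def)

typedef 'a ell2 = "{f :: 'a \<Rightarrow> complex. square_summable f}"
  morphisms ell2_fun Abs_ell2
  by (rule exI[of _ "\<lambda>_. 0"]) (simp add: square_summable_def)

setup_lifting type_definition_ell2

lemma ell2_eqI: "(\<And>x. ell2_fun u x = ell2_fun v x) \<Longrightarrow> u = v"
  by transfer auto

instantiation ell2 :: (type) real_vector
begin

lift_definition zero_ell2 :: "'a ell2" is "\<lambda>_. 0"
  by (simp add: square_summable_def)
lift_definition uminus_ell2 :: "'a ell2 \<Rightarrow> 'a ell2" is "\<lambda>f x. - f x"
  by (simp add: square_summable_def)
lift_definition plus_ell2 :: "'a ell2 \<Rightarrow> 'a ell2 \<Rightarrow> 'a ell2" is "\<lambda>f g x. f x + g x"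
  by (rule square_summable_add)
lift_definition minus_ell2 :: "'a ell2 \<Rightarrow> 'a ell2 \<Rightarrow> 'a ell2" is "\<lambda>f g x. f x - g x"
  subgoal for f g
    using square_summable_add(1)[of f "\<lambda>x. - g x"] by (simp add: square_summable_def)
  done
lift_definition scaleR_ell2 :: "real \<Rightarrow> 'a ell2 \<Rightarrow> 'a ell2" is "\<lambda>c f x. complex_of_real c * f x"
  by (rule square_summable_cmult)
instance
proof
  fix a b c :: "'a ell2" and r s :: real
  show "a + b + c = a + (b + c)" by transfer (simp add: add.assoc)
  show "a + b = b + a" by transfer (simp add: add.commute)
  show "0 + a = a" by transfer simp
  show "- a + a = 0" by transfer simp
  show "a - b = a + - b" by transfer simp
  show "r *\<^sub>R (a + b) = r *\<^sub>R a + r *\<^sub>R b" by transfer (simp add: algebra_simps)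
  show "(r + s) *\<^sub>R a = r *\<^sub>R a + s *\<^sub>R a" by transfer (simp add: algebra_simps)
  show "r *\<^sub>R s *\<^sub>R a = (r * s) *\<^sub>R a" by transfer (simp add: algebra_simps)
  show "1 *\<^sub>R a = a" by transfer simp
qed

end

instantiation ell2 :: (type) real_normed_vector
begin

lift_definition norm_ell2 :: "'a ell2 \<Rightarrow> real" is l2norm .

definition sgn_ell2 :: "'a ell2 \<Rightarrow> 'a ell2" where
  "sgn_ell2 u = u /\<^sub>R norm u"
definition dist_ell2 :: "'a ell2 \<Rightarrow> 'a ell2 \<Rightarrow> real" where
  "dist_ell2 u v = norm (u - v)"
definition uniformity_ell2 :: "('a ell2 \<times> 'a ell2) filter" where
  "uniformity_ell2 = (INF e\<in>{0 <..}. principal {(x, y). dist x y < e})"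
definition open_ell2 :: "'a ell2 set \<Rightarrow> bool" where
  "open_ell2 U \<longleftrightarrow> (\<forall>x\<in>U. eventually (\<lambda>(x', y). x' = x \<longrightarrow> y \<in> U) uniformity)"

instance
proof
  fix a b :: "'a ell2" and r :: real
  show "sgn a = inverse (norm a) *\<^sub>R a" by (rule sgn_ell2_def)
  show "dist a b = norm (a - b)" by (rule dist_ell2_def)
  show "(uniformity :: ('a ell2 \<times> 'a ell2) filter) =
          (INF e\<in>{0 <..}. principal {(x, y). dist x y < e})" by (rule uniformity_ell2_def)
  show "open U \<longleftrightarrow> (\<forall>x\<in>U. \<forall>\<^sub>F (x', y) in uniformity. x' = x \<longrightarrow> y \<in> U)" for U :: "'a ell2 set"
    by (rule open_ell2_def)
  show "norm a = 0 \<longleftrightarrow> a = 0"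
    by transfer (auto simp: fun_eq_iff l2norm_eq_0, simp add: l2norm_def)
  show "norm (a + b) \<le> norm a + norm b" by transfer (rule square_summable_add)
  show "norm (r *\<^sub>R a) = \<bar>r\<bar> * norm a" by transfer (simp add: l2norm_cmult)
qed

end

lift_definition scaleC_ell2 :: "complex \<Rightarrow> 'a ell2 \<Rightarrow> 'a ell2"  (infixr "*\<^sub>C" 75)
  is "\<lambda>c f x. c * f x"
  by (rule square_summable_cmult)

interpretation ell2: vector_space scaleC_ell2
  by unfold_locales (transfer, simp add: algebra_simps)+

lift_definition cinner_ell2 :: "'a ell2 \<Rightarrow> 'a ell2 \<Rightarrow> complex"
  is "\<lambda>f g. \<Sum>\<^sub>\<infinity>x. cnj (f x) * g x" .

lift_definition delta_ell2 :: "'a \<Rightarrow> 'a ell2" is "\<lambda>n k. if k = n then 1 else 0"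
  subgoal for n
    unfolding square_summable_def
    by (rule summable_on_cong_neutral[where T = "{n}", THEN iffD2]) auto
  done

text \<open>The power series of the exponential of a bounded operator, applied to a vector;
  the series converges in the norm of \<open>\<ell>\<^sup>2\<close>.\<close>

definition op_exp :: "('a ell2 \<Rightarrow> 'a ell2) \<Rightarrow> 'a ell2 \<Rightarrow> 'a ell2" where
  "op_exp A u = (\<Sum>k. (A ^^ k) u /\<^sub>R fact k)"


section \<open>Schroedinger operators and uniform localization\<close>

text \<open>For bounded potentials, \<open>schrodinger_apply\<close> below shows that the right-hand side is
  square summable, so that the abstraction function is applied inside its domain.\<close>

definition schrodinger :: "(int ^ 'd \<Rightarrow> real) \<Rightarrow> (int ^ 'd) ell2 \<Rightarrow> (int ^ 'd) ell2" where
  "schrodinger V u = Abs_ell2 (\<lambda>n.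
     (\<Sum>l | l1_norm l = 1. ell2_fun u (n + l)) + complex_of_real (V n) * ell2_fun u n)"

lemma schrodinger_apply:
  assumes "\<And>n. \<bar>V n\<bar> \<le> b"
  shows "ell2_fun (schrodinger V u) n =
     (\<Sum>l | l1_norm l = 1. ell2_fun u (n + l)) + complex_of_real (V n) * ell2_fun u n"
proof -
  have u: "square_summable (ell2_fun u)" using ell2_fun[of u] by simp
  have "square_summable (\<lambda>n. (\<Sum>l | l1_norm l = 1. ell2_fun u (n + l))
          + complex_of_real (V n) * ell2_fun u n)"
    by (intro square_summable_add square_summable_sum square_summable_shift
        square_summable_mult[where b = b] u finite_unit_sphere) (simp add: assms)
  then show ?thesis by (simp add: schrodinger_def Abs_ell2_inverse)
qed

definition eigenfunction :: "('a ell2 \<Rightarrow> 'a ell2) \<Rightarrow> 'a ell2 \<Rightarrow> bool" where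
  "eigenfunction A u \<longleftrightarrow> u \<noteq> 0 \<and> (\<exists>E. A u = E *\<^sub>C u)"

definition complete_set :: "'a ell2 set \<Rightarrow> bool" where
  "complete_set S \<longleftrightarrow> closure (ell2.span S) = UNIV"

definition uniformly_localized :: "(int ^ 'd) ell2 set \<Rightarrow> real \<Rightarrow> real \<Rightarrow> bool" where
  "uniformly_localized S r C \<longleftrightarrow> r > 0 \<and>
     (\<forall>u\<in>S. \<exists>m. \<forall>k. cmod (ell2_fun u k) \<le> C * exp (- r * real_of_int (max_norm (k - m))))"

text \<open>Eigenfunctions are normalized.  Without this convention the constant \<^term>\<open>C\<close> would be
  meaningless, because any eigenfunction can be rescaled to satisfy the bound with any given
  positive constant.\<close>

definition has_ULE :: "((int ^ 'd) ell2 \<Rightarrow> (int ^ 'd) ell2) \<Rightarrow> real \<Rightarrow> real \<Rightarrow> bool" where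
  "has_ULE A r C \<longleftrightarrow>
     (\<exists>S. (\<forall>u\<in>S. eigenfunction A u \<and> norm u = 1) \<and> complete_set S \<and> uniformly_localized S r C)"

end

theory Submission
  imports Defs
begin

text \<open>
  The potential is found by solving an inverse spectral problem, following Poeschel: instead of
  computing the eigenvalues of a given operator, one prescribes them.  On the $d$-th power of the
  group of $2$-adic integers let $D$ be an injective Cantor function whose values on an orbit
  separate polynomially, $|D(\omega) - D(\omega + k)| \ge c |k|^{-\tau}$ for all $\omega$ and all
  $k \ne 0$ in the lattice.  For a small multiple $E$ of the hopping term we look for a continuous
  function $Q$ and an invertible operator $U$ near $1$ with exponentially decaying, covariant kernel
  such that $(D + Q + E) U = U D$; the columns of $U$ are then localized eigenfunctions of
  $D + Q + E$ with eigenvalues $D(\omega + m)$, and $e^{-itH} = U e^{-itD} U^{-1}$ has an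
  exponentially decaying kernel, uniformly in $t$.  As $D$ is fixed, the small divisors
  $D(\omega) - D(\omega + k)$ never change during the iteration and no parameters are excluded.

  Given $(D + Q + E) U = U (D + P)$ with $P$ small, set $q = - \mathrm{diag}\, P$ and
  $R = P + U^{-1} q U$, solve $[D, W] = - (R - \mathrm{diag}\, R)$ and replace $U$ by $U (1 + W)$ and
  $Q$ by $Q + q$.  The new error is $(1 + W)^{-1} (\mathrm{diag}\, R + R W)$.  As
  $\mathrm{diag}\, R$ is only a small fixed multiple of $P$, convergence is geometric rather than
  quadratic, but with a ratio as small as desired, which beats the loss
  $\sigma_j^{-\tau} \sim 2^{\tau j}$ from the small divisors.
\<close>

section \<open>The $2$-adic odometer\<close>

text \<open>The kernel entries are continuous functions under the supremum norm, so one identity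
  between kernels is an eigenvalue equation at every phase \<omega> at once, with constants
  independent of \<omega>. The price of working with a small multiple \<epsilon> of the hopping term
  is a large coupling: dividing (D + Q + E) U = U D by \<epsilon> leaves the potential (D + Q) /
  \<epsilon>, with eigenvalues D / \<epsilon>. The exponent is \<tau> = d + 1: the 2^d digit vectors
  at each binary place are written in base 2^(d+1), half of which stays empty as gaps. Completeness
  comes from U U^-1 = 1 alone, which expands each delta in the columns of U, so neither
  orthogonality nor a spectral theorem is invoked. For the same reason the evolution is computed
  from its power series, term by term on absolutely convergent superpositions of
  eigenfunctions.\<close>

definition red :: "nat \<Rightarrow> int ^ 'd \<Rightarrow> int ^ 'd" where
  "red i n = (\<chi> j. n $ j mod 2 ^ i)"

lemma red_nth [simp]: "red i n $ j = n $ j mod 2 ^ i"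
  by (simp add: red_def)

lemma red_red: "i \<le> k \<Longrightarrow> red i (red k n) = red i n"
  by (simp add: vec_eq_iff mod_mod_cancel le_imp_power_dvd)

lemma red_idem [simp]: "red i (red i n) = red i n"
  by (simp add: red_red)

lemma red_add_left: "red i (red i m + n) = red i (m + n)"
  and red_add_right: "red i (m + red i n) = red i (m + n)"
  by (simp_all add: vec_eq_iff mod_simps)

lemma red_minus: "red i (- red i m) = red i (- m)"
  by (simp add: vec_eq_iff mod_simps)

lemma red_zero [simp]: "red i 0 = 0"
  by (simp add: vec_eq_iff)

lemma red_0 [simp]: "red 0 n = 0"
  by (simp add: vec_eq_iff)

lemma finite_range_red: "finite (range (red i :: int ^ 'd \<Rightarrow> int ^ 'd))"
proof (rule finite_subset)
  let ?B = "PiE (UNIV :: 'd set) (\<lambda>_. {0..2 ^ i :: int})"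
  show "range (red i :: int ^ 'd \<Rightarrow> int ^ 'd) \<subseteq> vec_lambda ` ?B"
  proof
    fix v :: "int ^ 'd" assume "v \<in> range (red i)"
    then have "vec_nth v \<in> ?B"
      by (auto intro!: less_imp_le pos_mod_bound simp: red_def)
    then show "v \<in> vec_lambda ` ?B" by (metis imageI vec_nth_inverse)
  qed
  show "finite (vec_lambda ` ?B)" by (intro finite_imageI finite_PiE) auto
qed

text \<open>The inverse limit of the groups (Z/2^i)^d. The condition makes the sequence coherent and
  each \<open>x i\<close> the least nonnegative residue, so points are equal exactly when their
  residues are.\<close>

typedef ('d::finite) odo = "{x :: nat \<Rightarrow> int ^ 'd. \<forall>i. x i = red i (x (Suc i))}"
  morphisms residue Abs_odo
  by (rule exI[of _ "\<lambda>_. 0"]) simp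

setup_lifting type_definition_odo

lemma residue_Suc: "red i (residue x (Suc i)) = residue x i"
  using residue[of x] unfolding mem_Collect_eq by (drule_tac spec[of _ i]) (erule sym)

lemma red_residue: "i \<le> k \<Longrightarrow> red i (residue x k) = residue x i"
proof (induction k rule: dec_induct)
  case base
  show ?case by (metis red_idem residue_Suc)
next
  case (step k)
  then show ?case by (metis red_red residue_Suc)
qed

lemma odo_eqI: "(\<And>i. residue x i = residue y i) \<Longrightarrow> x = y"
  by (simp add: residue_inject[symmetric] fun_eq_iff)

lemma residue_0 [simp]: "residue x 0 = 0"
  using residue_Suc[of 0 x] by simp

instantiation odo :: (finite) ab_group_add
begin

lift_definition zero_odo :: "'a odo" is "\<lambda>_. 0" by simp
lift_definition plus_odo :: "'a odo \<Rightarrow> 'a odo \<Rightarrow> 'a odo" is "\<lambda>x y i. red i (x i + y i)"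
proof -
  fix x y :: "nat \<Rightarrow> int ^ 'a" and i
  assume "\<And>i. x i = red i (x (Suc i))" "\<And>i. y i = red i (y (Suc i))"
  from this[of i] show "red i (x i + y i) = red i (red (Suc i) (x (Suc i) + y (Suc i)))"
    by (simp add: red_add_left red_add_right red_red)
qed
lift_definition uminus_odo :: "'a odo \<Rightarrow> 'a odo" is "\<lambda>x i. red i (- x i)"
proof -
  fix x :: "nat \<Rightarrow> int ^ 'a" and i
  assume "\<And>i. x i = red i (x (Suc i))"
  from this[of i] show "red i (- x i) = red i (red (Suc i) (- x (Suc i)))"
    by (simp add: red_minus red_red)
qed
definition minus_odo :: "'a odo \<Rightarrow> 'a odo \<Rightarrow> 'a odo" where "x - y = x + - y" for x y :: "'a odo"

instance
proof
  fix x y z :: "'a odo"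
  show "x + y + z = x + (y + z)"
    by (rule odo_eqI) (simp add: plus_odo.rep_eq red_add_left red_add_right add.assoc)
  show "x + y = y + x"
    by (rule odo_eqI) (simp add: plus_odo.rep_eq add.commute)
  show "0 + x = x"
    by (rule odo_eqI) (simp add: plus_odo.rep_eq zero_odo.rep_eq red_residue)
  show "- x + x = 0"
    by (rule odo_eqI) (simp add: plus_odo.rep_eq zero_odo.rep_eq uminus_odo.rep_eq red_add_left)
  show "x - y = x + - y" by (rule minus_odo_def)
qed

end

lift_definition odo_of :: "int ^ 'd \<Rightarrow> 'd::finite odo" is "\<lambda>n i. red i n"
  by (simp add: red_red)

lemma odo_of_add: "odo_of (m + n) = odo_of m + odo_of n"
  by (rule odo_eqI) (simp add: plus_odo.rep_eq odo_of.rep_eq red_add_left red_add_right)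

lemma odo_of_0 [simp]: "odo_of 0 = 0"
  by (rule odo_eqI) (simp add: zero_odo.rep_eq odo_of.rep_eq)

lemma odo_of_minus: "odo_of (- n) = - odo_of n"
proof -
  have "odo_of n + odo_of (- n) = 0" unfolding odo_of_add[symmetric] by simp
  then show ?thesis by (simp add: add_eq_0_iff)
qed

lemma residue_cong_add:
  "residue x i = residue y i \<Longrightarrow> residue (x + z) i = residue (y + z) i"
  by (simp add: plus_odo.rep_eq)

section \<open>Digit expansions and the Cantor function\<close>

definition odo_digit :: "'d::finite odo \<Rightarrow> nat \<Rightarrow> 'd \<Rightarrow> bool" where
  "odo_digit x i j \<longleftrightarrow> odd (residue x (Suc i) $ j div 2 ^ i)"

lemma residue_Suc_cong:
  assumes "residue x i = residue y i" "odo_digit x i = odo_digit y i"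
  shows "residue x (Suc i) = residue y (Suc i)"
proof -
  have *: "residue z (Suc i) $ j
      = 2 ^ i * of_bool (odo_digit z i j) + residue z i $ j" for z :: "'a odo" and j
  proof -
    let ?n = "residue z (Suc i) $ j"
    have "?n = red (Suc i) (residue z (Suc i)) $ j" by (simp add: red_residue del: red_nth)
    then have "?n = ?n mod (2 ^ i * 2)" by (simp add: mult.commute)
    also have "\<dots> = 2 ^ i * (?n div 2 ^ i mod 2) + ?n mod 2 ^ i"
      by (rule zmod_zmult2_eq) simp
    also have "?n mod 2 ^ i = residue z i $ j" by (metis residue_Suc red_nth)
    finally show ?thesis by (simp add: odo_digit_def mod_2_eq_odd)
  qed
  show ?thesis by (simp add: vec_eq_iff * assms)
qed

text \<open>An arbitrary numbering of the 2^d digit vectors by 0, ..., 2^d - 1: only injectivity and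
  the range matter.\<close>

definition odo_code :: "('d::finite \<Rightarrow> bool) \<Rightarrow> nat" where
  "odo_code = to_nat_on UNIV"

lemma odo_code_less: "odo_code (b :: 'd::finite \<Rightarrow> bool) < 2 ^ CARD('d)"
proof -
  have "bij_betw (to_nat_on (UNIV :: ('d \<Rightarrow> bool) set)) UNIV {..<card (UNIV :: ('d \<Rightarrow> bool) set)}"
    by (rule to_nat_on_finite) simp
  then have "odo_code b < card (UNIV :: ('d \<Rightarrow> bool) set)"
    by (auto simp: odo_code_def bij_betw_def)
  then show ?thesis by (simp add: card_fun)
qed

lemma odo_code_inj: "odo_code b = odo_code c \<longleftrightarrow> b = c"
  unfolding odo_code_def by (simp add: countable_finite)

text \<open>Twice the number of digit vectors. This leaves gaps: a change of digit at place i moves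
  the sum by at least q^-i, where q is this base, and all later places together by at most half of
  that.\<close>

abbreviation odo_base :: "'d::finite itself \<Rightarrow> real" where
  "odo_base _ \<equiv> 2 ^ Suc CARD('d)"

text \<open>The Cantor function D of the overview: the digit vectors of x, least significant first,
  are read as the digits of a real number. So points that agree modulo a high power of 2 have close
  values.\<close>

definition odo_real :: "'d::finite odo \<Rightarrow> real" where
  "odo_real x = (\<Sum>i. odo_code (odo_digit x i) / odo_base TYPE('d::finite) ^ i)"

lemma odo_digit_diff_le:
  "\<bar>real (odo_code (odo_digit x i)) - real (odo_code (odo_digit y i))\<bar>
    \<le> odo_base TYPE('d::finite) / 2 - 1" for x y :: "'d::finite odo"
proof -
  have "real (odo_code b) \<le> 2 ^ CARD('d) - 1" for b :: "'d \<Rightarrow> bool"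
  proof -
    have "real (Suc (odo_code b)) \<le> real (2 ^ CARD('d))"
      using odo_code_less[of b] by (intro of_nat_mono) simp
    then show ?thesis by simp
  qed
  from this[of "odo_digit x i"] this[of "odo_digit y i"] show ?thesis
    by (simp add: abs_le_iff)
qed

lemma odo_base_ge: "odo_base TYPE('d::finite) \<ge> 4"
proof -
  have "Suc 0 \<le> CARD('d)" by (simp add: Suc_leI)
  then have "(2::real) ^ Suc (Suc 0) \<le> 2 ^ Suc CARD('d)" by (intro power_increasing) auto
  then show ?thesis by simp
qed

lemma summable_odo_real:
  "summable (\<lambda>i. real (odo_code (odo_digit x i)) / odo_base TYPE('d::finite) ^ i)" for x :: "'d::finite odo"
proof (rule summable_comparison_test')
  have "norm (inverse (odo_base TYPE('d::finite))) < 1"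
    using odo_base_ge[where 'd='d] by (simp add: field_simps)
  then show "summable (\<lambda>i. 2 ^ CARD('d) * inverse (odo_base TYPE('d::finite)) ^ i)"
    by (intro summable_mult summable_geometric)
  fix i
  have "real (odo_code (odo_digit x i)) \<le> 2 ^ CARD('d)"
    using odo_code_less[of "odo_digit x i"] by (metis less_imp_le of_nat_le_iff of_nat_numeral of_nat_power)
  then show "norm (real (odo_code (odo_digit x i)) / odo_base TYPE('d::finite) ^ i)
      \<le> 2 ^ CARD('d) * inverse (odo_base TYPE('d::finite)) ^ i"
    by (simp add: field_simps)
qed

text \<open>With q = \<open>odo_base\<close>, a geometric series majorizes the tail: digits differ
  by at most q/2 - 1, and (q/2 - 1) / (1 - 1/q) <= q/2. The factor 1/2 is what
  \<open>odo_real_apart\<close> relies on.\<close>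

lemma odo_tail:
  fixes x y :: "'d::finite odo"
  shows "summable (\<lambda>i. (real (odo_code (odo_digit x (i + I))) - real (odo_code (odo_digit y (i + I))))
        / odo_base TYPE('d::finite) ^ (i + I))" (is "summable ?f")
    and "\<bar>\<Sum>i. (real (odo_code (odo_digit x (i + I))) - real (odo_code (odo_digit y (i + I))))
        / odo_base TYPE('d::finite) ^ (i + I)\<bar> \<le> odo_base TYPE('d::finite) / (2 * odo_base TYPE('d::finite) ^ I)"
proof -
  let ?q = "odo_base TYPE('d::finite)"
  have q: "?q \<ge> 4" by (rule odo_base_ge)
  have r: "norm (inverse ?q) < 1" using q by (simp add: field_simps)
  let ?g = "\<lambda>i. (?q / 2 - 1) / ?q ^ I * inverse ?q ^ i"
  have g: "summable ?g" by (intro summable_mult summable_geometric r)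
  have fg: "norm (?f i) \<le> ?g i" for i
  proof -
    have "norm (?f i) \<le> (?q / 2 - 1) / ?q ^ (i + I)"
      using odo_digit_diff_le[of x "i + I" y] q
      by (simp only: real_norm_def abs_divide power_abs abs_of_nonneg divide_right_mono)
        (intro divide_right_mono, auto)
    then show ?thesis by (simp add: power_add divide_simps mult_ac)
  qed
  have nf: "summable (\<lambda>i. norm (?f i))"
    by (rule summable_comparison_test'[OF g]) (use fg in auto)
  then show "summable ?f" by (rule summable_norm_cancel)
  have "norm (suminf ?f) \<le> (\<Sum>i. norm (?f i))" by (rule summable_norm[OF nf])
  also have "\<dots> \<le> suminf ?g" by (intro suminf_le fg nf g)
  also have "\<dots> = (?q / 2 - 1) / ?q ^ I * (1 / (1 - inverse ?q))"
    by (subst suminf_mult[OF summable_geometric[OF r]]) (simp only: suminf_geometric[OF r])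
  also have "\<dots> \<le> (?q / 2) / ?q ^ I"
  proof -
    have "(?q / 2 - 1) * (1 / (1 - inverse ?q)) \<le> ?q / 2"
      using q by (simp add: field_simps)
    then have "(?q / 2 - 1) * (1 / (1 - inverse ?q)) / ?q ^ I \<le> (?q / 2) / ?q ^ I"
      using q by (intro divide_right_mono) auto
    then show ?thesis by (simp only: times_divide_eq_left)
  qed
  finally show "\<bar>suminf ?f\<bar> \<le> ?q / (2 * ?q ^ I)" by simp
qed

lemma odo_real_diff:
  "odo_real x - odo_real y = (\<Sum>i. (real (odo_code (odo_digit x i)) - real (odo_code (odo_digit y i)))
        / odo_base TYPE('d::finite) ^ i)" for x y :: "'d::finite odo"
  unfolding odo_real_def
  by (subst suminf_diff[OF summable_odo_real summable_odo_real]) (simp only: diff_divide_distrib)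

lemma odo_digit_cong:
  "residue x I = residue y I \<Longrightarrow> i < I \<Longrightarrow> odo_digit x i = odo_digit y i"
  unfolding odo_digit_def fun_eq_iff by (metis Suc_leI red_residue)

lemma odo_real_split:
  fixes x y :: "'d::finite odo"
  assumes "residue x I = residue y I"
  shows "odo_real x - odo_real y
    = (\<Sum>i. (real (odo_code (odo_digit x (i + I))) - real (odo_code (odo_digit y (i + I))))
        / odo_base TYPE('d::finite) ^ (i + I))"
proof -
  let ?f = "\<lambda>i. (real (odo_code (odo_digit x i)) - real (odo_code (odo_digit y i))) / odo_base TYPE('d) ^ i"
  have "summable ?f" using odo_tail(1)[of x 0 y] by (simp only: add_0_right)
  then have "suminf ?f = (\<Sum>i. ?f (i + I)) + sum ?f {..<I}" by (rule suminf_split_initial_segment)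
  moreover have "sum ?f {..<I} = 0"
    by (intro sum.neutral) (use odo_digit_cong[OF assms] in auto)
  ultimately show ?thesis unfolding odo_real_diff by simp
qed

lemma odo_real_close:
  fixes x y :: "'d::finite odo"
  assumes "residue x I = residue y I"
  shows "\<bar>odo_real x - odo_real y\<bar> \<le> odo_base TYPE('d::finite) / (2 * odo_base TYPE('d::finite) ^ I)"
  unfolding odo_real_split[OF assms] by (rule odo_tail(2))

text \<open>At the first place K where the digits differ the sums differ by at least q^-K; the
  places after it take back at most half. Since K < I, what is left is at least the stated bound,
  the same quantity that bounds the distance from above in \<open>odo_real_close\<close>.\<close>

lemma odo_real_apart:
  fixes x y :: "'d::finite odo"
  assumes "residue x I \<noteq> residue y I"
  shows "\<bar>odo_real x - odo_real y\<bar> \<ge> odo_base TYPE('d::finite) / (2 * odo_base TYPE('d::finite) ^ I)"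
proof -
  let ?q = "odo_base TYPE('d::finite)"
  have q: "?q \<ge> 4" by (rule odo_base_ge)
  \<comment> \<open>The least level with different residues is positive because all residues at
    level 0 are 0; so K = J - 1 is the place of the first different digit.\<close>
  define J where "J = (LEAST J. residue x J \<noteq> residue y J)"
  have J: "residue x J \<noteq> residue y J" "J \<le> I"
    unfolding J_def using assms by (rule LeastI, rule Least_le)
  then obtain K where K: "J = Suc K" by (cases J) auto
  have eq: "residue x K = residue y K"
    using not_less_Least[of K "\<lambda>J. residue x J \<noteq> residue y J"] K unfolding J_def by auto
  have "odo_digit x K \<noteq> odo_digit y K" using residue_Suc_cong[OF eq] J K by auto
  then have ne: "odo_code (odo_digit x K) \<noteq> odo_code (odo_digit y K)" by (simp add: odo_code_inj)
  let ?d = "\<lambda>i. real (odo_code (odo_digit x i)) - real (odo_code (odo_digit y i))"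
  have "odo_real x - odo_real y = ?d K / ?q ^ K + (\<Sum>i. ?d (i + J) / ?q ^ (i + J))"
    unfolding odo_real_split[OF eq] K
    by (subst suminf_split_initial_segment[OF odo_tail(1), of _ _ _ 1]) simp
  moreover have "1 \<le> \<bar>?d K\<bar>" using ne by linarith
  then have "1 / ?q ^ K \<le> \<bar>?d K / ?q ^ K\<bar>"
    using q by (simp only: abs_divide power_abs) (intro divide_mono, auto)
  moreover have "\<bar>\<Sum>i. ?d (i + J) / ?q ^ (i + J)\<bar> \<le> ?q / (2 * ?q ^ J)" by (rule odo_tail(2))
  moreover have "?q / (2 * ?q ^ J) = 1 / ?q ^ K / 2" using q by (simp add: K)
  moreover have "?q / (2 * ?q ^ I) \<le> ?q / (2 * ?q ^ J)"
  proof -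
    have "?q ^ J \<le> ?q ^ I" using q J by (intro power_increasing) auto
    then show ?thesis using q by (intro divide_left_mono mult_left_mono mult_pos_pos zero_less_power) auto
  qed
  \<comment> \<open>The reverse triangle inequality: A is the digit term, B the tail, and at least
    half of t survives.\<close>
  moreover have "v \<le> \<bar>D\<bar>"
    if "D = A + B" "t \<le> \<bar>A\<bar>" "\<bar>B\<bar> \<le> u" "u = t / 2" "v \<le> u" for A B D t u v :: real
    using that by linarith
  ultimately show ?thesis by blast
qed

lemma odo_real_inj: "odo_real x = odo_real y \<longleftrightarrow> x = y"
proof
  assume "odo_real x = odo_real y"
  moreover have "odo_base TYPE('a) / (2 * odo_base TYPE('a) ^ I) > 0" for I
    using odo_base_ge[where 'd='a] by (intro divide_pos_pos mult_pos_pos zero_less_power) auto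
  ultimately show "x = y"
    by (intro odo_eqI) (metis odo_real_apart abs_zero diff_self not_le)
qed auto

text \<open>The metric is pulled back from the real line, so \<^const>\<open>odo_real\<close> is an isometric embedding.\<close>

instantiation odo :: (finite) metric_space
begin

definition dist_odo :: "'a odo \<Rightarrow> 'a odo \<Rightarrow> real" where
  "dist_odo x y = \<bar>odo_real x - odo_real y\<bar>"
definition uniformity_odo :: "('a odo \<times> 'a odo) filter" where
  "uniformity_odo = (INF e\<in>{0 <..}. principal {(x, y). dist x y < e})"
definition open_odo :: "'a odo set \<Rightarrow> bool" where
  "open_odo U \<longleftrightarrow> (\<forall>x\<in>U. eventually (\<lambda>(x', y). x' = x \<longrightarrow> y \<in> U) uniformity)"

instance
proof
  fix x y z :: "'a odo"
  show "dist x y = 0 \<longleftrightarrow> x = y" by (simp add: dist_odo_def odo_real_inj)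
  show "dist x y \<le> dist x z + dist y z" by (simp add: dist_odo_def)
qed (auto simp: uniformity_odo_def open_odo_def)

end

lemma continuous_odo_real: "continuous_on UNIV odo_real"
  unfolding continuous_on_iff by (auto simp: dist_odo_def dist_real_def)

text \<open>With \<open>close_residue\<close> this identifies the metric topology with the inverse
  limit topology, whose basic neighbourhoods fix a residue. Continuity of the group operations then
  becomes a statement about residues.\<close>

lemma residue_close:
  fixes x :: "'d::finite odo"
  shows "\<exists>e>0. \<forall>y. dist y x < e \<longrightarrow> residue y i = residue x i"
proof (intro exI conjI allI impI)
  show "odo_base TYPE('d::finite) / (2 * odo_base TYPE('d::finite) ^ i) > 0"
    using odo_base_ge[where 'd='d] by (intro divide_pos_pos mult_pos_pos zero_less_power) auto
  show "residue y i = residue x i"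
    if "dist y x < odo_base TYPE('d::finite) / (2 * odo_base TYPE('d::finite) ^ i)" for y
    using that odo_real_apart[of y i x] unfolding dist_odo_def by linarith
qed

lemma close_residue:
  fixes x :: "'d::finite odo"
  assumes "e > 0"
  shows "\<exists>i. \<forall>y. residue y i = residue x i \<longrightarrow> dist y x < e"
proof -
  let ?q = "odo_base TYPE('d::finite)"
  have q: "?q \<ge> 4" by (rule odo_base_ge)
  obtain i where "inverse ?q ^ i < 2 * e / ?q"
    using real_arch_pow_inv[of "2 * e / ?q" "inverse ?q"] q assms by (auto simp: field_simps)
  then have "?q / (2 * ?q ^ i) < e" using q by (simp add: field_simps)
  then show ?thesis
    using odo_real_close[of _ i x] unfolding dist_odo_def by (meson le_less_trans)
qed

lemma continuous_odo_add: "continuous_on UNIV (\<lambda>x :: 'd::finite odo. x + z)"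
  unfolding continuous_on_iff
proof (intro ballI allI impI)
  fix x :: "'d::finite odo" and e :: real assume "e > 0"
  obtain i where i: "\<And>y. residue y i = residue (x + z) i \<Longrightarrow> dist y (x + z) < e"
    using close_residue[OF \<open>e > 0\<close>] by blast
  obtain \<delta> where "\<delta> > 0" "\<And>y. dist y x < \<delta> \<Longrightarrow> residue y i = residue x i"
    using residue_close by blast
  then show "\<exists>\<delta>>0. \<forall>x'\<in>UNIV. dist x' x < \<delta> \<longrightarrow> dist (x' + z) (x + z) < e"
    using i residue_cong_add by blast
qed

section \<open>The maximum norm and the small divisors\<close>

lemma max_norm_ge: "\<bar>k $ j\<bar> \<le> max_norm k"
  unfolding max_norm_def by (intro Max_ge) auto

lemma max_norm_leI: "(\<And>j. \<bar>k $ j\<bar> \<le> b) \<Longrightarrow> max_norm k \<le> b"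
  unfolding max_norm_def by (subst Max_le_iff) auto

lemma max_norm_nonneg: "0 \<le> max_norm k"
  using max_norm_ge[of k] by (meson abs_ge_zero order_trans)

lemma max_norm_minus [simp]: "max_norm (- k) = max_norm k"
  by (simp add: max_norm_def)

lemma max_norm_0 [simp]: "max_norm 0 = 0"
  by (simp add: max_norm_def)

lemma max_norm_triangle: "max_norm (k + l) \<le> max_norm k + max_norm l"
proof (rule max_norm_leI)
  fix j
  show "\<bar>(k + l) $ j\<bar> \<le> max_norm k + max_norm l"
    using max_norm_ge[of k j] max_norm_ge[of l j] by simp
qed

lemma max_norm_pos: "k \<noteq> 0 \<Longrightarrow> max_norm k > 0"
proof -
  assume "k \<noteq> 0"
  then obtain j where "k $ j \<noteq> 0" by (auto simp: vec_eq_iff)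
  then show ?thesis using max_norm_ge[of k j] by simp
qed

text \<open>If 2^I <= |k| < 2^(I+1), a nonzero coordinate of k is not divisible by 2^(I+2), so the
  residues of x and x + k differ at that level and \<open>odo_real_apart\<close> gives a bound of
  order q^-I. As q = 2^(d+1), q^I = (2^I)^(d+1) <= |k|^(d+1), which turns the exponential into a
  power of |k|, uniformly in x.\<close>

lemma odo_real_shift_apart:
  fixes k :: "int ^ 'd" and x :: "'d::finite odo"
  assumes "k \<noteq> 0"
  shows "\<bar>odo_real x - odo_real (x + odo_of k)\<bar>
    \<ge> 1 / (2 * odo_base TYPE('d::finite) * real_of_int (max_norm k) ^ Suc CARD('d))"
proof -
  let ?q = "odo_base TYPE('d::finite)" and ?N = "max_norm k"
  have q: "?q \<ge> 4" by (rule odo_base_ge)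
  have N: "?N > 0" by (rule max_norm_pos[OF assms])
  obtain I where I: "2 ^ I \<le> ?N" "?N < 2 ^ Suc I"
  proof -
    have "int (nat ?N) < 2 ^ nat ?N" by (rule of_nat_less_two_power)
    then have "\<exists>I. ?N < 2 ^ I" using N by (intro exI[of _ "nat ?N"]) simp
    then have l: "?N < 2 ^ (LEAST I. ?N < 2 ^ I)" by (rule LeastI_ex)
    then obtain J where J: "(LEAST I. ?N < 2 ^ I) = Suc J"
      using N by (cases "LEAST I. ?N < 2 ^ I") auto
    then have "\<not> ?N < 2 ^ J" using not_less_Least[of J "\<lambda>I. ?N < 2 ^ I"] by auto
    with l J show ?thesis by (intro that[of J]) auto
  qed
  obtain j where j: "k $ j \<noteq> 0" using assms by (auto simp: vec_eq_iff)
  have ne: "residue x (Suc (Suc I)) \<noteq> residue (x + odo_of k) (Suc (Suc I))"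
  proof
    assume "residue x (Suc (Suc I)) = residue (x + odo_of k) (Suc (Suc I))"
    then have "residue (x + - x) (Suc (Suc I)) = residue (x + odo_of k + - x) (Suc (Suc I))"
      by (rule residue_cong_add)
    then have "red (Suc (Suc I)) k = 0" by (simp add: odo_of.rep_eq zero_odo.rep_eq)
    then have "k $ j mod 2 ^ Suc (Suc I) = 0" by (metis red_nth zero_index)
    then have "2 ^ Suc (Suc I) dvd \<bar>k $ j\<bar>" by (simp add: mod_eq_0_iff_dvd)
    then have "2 ^ Suc (Suc I) \<le> \<bar>k $ j\<bar>" using j by (intro zdvd_imp_le) auto
    also have "\<dots> \<le> ?N" by (rule max_norm_ge)
    also have "\<dots> < 2 ^ Suc (Suc I)" using I by simp
    finally show False by simp
  qed
  have "real_of_int ?N \<ge> 2 ^ I" using I(1) by (metis of_int_le_iff of_int_numeral of_int_power)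
  then have "(2 ^ I) ^ Suc CARD('d) \<le> real_of_int ?N ^ Suc CARD('d)" by (intro power_mono) auto
  moreover have "?q ^ I = (2 ^ I) ^ Suc CARD('d)"
    unfolding power_mult[symmetric] by (simp only: mult.commute)
  ultimately have "?q ^ I \<le> real_of_int ?N ^ Suc CARD('d)" by simp
  then have "1 / (2 * ?q * real_of_int ?N ^ Suc CARD('d)) \<le> 1 / (2 * ?q * ?q ^ I)"
    using q N by (intro divide_left_mono mult_left_mono mult_pos_pos zero_less_power) auto
  also have "\<dots> = ?q / (2 * ?q ^ Suc (Suc I))" using q by simp
  also have "\<dots> \<le> \<bar>odo_real x - odo_real (x + odo_of k)\<bar>"
    by (rule odo_real_apart[OF ne])
  finally show ?thesis .
qed


section \<open>Covariant kernels\<close>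

instance bcontfun :: (metric_space, banach) banach ..

section \<open>Infinite sums and weighted l1 bounds\<close>

lemma infsum_bounded_linear:
  assumes "bounded_linear h" "f summable_on A"
  shows "infsum (\<lambda>x. h (f x)) A = h (infsum f A)"
  by (intro infsumI has_sum_bounded_linear[OF assms(1)] has_sum_infsum assms(2))

lemma has_sum_finite_sum:
  fixes f :: "'i \<Rightarrow> 'k \<Rightarrow> 'a::topological_comm_monoid_add"
  assumes "finite F" "\<And>i. i \<in> F \<Longrightarrow> (f i has_sum s i) A"
  shows "((\<lambda>k. \<Sum>i\<in>F. f i k) has_sum (\<Sum>i\<in>F. s i)) A"
  using assms by (induction F) (auto intro: has_sum_add)

lemma
  fixes f :: "'i \<Rightarrow> 'k \<Rightarrow> 'a::{topological_comm_monoid_add, t2_space}"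
  assumes "finite F" "\<And>i. i \<in> F \<Longrightarrow> f i summable_on A"
  shows summable_on_finite_sum: "(\<lambda>k. \<Sum>i\<in>F. f i k) summable_on A"
    and infsum_finite_sum: "(\<Sum>\<^sub>\<infinity>k\<in>A. \<Sum>i\<in>F. f i k) = (\<Sum>i\<in>F. infsum (f i) A)"
proof -
  have "((\<lambda>k. \<Sum>i\<in>F. f i k) has_sum (\<Sum>i\<in>F. infsum (f i) A)) A"
    using assms by (intro has_sum_finite_sum has_sum_infsum)
  then show "(\<lambda>k. \<Sum>i\<in>F. f i k) summable_on A"
    "(\<Sum>\<^sub>\<infinity>k\<in>A. \<Sum>i\<in>F. f i k) = (\<Sum>i\<in>F. infsum (f i) A)"
    by (auto simp: summable_on_def infsumI)
qed

text \<open>An upper bound for the l1 norm with weight e^(s|k|). Quantifying over finite sets makes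
  the bound include convergence, whereas \<open>infsum\<close> is 0 on a divergent family. A
  relation instead of a norm lets the rate s drop from step to step.\<close>

definition wbound :: "real \<Rightarrow> (int ^ 'd \<Rightarrow> 'b::real_normed_vector) \<Rightarrow> real \<Rightarrow> bool" where
  "wbound s A M \<longleftrightarrow> (\<forall>F. finite F \<longrightarrow> (\<Sum>k\<in>F. norm (A k) * exp (s * real_of_int (max_norm k))) \<le> M)"

lemma wbound_nonneg: "wbound s A M \<Longrightarrow> 0 \<le> M"
  unfolding wbound_def by (metis finite.emptyI sum.empty)

lemma wbound_mono:
  assumes "wbound s A M" "t \<le> s" "M \<le> N"
  shows "wbound t A N"
  unfolding wbound_def
proof (intro allI impI)
  fix F :: "(int ^ 'a) set" assume F: "finite F"
  have "(\<Sum>k\<in>F. norm (A k) * exp (t * real_of_int (max_norm k)))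
      \<le> (\<Sum>k\<in>F. norm (A k) * exp (s * real_of_int (max_norm k)))"
    using assms(2) by (intro sum_mono mult_left_mono) (auto intro!: mult_right_mono max_norm_nonneg)
  also have "\<dots> \<le> N" using assms F unfolding wbound_def by (meson order_trans)
  finally show "(\<Sum>k\<in>F. norm (A k) * exp (t * real_of_int (max_norm k))) \<le> N" .
qed

lemma wbound_dominated:
  assumes "wbound s A M"
    "\<And>k. norm (B k) * exp (t * real_of_int (max_norm k)) \<le> c * (norm (A k) * exp (s * real_of_int (max_norm k)))"
    "c \<ge> 0"
  shows "wbound t B (c * M)"
  unfolding wbound_def
proof (intro allI impI)
  fix F :: "(int ^ 'a) set" assume F: "finite F"
  have "(\<Sum>k\<in>F. norm (B k) * exp (t * real_of_int (max_norm k)))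
      \<le> c * (\<Sum>k\<in>F. norm (A k) * exp (s * real_of_int (max_norm k)))"
    unfolding sum_distrib_left by (intro sum_mono assms(2))
  also have "\<dots> \<le> c * M" using assms F unfolding wbound_def by (intro mult_left_mono) auto
  finally show "(\<Sum>k\<in>F. norm (B k) * exp (t * real_of_int (max_norm k))) \<le> c * M" .
qed

lemma wbound_add:
  assumes "wbound s A M" "wbound s B N"
  shows "wbound s (\<lambda>k. A k + B k) (M + N)"
  unfolding wbound_def
proof (intro allI impI)
  fix F :: "(int ^ 'a) set" assume F: "finite F"
  have "(\<Sum>k\<in>F. norm (A k + B k) * exp (s * real_of_int (max_norm k)))
      \<le> (\<Sum>k\<in>F. norm (A k) * exp (s * real_of_int (max_norm k)) + norm (B k) * exp (s * real_of_int (max_norm k)))"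
    unfolding distrib_right[symmetric] by (intro sum_mono mult_right_mono norm_triangle_ineq) auto
  also have "\<dots> \<le> M + N"
    unfolding sum.distrib using assms F unfolding wbound_def by (intro add_mono) auto
  finally show "(\<Sum>k\<in>F. norm (A k + B k) * exp (s * real_of_int (max_norm k))) \<le> M + N" .
qed

lemma wbound_single:
  assumes "\<And>k. k \<noteq> 0 \<Longrightarrow> A k = 0" "norm (A 0) \<le> M"
  shows "wbound s A M"
  unfolding wbound_def
proof (intro allI impI)
  fix F :: "(int ^ 'a) set" assume F: "finite F"
  have "(\<Sum>k\<in>F. norm (A k) * exp (s * real_of_int (max_norm k)))
      = (\<Sum>k\<in>F. if k = 0 then norm (A 0) else 0)"
    by (intro sum.cong) (auto simp: assms(1))
  also have "\<dots> \<le> M" using assms(2) order_trans[OF norm_ge_zero assms(2)] F by auto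
  finally show "(\<Sum>k\<in>F. norm (A k) * exp (s * real_of_int (max_norm k))) \<le> M" .
qed

lemma wbound_entry: "wbound s A M \<Longrightarrow> norm (A k) * exp (s * real_of_int (max_norm k)) \<le> M"
  unfolding wbound_def by (erule allE[of _ "{k}"]) simp

lemma wbound_tendsto:
  assumes "\<And>n. wbound s (A n) M" "\<And>k. (\<lambda>n. A n k) \<longlonglongrightarrow> L k"
  shows "wbound s L M"
  unfolding wbound_def
proof (intro allI impI)
  fix F :: "(int ^ 'a) set" assume F: "finite F"
  have "(\<lambda>n. \<Sum>k\<in>F. norm (A n k) * exp (s * real_of_int (max_norm k)))
     \<longlonglongrightarrow> (\<Sum>k\<in>F. norm (L k) * exp (s * real_of_int (max_norm k)))"
    by (intro tendsto_intros assms(2))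
  then show "(\<Sum>k\<in>F. norm (L k) * exp (s * real_of_int (max_norm k))) \<le> M"
    by (rule LIMSEQ_le_const2) (use assms(1) F in \<open>auto simp: wbound_def\<close>)
qed

lemma wbound_summable:
  "wbound s A M \<Longrightarrow> (\<lambda>k. norm (A k) * exp (s * real_of_int (max_norm k))) summable_on UNIV"
  unfolding wbound_def by (intro nonneg_bdd_above_summable_on) (auto simp: bdd_above_def)

lemma wbound_infsum_le:
  "wbound s A M \<Longrightarrow> (\<Sum>\<^sub>\<infinity>k. norm (A k) * exp (s * real_of_int (max_norm k))) \<le> M"
  using wbound_summable[of s A M] unfolding wbound_def by (intro infsum_le_finite_sums) auto

section \<open>Twisted convolution\<close>

type_synonym 'd obs = "'d odo \<Rightarrow>\<^sub>C real"

lemma twist_bcontfun: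
  fixes a b :: "'d::finite obs"
  shows "(\<lambda>x. a x * b (x + odo_of k)) \<in> bcontfun"
proof (rule bcontfun_normI)
  have "continuous_on UNIV (\<lambda>x. b (x + odo_of k))"
    by (intro continuous_on_compose2[OF continuous_on_apply_bcontfun continuous_odo_add]) auto
  then show "continuous_on UNIV (\<lambda>x. a x * b (x + odo_of k))"
    by (intro continuous_on_mult) auto
  show "norm (a x * b (x + odo_of k)) \<le> norm a * norm b" for x
    unfolding norm_mult by (intro mult_mono norm_bounded) auto
qed

text \<open>The product rule of a crossed product of functions by lattice translations: after a jump
  by k, the second factor is evaluated at the shifted point.\<close>

definition twist :: "int ^ 'd \<Rightarrow> 'd::finite obs \<Rightarrow> 'd obs \<Rightarrow> 'd obs" where
  "twist k a b = Bcontfun (\<lambda>x. a x * b (x + odo_of k))"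

lemma twist_apply: "twist k a b x = a x * b (x + odo_of k)"
  by (simp add: twist_def Bcontfun_inverse twist_bcontfun)

lemma norm_twist: "norm (twist k a b) \<le> norm a * norm b"
  unfolding real_norm_def[symmetric]
  by (rule norm_bound) (simp only: twist_apply norm_mult mult_mono norm_bounded norm_ge_zero)

lemma bounded_bilinear_twist: "bounded_bilinear (twist k)"
proof
  show "\<exists>K. \<forall>a b. norm (twist k a b) \<le> norm a * norm b * K"
    by (rule exI[of _ 1]) (simp add: norm_twist)
qed (rule bcontfun_eqI, simp add: twist_apply algebra_simps)+

lemma twist_twist: "twist j a (twist k b c) = twist (j + k) (twist j a b) c"
  by (rule bcontfun_eqI) (simp add: twist_apply odo_of_add add.assoc)

lemmas bounded_linear_twist_left = bounded_bilinear.bounded_linear_left[OF bounded_bilinear_twist]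
lemmas bounded_linear_twist_right = bounded_bilinear.bounded_linear_right[OF bounded_bilinear_twist]

definition conv :: "(int ^ 'd \<Rightarrow> 'd::finite obs) \<Rightarrow> (int ^ 'd \<Rightarrow> 'd obs) \<Rightarrow> int ^ 'd \<Rightarrow> 'd obs" where
  "conv A B m = (\<Sum>\<^sub>\<infinity>k. twist k (A k) (B (m - k)))"

lemma wbound_0_summable: "wbound 0 A M \<Longrightarrow> (\<lambda>k. norm (A k)) summable_on UNIV"
  using wbound_summable[of 0 A M] by simp

lemma wbound_0_norm: "wbound 0 A M \<Longrightarrow> norm (A k) \<le> M"
  using wbound_entry[of 0 A M] by simp

lemma conv_summable:
  assumes "wbound 0 A M" "wbound 0 B N"
  shows "(\<lambda>k. norm (twist k (A k) (B (m - k)))) summable_on UNIV"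
proof (rule Infinite_Sum.abs_summable_on_comparison_test')
  show "(\<lambda>k. norm (A k) * N) summable_on UNIV"
    using wbound_0_summable[OF assms(1)] by (rule summable_on_cmult_left)
  show "norm (twist k (A k) (B (m - k))) \<le> norm (A k) * N" for k
    using norm_twist[of k "A k" "B (m - k)"] wbound_0_norm[OF assms(2), of "m - k"]
    by (meson mult_left_mono norm_ge_zero order_trans)
qed

lemma weight_diff:
  "s \<ge> 0 \<Longrightarrow> exp (s * real_of_int (max_norm m))
     \<le> exp (s * real_of_int (max_norm k)) * exp (s * real_of_int (max_norm (m - k)))"
  using max_norm_triangle[of k "m - k"]
  unfolding exp_add[symmetric] distrib_left[symmetric] by (auto intro!: mult_left_mono)

text \<open>The weight e^(s|m|) is submultiplicative (\<open>weight_diff\<close>), so the claim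
  reduces to the scalar sequences a and b, where it is Young's inequality for l1. Only a finite sum
  over m is moved past the sum over k.\<close>

lemma wbound_conv:
  assumes s: "s \<ge> 0" and A: "wbound s A M" and B: "wbound s B N"
  shows "wbound s (conv A B) (M * N)"
  unfolding wbound_def
proof (intro allI impI)
  fix F :: "(int ^ 'a) set" assume F: "finite F"
  define a where "a k = norm (A k) * exp (s * real_of_int (max_norm k))" for k
  define b where "b k = norm (B k) * exp (s * real_of_int (max_norm k))" for k
  have a: "a summable_on UNIV" unfolding a_def by (rule wbound_summable[OF A])
  have ab0: "0 \<le> a k" "0 \<le> b k" for k by (simp_all add: a_def b_def)
  have bN: "(\<Sum>k\<in>F. b k) \<le> N" if "finite F" for F
    using B that unfolding wbound_def b_def by blast
  have bN1: "b k \<le> N" for k using bN[of "{k}"] by simp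
  have ab: "(\<lambda>k. a k * b (m - k)) summable_on UNIV" for m
    by (rule summable_on_comparison_test[OF summable_on_cmult_left[OF a, of N]])
      (use ab0 bN1 in \<open>auto intro!: mult_left_mono\<close>)
  have A0: "wbound 0 A M" and B0: "wbound 0 B N" using A B s by (auto intro: wbound_mono)
  have c: "norm (conv A B m) * exp (s * real_of_int (max_norm m)) \<le> (\<Sum>\<^sub>\<infinity>k. a k * b (m - k))" for m
  proof -
    let ?t = "\<lambda>k. twist k (A k) (B (m - k))" and ?e = "exp (s * real_of_int (max_norm m))"
    have t: "(\<lambda>k. norm (?t k)) summable_on UNIV" by (rule conv_summable[OF A0 B0])
    have "norm (conv A B m) * ?e \<le> (\<Sum>\<^sub>\<infinity>k. norm (?t k)) * ?e"
      unfolding conv_def by (intro mult_right_mono norm_infsum_bound t) auto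
    also have "\<dots> = (\<Sum>\<^sub>\<infinity>k. norm (?t k) * ?e)"
      by (rule infsum_cmult_left[symmetric]) (use t in auto)
    also have "\<dots> \<le> (\<Sum>\<^sub>\<infinity>k. a k * b (m - k))"
    proof (rule infsum_mono)
      show "(\<lambda>k. norm (?t k) * ?e) summable_on UNIV" using t by (rule summable_on_cmult_left)
      show "norm (?t k) * ?e \<le> a k * b (m - k)" for k
        using mult_mono[OF norm_twist[of k "A k" "B (m - k)"] weight_diff[OF s, of m k]]
        by (simp add: a_def b_def mult_ac)
    qed (rule ab)
    finally show ?thesis .
  qed
  have "(\<Sum>m\<in>F. norm (conv A B m) * exp (s * real_of_int (max_norm m)))
      \<le> (\<Sum>m\<in>F. \<Sum>\<^sub>\<infinity>k. a k * b (m - k))" by (intro sum_mono c)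
  also have "\<dots> = (\<Sum>\<^sub>\<infinity>k. \<Sum>m\<in>F. a k * b (m - k))"
    by (intro infsum_finite_sum[symmetric] ab F)
  also have "\<dots> \<le> (\<Sum>\<^sub>\<infinity>k. a k * N)"
  proof (rule infsum_mono)
    have "(\<Sum>m\<in>F. b (m - k)) = (\<Sum>m\<in>(\<lambda>m. m - k) ` F. b m)" for k
      by (subst sum.reindex) (auto simp: inj_on_def)
    also have "(\<Sum>m\<in>(\<lambda>m. m - k) ` F. b m) \<le> N" for k using F by (intro bN) auto
    finally show "(\<Sum>m\<in>F. a k * b (m - k)) \<le> a k * N" for k
      unfolding sum_distrib_left[symmetric] by (intro mult_left_mono ab0)
    show "(\<lambda>k. \<Sum>m\<in>F. a k * b (m - k)) summable_on UNIV" by (intro summable_on_finite_sum F ab)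
    show "(\<lambda>k. a k * N) summable_on UNIV" using a by (rule summable_on_cmult_left)
  qed
  also have "\<dots> = (\<Sum>\<^sub>\<infinity>k. a k) * N" by (rule infsum_cmult_left) (use a in auto)
  also have "\<dots> \<le> M * N"
    using wbound_infsum_le[OF A] wbound_nonneg[OF B] unfolding a_def by (rule mult_right_mono)
  finally show "(\<Sum>m\<in>F. norm (conv A B m) * exp (s * real_of_int (max_norm m))) \<le> M * N" .
qed

text \<open>Both sides add up the same products over paths 0, i, k, m; \<open>G i k\<close> is the
  product along one path. Absolute summability over the pairs (i, k) allows the exchange of the two
  sums.\<close>

lemma conv_assoc:
  assumes A: "wbound 0 A L" and B: "wbound 0 B M" and C: "wbound 0 C N"
  shows "conv (conv A B) C m = conv A (conv B C) m"
proof -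
  define G where "G i k = twist i (A i) (twist (k - i) (B (k - i)) (C (m - k)))" for i k
  have "(\<lambda>p. norm (case p of (i, k) \<Rightarrow> G i k)) summable_on UNIV \<times> UNIV"
  proof (rule Infinite_Sum.abs_summable_on_Sigma_iff[THEN iffD2], intro conjI ballI)
    have n: "norm (G i k) \<le> norm (A i) * (norm (B (k - i)) * N)" for i k
    proof -
      have "norm (G i k) \<le> norm (A i) * norm (twist (k - i) (B (k - i)) (C (m - k)))"
        unfolding G_def by (rule norm_twist)
      also have "\<dots> \<le> norm (A i) * (norm (B (k - i)) * norm (C (m - k)))"
        by (intro mult_left_mono norm_twist) auto
      also have "\<dots> \<le> norm (A i) * (norm (B (k - i)) * N)"
        by (intro mult_left_mono wbound_0_norm[OF C]) auto
      finally show ?thesis .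
    qed
    have sh: "(\<lambda>k. norm (B (k - i))) summable_on UNIV" "(\<Sum>\<^sub>\<infinity>k. norm (B (k - i))) = (\<Sum>\<^sub>\<infinity>k. norm (B k))" for i
    proof -
      have bij: "bij_betw (\<lambda>k. k - i) UNIV UNIV"
        by (rule bij_betw_byWitness[of _ "\<lambda>k. k + i"]) auto
      show "(\<lambda>k. norm (B (k - i))) summable_on UNIV"
        using wbound_0_summable[OF B] summable_on_reindex_bij_betw[OF bij, of "\<lambda>k. norm (B k)"] by simp
      show "(\<Sum>\<^sub>\<infinity>k. norm (B (k - i))) = (\<Sum>\<^sub>\<infinity>k. norm (B k))"
        by (rule infsum_reindex_bij_betw[OF bij, of "\<lambda>k. norm (B k)"])
    qed
    have s1: "(\<lambda>k. norm (A i) * (norm (B (k - i)) * N)) summable_on UNIV" for i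
      by (intro summable_on_cmult_right summable_on_cmult_left sh)
    have s2: "(\<lambda>k. norm (G i k)) summable_on UNIV" for i
      using n by (intro summable_on_comparison_test[OF s1]) auto
    then show "(\<lambda>y. norm (case (i, y) of (i, k) \<Rightarrow> G i k)) summable_on UNIV" for i by simp
    have n2: "(\<Sum>\<^sub>\<infinity>k. norm (G i k)) \<le> norm (A i) * ((\<Sum>\<^sub>\<infinity>k. norm (B k)) * N)" for i
    proof -
      have "(\<Sum>\<^sub>\<infinity>k. norm (G i k)) \<le> (\<Sum>\<^sub>\<infinity>k. norm (A i) * (norm (B (k - i)) * N))"
        by (intro infsum_mono s1 s2 n)
      also have "\<dots> = norm (A i) * ((\<Sum>\<^sub>\<infinity>k. norm (B k)) * N)"
        by (simp add: infsum_cmult_right' infsum_cmult_left' sh(2))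
      finally show ?thesis .
    qed
    have "(\<lambda>i. \<Sum>\<^sub>\<infinity>k. norm (G i k)) summable_on UNIV"
      by (rule summable_on_comparison_test[OF summable_on_cmult_left[OF wbound_0_summable[OF A]]])
        (auto intro: n2 infsum_nonneg)
    then show "(\<lambda>x. norm (\<Sum>\<^sub>\<infinity>y. norm (case (x, y) of (i, k) \<Rightarrow> G i k))) summable_on UNIV"
      by (simp add: infsum_nonneg)
  qed
  then have sw: "(\<Sum>\<^sub>\<infinity>i. \<Sum>\<^sub>\<infinity>k. G i k) = (\<Sum>\<^sub>\<infinity>k. \<Sum>\<^sub>\<infinity>i. G i k)"
    by (rule infsum_swap_banach[OF abs_summable_summable])
  have "conv (conv A B) C m = (\<Sum>\<^sub>\<infinity>k. \<Sum>\<^sub>\<infinity>i. twist k (twist i (A i) (B (k - i))) (C (m - k)))"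
    unfolding conv_def[of "conv A B"] conv_def[of A]
    by (rule infsum_cong, rule infsum_bounded_linear[symmetric, OF bounded_linear_twist_left],
        rule abs_summable_summable[OF conv_summable[OF A B]])
  also have "\<dots> = (\<Sum>\<^sub>\<infinity>k. \<Sum>\<^sub>\<infinity>i. G i k)"
    by (intro infsum_cong) (simp add: G_def twist_twist)
  also have "\<dots> = (\<Sum>\<^sub>\<infinity>i. \<Sum>\<^sub>\<infinity>k. G i k)" by (rule sw[symmetric])
  also have "\<dots> = (\<Sum>\<^sub>\<infinity>i. \<Sum>\<^sub>\<infinity>j. G i (j + i))"
  proof (rule infsum_cong)
    fix i :: "int ^ 'a"
    have bij: "bij_betw (\<lambda>j. j + i) UNIV UNIV"
      by (rule bij_betw_byWitness[of _ "\<lambda>k. k - i"]) auto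
    show "(\<Sum>\<^sub>\<infinity>k. G i k) = (\<Sum>\<^sub>\<infinity>j. G i (j + i))"
      by (rule infsum_reindex_bij_betw[OF bij, symmetric])
  qed
  also have "\<dots> = (\<Sum>\<^sub>\<infinity>i. \<Sum>\<^sub>\<infinity>j. twist i (A i) (twist j (B j) (C (m - i - j))))"
    by (simp add: G_def algebra_simps)
  also have "\<dots> = conv A (conv B C) m"
    unfolding conv_def[of A] conv_def[of B]
    by (rule infsum_cong, rule infsum_bounded_linear[OF bounded_linear_twist_right],
        rule abs_summable_summable[OF conv_summable[OF B C]])
  finally show ?thesis .
qed

text \<open>A kernel \<open>A\<close> stands for the covariant family of operators
  \<open>(A\<^sub>\<omega> u)(n) = (\<Sum>k. A k (\<omega> + n) u(n + k))\<close>; \<^const>\<open>conv\<close> is the kernel of the composition.\<close>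

typedef ('d::finite) ker = "{A :: int ^ 'd \<Rightarrow> 'd obs. \<exists>M. wbound 0 A M}"
  morphisms entry Abs_ker
  by (rule exI[of _ "\<lambda>_. 0"]) (auto simp: wbound_def intro!: exI[of _ 0])

setup_lifting type_definition_ker

lemma ker_eqI: "(\<And>k. entry A k = entry B k) \<Longrightarrow> A = B"
  by transfer auto

instantiation ker :: (finite) real_vector
begin

lift_definition zero_ker :: "'a ker" is "\<lambda>_. 0"
  by (auto simp: wbound_def intro!: exI[of _ 0])
lift_definition plus_ker :: "'a ker \<Rightarrow> 'a ker \<Rightarrow> 'a ker" is "\<lambda>A B k. A k + B k"
  using wbound_add by blast
lift_definition scaleR_ker :: "real \<Rightarrow> 'a ker \<Rightarrow> 'a ker" is "\<lambda>r A k. r *\<^sub>R A k"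
  subgoal for r A using wbound_dominated[of 0 A _ "\<lambda>k. r *\<^sub>R A k" 0 "\<bar>r\<bar>"] by (auto simp: mult.assoc)
  done
lift_definition uminus_ker :: "'a ker \<Rightarrow> 'a ker" is "\<lambda>A k. - A k"
  by (auto simp: wbound_def)
definition minus_ker :: "'a ker \<Rightarrow> 'a ker \<Rightarrow> 'a ker" where "A - B = A + - B" for A B :: "'a ker"

instance
proof
  fix A B C :: "'a ker" and r t :: real
  show "A + B + C = A + (B + C)" by transfer (simp add: add.assoc)
  show "A + B = B + A" by transfer (simp add: add.commute)
  show "0 + A = A" by transfer simp
  show "- A + A = 0" by transfer simp
  show "A - B = A + - B" by (rule minus_ker_def)
  show "r *\<^sub>R (A + B) = r *\<^sub>R A + r *\<^sub>R B" by transfer (simp add: algebra_simps)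
  show "(r + t) *\<^sub>R A = r *\<^sub>R A + t *\<^sub>R A" by transfer (simp add: algebra_simps)
  show "r *\<^sub>R t *\<^sub>R A = (r * t) *\<^sub>R A" by transfer simp
  show "1 *\<^sub>R A = A" by transfer simp
qed

end

instantiation ker :: (finite) real_normed_vector
begin

definition norm_ker :: "'a ker \<Rightarrow> real" where "norm_ker A = (\<Sum>\<^sub>\<infinity>k. norm (entry A k))"
definition sgn_ker :: "'a ker \<Rightarrow> 'a ker" where "sgn_ker A = A /\<^sub>R norm A"
definition dist_ker :: "'a ker \<Rightarrow> 'a ker \<Rightarrow> real" where "dist_ker A B = norm (A - B)"
definition uniformity_ker :: "('a ker \<times> 'a ker) filter" where
  "uniformity_ker = (INF e\<in>{0 <..}. principal {(x, y). dist x y < e})"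
definition open_ker :: "'a ker set \<Rightarrow> bool" where
  "open_ker U \<longleftrightarrow> (\<forall>x\<in>U. eventually (\<lambda>(x', y). x' = x \<longrightarrow> y \<in> U) uniformity)"

lemma norm_ker_le_iff: "norm A \<le> M \<longleftrightarrow> wbound 0 (entry A) M" for A :: "'a ker"
proof
  obtain N where N: "wbound 0 (entry A) N" using entry[of A] by auto
  show "wbound 0 (entry A) M" if "norm A \<le> M"
    using finite_sum_le_infsum[OF wbound_0_summable[OF N]] that
    unfolding wbound_def norm_ker_def by (auto intro: order_trans)
  show "norm A \<le> M" if "wbound 0 (entry A) M"
    using wbound_infsum_le[OF that] by (simp add: norm_ker_def)
qed

instance
proof
  fix A B C :: "'a ker" and r t :: real
  show "norm A = 0 \<longleftrightarrow> A = 0"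
  proof
    assume "norm A = 0"
    then have "wbound 0 (entry A) 0" by (simp add: norm_ker_le_iff[symmetric])
    then have "norm (entry A k) \<le> 0" for k by (rule wbound_0_norm)
    then show "A = 0" by (intro ker_eqI) (simp add: zero_ker.rep_eq)
  qed (simp add: norm_ker_def zero_ker.rep_eq)
  show "norm (A + B) \<le> norm A + norm B"
    unfolding norm_ker_le_iff plus_ker.rep_eq
    by (intro wbound_add) (simp_all add: norm_ker_le_iff[symmetric])
  show "norm (r *\<^sub>R A) = \<bar>r\<bar> * norm A"
    by (simp add: norm_ker_def scaleR_ker.rep_eq infsum_cmult_right')
qed (simp_all add: sgn_ker_def dist_ker_def uniformity_ker_def open_ker_def)

end

lemma entry_zero [simp]: "entry 0 k = 0" by (simp add: zero_ker.rep_eq)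
lemma entry_add [simp]: "entry (A + B) k = entry A k + entry B k" by (simp add: plus_ker.rep_eq)
lemma entry_uminus [simp]: "entry (- A) k = - entry A k" by (simp add: uminus_ker.rep_eq)
lemma entry_diff [simp]: "entry (A - B) k = entry A k - entry B k" by (simp only: minus_ker_def entry_add entry_uminus diff_conv_add_uminus)
lemma entry_scaleR [simp]: "entry (r *\<^sub>R A) k = r *\<^sub>R entry A k" by (simp add: scaleR_ker.rep_eq)

lemma norm_entry_le: "norm (entry A k) \<le> norm A"
  using norm_ker_le_iff[of A "norm A"] by (auto intro: wbound_0_norm)

lemma entry_tendsto:
  assumes "(A \<longlongrightarrow> L) F"
  shows "((\<lambda>n. entry (A n) k) \<longlongrightarrow> entry L k) F"
proof (rule tendsto_norm_zero_cancel[THEN LIM_zero_cancel])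
  show "((\<lambda>n. norm (entry (A n) k - entry L k)) \<longlongrightarrow> 0) F"
  proof (rule tendsto_sandwich[OF _ _ tendsto_const])
    show "((\<lambda>n. norm (A n - L)) \<longlongrightarrow> 0) F"
      using assms by (simp add: LIM_zero tendsto_norm_zero)
    show "\<forall>\<^sub>F n in F. norm (entry (A n) k - entry L k) \<le> norm (A n - L)"
      using norm_entry_le[of "A _ - L" k] by (intro always_eventually allI) simp
  qed auto
qed

text \<open>The entries converge because bounded continuous functions are complete. The finite-sum
  form of \<open>wbound\<close> then lets m tend to infinity in the bound on X n - X m, so the
  convergence is in norm.\<close>

instance ker :: (finite) banach
proof
  fix X :: "nat \<Rightarrow> 'a ker"
  assume X: "Cauchy X"
  have "Cauchy (\<lambda>n. entry (X n) k)" for k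
    unfolding Cauchy_iff
  proof (intro allI impI)
    fix e :: real assume "e > 0"
    then obtain N where "\<forall>m\<ge>N. \<forall>n\<ge>N. norm (X m - X n) < e" using X unfolding Cauchy_iff by blast
    moreover have "norm (entry (X m) k - entry (X n) k) \<le> norm (X m - X n)" for m n
      using norm_entry_le[of "X m - X n" k] by simp
    ultimately show "\<exists>N. \<forall>m\<ge>N. \<forall>n\<ge>N. norm (entry (X m) k - entry (X n) k) < e"
      by (meson le_less_trans)
  qed
  then have L: "(\<lambda>n. entry (X n) k) \<longlonglongrightarrow> lim (\<lambda>n. entry (X n) k)" for k
    using Cauchy_convergent convergent_LIMSEQ_iff by blast
  define L where "L k = lim (\<lambda>n. entry (X n) k)" for k
  note L = L[folded L_def]
  have close: "\<exists>N. \<forall>n\<ge>N. wbound 0 (\<lambda>k. entry (X n) k - L k) e" if e: "e > 0" for e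
  proof -
    obtain N where N: "\<forall>n\<ge>N. \<forall>m\<ge>N. norm (X n - X m) < e"
      using X e unfolding Cauchy_iff by blast
    have "wbound 0 (\<lambda>k. entry (X n) k - L k) e" if "n \<ge> N" for n
    proof (rule wbound_tendsto)
      show "wbound 0 (\<lambda>k. entry (X n) k - entry (X (m + N)) k) e" for m
        using N[rule_format, of n "m + N"] that norm_ker_le_iff[of "X n - X (m + N)" e]
        by (simp add: less_imp_le wbound_def)
      show "(\<lambda>m. entry (X n) k - entry (X (m + N)) k) \<longlonglongrightarrow> entry (X n) k - L k" for k
        by (intro tendsto_diff tendsto_const LIMSEQ_ignore_initial_segment L)
    qed
    then show ?thesis by blast
  qed
  obtain N where "wbound 0 (\<lambda>k. entry (X N) k - L k) 1" using close[of 1] by auto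
  then have "wbound 0 (\<lambda>k. - (entry (X N) k - L k)) 1" by (simp add: wbound_def norm_minus_commute)
  moreover have "wbound 0 (entry (X N)) (norm (X N))" using norm_ker_le_iff by blast
  ultimately have "wbound 0 (\<lambda>k. - (entry (X N) k - L k) + entry (X N) k) (1 + norm (X N))"
    by (rule wbound_add)
  then have "\<exists>M. wbound 0 L M" by auto
  then have cL: "entry (Abs_ker L) = L" by (simp add: Abs_ker_inverse)
  have "X \<longlonglongrightarrow> Abs_ker L"
    unfolding LIMSEQ_iff
  proof (intro allI impI)
    fix r :: real assume "r > 0"
    then obtain N where N: "\<forall>n\<ge>N. wbound 0 (\<lambda>k. entry (X n) k - L k) (r / 2)" using close[of "r / 2"] by auto
    have "norm (X n - Abs_ker L) < r" if "n \<ge> N" for n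
    proof -
      have "norm (X n - Abs_ker L) \<le> r / 2"
        using N that unfolding norm_ker_le_iff wbound_def by (simp add: cL)
      then show ?thesis using \<open>r > 0\<close> by simp
    qed
    then show "\<exists>N. \<forall>n\<ge>N. norm (X n - Abs_ker L) < r" by blast
  qed
  then show "convergent X" by (rule convergentI)
qed

definition diag_fun :: "'d::finite obs \<Rightarrow> int ^ 'd \<Rightarrow> 'd obs" where
  "diag_fun q k = (if k = 0 then q else 0)"

lift_definition diag :: "'d::finite obs \<Rightarrow> 'd ker" is diag_fun
  by (rule exI, rule wbound_single[OF _ order_refl]) (simp add: diag_fun_def)

lemma entry_diag: "entry (diag q) k = (if k = 0 then q else 0)"
  by (simp add: diag.rep_eq diag_fun_def)

lemma infsum_single:
  assumes "\<And>k. k \<noteq> i \<Longrightarrow> f k = 0"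
  shows "infsum f UNIV = f i"
  using infsum_cong_neutral[of UNIV "{i}" f f] assms by auto

instantiation ker :: (finite) real_normed_algebra_1
begin

lift_definition times_ker :: "'a ker \<Rightarrow> 'a ker \<Rightarrow> 'a ker" is conv
  using wbound_conv[of 0] by blast

definition one_ker :: "'a ker" where "one_ker = diag (const_bcontfun 1)"

lemma entry_times: "entry (A * B) m = (\<Sum>\<^sub>\<infinity>k. twist k (entry A k) (entry B (m - k)))" for A B :: "'a ker"
  by (simp add: times_ker.rep_eq conv_def)

lemma entry_times_summable:
  "(\<lambda>k. twist k (entry A k) (entry B (m - k))) summable_on UNIV" for A B :: "'a ker"
proof -
  have "wbound 0 (entry A) (norm A)" "wbound 0 (entry B) (norm B)"
    by (simp_all add: norm_ker_le_iff[symmetric])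
  then show ?thesis by (intro abs_summable_summable[OF conv_summable])
qed

lemma entry_diag_times: "entry (diag q * A) m = twist 0 q (entry A m)" for A :: "'a ker"
  unfolding entry_times
  by (subst infsum_single[of 0]) (auto simp: entry_diag bounded_bilinear.zero_left[OF bounded_bilinear_twist])

text \<open>On this side q is read at the far end x + m, in \<open>entry_diag_times\<close> at x.
  The commutator with \<open>diag odo_obs\<close> therefore multiplies entry m by D(x) - D(x + m),
  the small divisor.\<close>

lemma entry_times_diag: "entry (A * diag q) m = twist m (entry A m) q" for A :: "'a ker"
  unfolding entry_times
  by (subst infsum_single[of m]) (auto simp: entry_diag bounded_bilinear.zero_right[OF bounded_bilinear_twist])

instance
proof
  fix A B C :: "'a ker" and r :: real
  show "A * B * C = A * (B * C)"
  proof (rule ker_eqI)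
    fix k
    have "wbound 0 (entry D) (norm D)" for D :: "'a ker" by (simp add: norm_ker_le_iff[symmetric])
    then show "entry (A * B * C) k = entry (A * (B * C)) k"
      unfolding times_ker.rep_eq by (intro conv_assoc)
  qed
  show "(A + B) * C = A * C + B * C"
    by (rule ker_eqI) (simp add: entry_times infsum_add[symmetric] entry_times_summable
        bounded_bilinear.add_left[OF bounded_bilinear_twist])
  show "A * (B + C) = A * B + A * C"
    by (rule ker_eqI) (simp add: entry_times infsum_add[symmetric] entry_times_summable
        bounded_bilinear.add_right[OF bounded_bilinear_twist])
  show "r *\<^sub>R A * B = r *\<^sub>R (A * B)"
    by (rule ker_eqI) (simp add: entry_times entry_times_summable
        bounded_bilinear.scaleR_left[OF bounded_bilinear_twist]
        infsum_bounded_linear[OF bounded_linear_scaleR_right])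
  show "A * r *\<^sub>R B = r *\<^sub>R (A * B)"
    by (rule ker_eqI) (simp add: entry_times entry_times_summable
        bounded_bilinear.scaleR_right[OF bounded_bilinear_twist]
        infsum_bounded_linear[OF bounded_linear_scaleR_right])
  have tw: "twist 0 (const_bcontfun 1) a = a" "twist k a (const_bcontfun 1) = a" for a :: "'a obs" and k
    by (rule bcontfun_eqI, simp add: twist_apply const_bcontfun.rep_eq)+
  show "1 * A = A" by (rule ker_eqI) (simp add: one_ker_def entry_diag_times tw)
  show "A * 1 = A" by (rule ker_eqI) (simp add: one_ker_def entry_times_diag tw)
  have n1: "norm (const_bcontfun 1 :: 'a obs) = 1"
  proof (rule antisym)
    show "norm (const_bcontfun 1 :: 'a obs) \<le> 1" by (rule norm_bound) (simp add: const_bcontfun.rep_eq)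
    show "1 \<le> norm (const_bcontfun 1 :: 'a obs)"
      using norm_bounded[of "const_bcontfun 1 :: 'a obs" undefined] by (simp add: const_bcontfun.rep_eq)
  qed
  show "norm (1 :: 'a ker) = 1"
    unfolding norm_ker_def one_ker_def
    by (subst infsum_single[of 0]) (auto simp: entry_diag n1)
  then show "(0 :: 'a ker) \<noteq> 1" using norm_zero[where 'a="'a ker"] zero_neq_one[where 'a=real] by metis
  show "norm (A * B) \<le> norm A * norm B"
    unfolding norm_ker_le_iff times_ker.rep_eq
    by (intro wbound_conv) (simp_all add: norm_ker_le_iff[symmetric])
qed

end


section \<open>The iteration\<close>

lemma entry_one: "entry 1 k = (if k = 0 then const_bcontfun 1 else 0)"
  by (simp add: one_ker_def entry_diag)

abbreviation kbound :: "real \<Rightarrow> 'd::finite ker \<Rightarrow> real \<Rightarrow> bool" where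
  "kbound s A M \<equiv> wbound s (entry A) M"

lemma kbound_add: "kbound s A M \<Longrightarrow> kbound s B N \<Longrightarrow> kbound s (A + B) (M + N)"
  unfolding plus_ker.rep_eq by (rule wbound_add)

lemma kbound_uminus: "kbound s (- A) M \<longleftrightarrow> kbound s A M"
  by (simp add: wbound_def)

lemma kbound_mult: "s \<ge> 0 \<Longrightarrow> kbound s A M \<Longrightarrow> kbound s B N \<Longrightarrow> kbound s (A * B) (M * N)"
  unfolding times_ker.rep_eq by (rule wbound_conv)

lemma kbound_diag: "kbound s (diag q) (norm q)"
  by (rule wbound_single) (simp_all add: entry_diag)

lemma kbound_one: "kbound s 1 1"
  by (rule wbound_single) (simp_all add: entry_one norm_bound const_bcontfun.rep_eq)

lemma kbound_scaleR: "kbound s A M \<Longrightarrow> kbound s (r *\<^sub>R A) (\<bar>r\<bar> * M)"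
  by (rule wbound_dominated[of s "entry A"]) (simp_all add: mult.assoc)

lemma kbound_norm: "s \<ge> 0 \<Longrightarrow> kbound s A M \<Longrightarrow> norm A \<le> M"
  unfolding norm_ker_le_iff by (auto intro: wbound_mono)

lemma kbound_entry: "s \<ge> 0 \<Longrightarrow> kbound s A M \<Longrightarrow> norm (entry A k) \<le> M"
  using kbound_norm norm_entry_le order_trans by blast

lemma kbound_tendsto: "(\<And>n. kbound s (A n) M) \<Longrightarrow> A \<longlonglongrightarrow> L \<Longrightarrow> kbound s L M"
  by (rule wbound_tendsto) (auto intro: entry_tendsto)

lemma kbound_offdiag: "kbound s A M \<Longrightarrow> kbound s (A - diag (entry A 0)) M"
  using wbound_dominated[of s "entry A" M "entry (A - diag (entry A 0))" s 1]
  by (simp add: entry_diag)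

lemma diag_add: "diag (p + q) = diag p + diag q"
  by (rule ker_eqI) (simp add: entry_diag)

lemma diag_uminus: "diag (- q) = - diag q"
  by (rule ker_eqI) (simp add: entry_diag)

lemma norm_diag: "norm (diag q) = norm q"
  unfolding norm_ker_def by (subst infsum_single[of 0]) (auto simp: entry_diag)

lemma tendsto_diag:
  assumes "(f \<longlongrightarrow> q) F"
  shows "((\<lambda>n. diag (f n)) \<longlongrightarrow> diag q) F"
proof -
  have "((\<lambda>n. norm (diag (f n) - diag q)) \<longlongrightarrow> 0) F"
    using assms by (simp add: norm_diag diag_add[symmetric] diag_uminus[symmetric]
        diff_conv_add_uminus del: add_uminus_conv_diff)
      (simp add: LIM_zero tendsto_norm_zero)
  then show ?thesis by (rule tendsto_norm_zero_cancel[THEN LIM_zero_cancel])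
qed

lemma neumann:
  fixes Y :: "'a::{real_normed_algebra_1, banach}"
  assumes "norm Y < 1"
  shows "summable (\<lambda>n. Y ^ n)" "(1 - Y) * (\<Sum>n. Y ^ n) = 1" "(\<Sum>n. Y ^ n) * (1 - Y) = 1"
proof -
  show s: "summable (\<lambda>n. Y ^ n)"
    by (rule summable_norm_cancel, rule summable_comparison_test'[OF summable_geometric[of "norm Y"]])
      (use assms in \<open>auto simp: norm_power_ineq\<close>)
  have "(\<Sum>n. Y ^ Suc n) = (\<Sum>n. Y ^ n) - 1" using suminf_split_head[OF s] by simp
  moreover have "(\<Sum>n. Y ^ Suc n) = Y * (\<Sum>n. Y ^ n)" using suminf_mult[OF s, of Y] by simp
  moreover have "(\<Sum>n. Y ^ Suc n) = (\<Sum>n. Y ^ n) * Y"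
    using suminf_mult2[OF s, of Y] by (simp add: power_Suc2 del: power_Suc)
  ultimately show "(1 - Y) * (\<Sum>n. Y ^ n) = 1" "(\<Sum>n. Y ^ n) * (1 - Y) = 1"
    by (simp_all add: algebra_simps)
qed

text \<open>The Neumann series of -W. Weighted bounds are proved for its partial sums, by 1 + 1/2 +
  1/4 + ..., and pass to the limit; then X - 1 = - W X.\<close>

lemma kbound_inverse:
  assumes s: "s \<ge> 0" and W: "kbound s W w" and w: "w \<le> 1 / 2"
  shows "\<exists>X. (1 + W) * X = 1 \<and> X * (1 + W) = 1 \<and> kbound s X 2 \<and> kbound s (X - 1) (2 * w)"
proof -
  have Y: "kbound s (- W) (1 / 2)" using wbound_mono[OF W _ w] by (simp add: kbound_uminus)
  have n: "norm (- W) < 1" using kbound_norm[OF s Y] by simp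
  define X where "X = (\<Sum>n. (- W) ^ n)"
  have pw: "kbound s ((- W) ^ n) ((1 / 2) ^ n)" for n
  proof (induction n)
    case (Suc n)
    show ?case unfolding power_Suc by (rule kbound_mult[OF s Y Suc])
  qed (use kbound_one in simp)
  have ps: "kbound s (\<Sum>i<n. (- W) ^ i) (2 - 2 * (1 / 2) ^ n)" for n
  proof (induction n)
    case 0
    show ?case by (simp add: wbound_def)
  next
    case (Suc n)
    from kbound_add[OF Suc pw[of n]] show ?case by (simp del: entry_add)
  qed
  have "kbound s X 2"
  proof (rule kbound_tendsto)
    show "kbound s (\<Sum>i<n. (- W) ^ i) 2" for n
      by (rule wbound_mono[OF ps[of n]]) auto
    show "(\<lambda>n. \<Sum>i<n. (- W) ^ i) \<longlonglongrightarrow> X"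
      unfolding X_def by (rule summable_LIMSEQ[OF neumann(1)[OF n]])
  qed
  moreover have X1: "(1 + W) * X = 1" "X * (1 + W) = 1"
    using neumann(2,3)[OF n] by (simp_all add: X_def)
  moreover have "kbound s (X - 1) (2 * w)"
  proof -
    have "X - 1 = - (W * X)" using X1(1) by (simp add: algebra_simps eq_neg_iff_add_eq_0)
    then show ?thesis
      using kbound_mult[OF s W \<open>kbound s X 2\<close>] by (simp only: kbound_uminus mult.commute)
  qed
  ultimately show ?thesis by blast
qed

section \<open>Small divisors and the commutator equation\<close>

lemma odo_real_bcontfun: "odo_real \<in> bcontfun"
proof (rule bcontfun_normI[OF continuous_odo_real])
  fix x :: "'a odo"
  show "norm (odo_real x) \<le> \<bar>odo_real (0 :: 'a odo)\<bar> + odo_base TYPE('a)"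
    using odo_real_close[of x 0 0] by simp
qed

definition odo_obs :: "'d::finite obs" where "odo_obs = Bcontfun odo_real"

lemma odo_obs_apply [simp]: "odo_obs x = odo_real x"
  by (simp add: odo_obs_def Bcontfun_inverse odo_real_bcontfun)

text \<open>One term of the exponential series. It pays for the power of |k| in the inverse divisors
  with a loss of decay rate.\<close>

lemma power_le_fact_exp: "0 \<le> x \<Longrightarrow> x ^ n \<le> fact n * exp x" for x :: real
proof -
  assume x: "0 \<le> x"
  have "(\<Sum>i\<in>{n}. x ^ i /\<^sub>R fact i) \<le> exp x"
    unfolding exp_def using x by (intro sum_le_suminf summable_exp_generic) auto
  then show ?thesis by (simp add: field_simps)
qed

text \<open>The factor \<open>2 * odo_base\<close> is from the small divisor bound and the factorial
  from \<open>power_le_fact_exp\<close> with exponent \<tau> = d + 1.\<close>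

abbreviation divisor_const :: "'d::finite itself \<Rightarrow> real" where
  "divisor_const _ \<equiv> 2 * odo_base TYPE('d) * fact (Suc CARD('d))"

text \<open>Entry k of the commutator is (D(x) - D(x + k)) times entry k of W, so W is found by
  division for k \<noteq> 0; at k = 0 this factor is 0, hence the assumption \<open>R0\<close>. The
  inverse divisor grows at most like |k|^\<tau>, and lowering the rate from s to t absorbs this at
  the cost of (s - t)^-\<tau>.\<close>

lemma commutator_solve:
  fixes R :: "'d::finite ker"
  assumes R: "kbound s R M" and st: "0 \<le> t" "t < s" and R0: "entry R 0 = 0"
  shows "\<exists>W. diag odo_obs * W - W * diag odo_obs = - R
    \<and> kbound t W (divisor_const TYPE('d) / (s - t) ^ Suc CARD('d) * M)"
proof -
  let ?q = "odo_base TYPE('d)" and ?c = "Suc CARD('d)"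
  define g where "g k x = (if k = 0 then 0 else - (entry R k x / (odo_real x - odo_real (x + odo_of k))))" for k x
  have apart: "odo_real x - odo_real (x + odo_of k) \<noteq> 0" if "k \<noteq> 0" for k :: "int ^ 'd" and x
  proof -
    have "0 < 1 / (2 * ?q * real_of_int (max_norm k) ^ ?c)"
      using max_norm_pos[OF that] by (intro divide_pos_pos mult_pos_pos zero_less_power) auto
    then show ?thesis using odo_real_shift_apart[OF that, of x] by auto
  qed
  have gle: "norm (g k x) \<le> norm (entry R k) * (2 * ?q * real_of_int (max_norm k) ^ ?c)" for k x
  proof (cases "k = 0")
    case False
    let ?N = "2 * ?q * real_of_int (max_norm k) ^ ?c"
    have N: "0 < ?N" using max_norm_pos[OF False] by (intro mult_pos_pos zero_less_power) auto
    have "norm (g k x) = norm (entry R k x) * (1 / \<bar>odo_real x - odo_real (x + odo_of k)\<bar>)"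
      using False by (simp add: g_def)
    also have "\<dots> \<le> norm (entry R k) * ?N"
    proof (intro mult_mono norm_bounded)
      have "1 / d \<le> n" if "1 / n \<le> d" "0 < n" for d n :: real
        using le_imp_inverse_le[OF that(1)] that(2) by (simp add: inverse_eq_divide)
      then show "1 / \<bar>odo_real x - odo_real (x + odo_of k)\<bar> \<le> ?N"
        using odo_real_shift_apart[OF False] N by blast
    qed auto
    finally show ?thesis .
  qed (simp add: g_def)
  have gb: "g k \<in> bcontfun" for k
  proof (rule bcontfun_normI[OF _ gle])
    show "continuous_on UNIV (g k)"
    proof (cases "k = 0")
      case False
      have "continuous_on UNIV (\<lambda>x. - (entry R k x / (odo_real x - odo_real (x + odo_of k))))"
        by (intro continuous_intros continuous_odo_real continuous_on_apply_bcontfun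
            continuous_on_compose2[OF continuous_odo_real continuous_odo_add])
          (use apart[OF False] in auto)
      then show ?thesis using False by (simp add: g_def[abs_def])
    qed (simp add: g_def[abs_def])
  qed
  define G where "G k = Bcontfun (g k)" for k
  have G: "G k x = g k x" for k x by (simp add: G_def Bcontfun_inverse gb)
  have Gb: "wbound t G (divisor_const TYPE('d) / (s - t) ^ ?c * M)"
  proof (rule wbound_dominated[OF R])
    fix k :: "int ^ 'd"
    let ?m = "real_of_int (max_norm k)"
    have m0: "0 \<le> ?m" using max_norm_nonneg[of k] by simp
    have "((s - t) * ?m) ^ ?c \<le> fact ?c * exp ((s - t) * ?m)"
      using st m0 by (intro power_le_fact_exp) auto
    then have m: "?m ^ ?c \<le> fact ?c / (s - t) ^ ?c * exp ((s - t) * ?m)"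
      using st unfolding power_mult_distrib by (simp add: field_simps)
    have "norm (G k) * exp (t * ?m) \<le> norm (entry R k) * (2 * ?q * ?m ^ ?c) * exp (t * ?m)"
      by (intro mult_right_mono norm_bound) (use gle G in auto)
    also have "\<dots> \<le> norm (entry R k) * (2 * ?q * (fact ?c / (s - t) ^ ?c * exp ((s - t) * ?m))) * exp (t * ?m)"
      by (intro mult_right_mono mult_left_mono m) auto
    also have "\<dots> = divisor_const TYPE('d) / (s - t) ^ ?c * (norm (entry R k) * (exp ((s - t) * ?m) * exp (t * ?m)))"
      by (simp only: times_divide_eq_left times_divide_eq_right mult_ac)
    also have "exp ((s - t) * ?m) * exp (t * ?m) = exp (s * ?m)"
      unfolding exp_add[symmetric] by (simp add: algebra_simps)
    finally show "norm (G k) * exp (t * ?m) \<le> divisor_const TYPE('d) / (s - t) ^ ?c * (norm (entry R k) * exp (s * ?m))" .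
  qed (use st in simp)
  then have "wbound 0 G (divisor_const TYPE('d) / (s - t) ^ ?c * M)" by (rule wbound_mono) (use st in auto)
  then have E: "entry (Abs_ker G) = G" by (intro Abs_ker_inverse) auto
  have "diag odo_obs * Abs_ker G - Abs_ker G * diag odo_obs = - R"
  proof (rule ker_eqI, rule bcontfun_eqI)
    fix k x
    show "entry (diag odo_obs * Abs_ker G - Abs_ker G * diag odo_obs) k x = entry (- R) k x"
    proof (cases "k = 0")
      case True
      then show ?thesis by (simp add: entry_diag_times entry_times_diag twist_apply E G g_def R0)
    next
      case False
      have "odo_real x * g k x - g k x * odo_real (x + odo_of k)
          = g k x * (odo_real x - odo_real (x + odo_of k))"
        by (simp only: right_diff_distrib mult.commute)
      also have "\<dots> = - entry R k x"
        using apart[OF False, of x] False by (simp add: g_def del: right_diff_distrib)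
      finally have "odo_real x * g k x - g k x * odo_real (x + odo_of k) = - entry R k x" .
      then show ?thesis by (simp add: entry_diag_times entry_times_diag twist_apply E G)
    qed
  qed
  with Gb show ?thesis by (intro exI[of _ "Abs_ker G"]) (simp only: E simp_thms)
qed

text \<open>The numbers: A bounds the distance of U and V from 1, and w the correction W. The new
  error 6 p (A + w) is linear in p since A does not shrink, but A and w are small. The 3 p bounds R
  through p + (1 + A)^2 p, and 6 = 2 * 3 has its 2 from the bound on X, the inverse of 1 +
  W.\<close>

lemma kam_step:
  fixes U V P E :: "'d::finite ker" and Q :: "'d obs"
  assumes eq: "(diag odo_obs + diag Q + E) * U = U * (diag odo_obs + P)"
    and inv: "U * V = 1" "V * U = 1"
    and st: "0 \<le> t" "t < s"
    and P: "kbound s P p" and U: "kbound s (U - 1) A" and V: "kbound s (V - 1) A"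
    and A: "A \<le> 1 / 4"
    and w: "divisor_const TYPE('d) / (s - t) ^ Suc CARD('d) * (3 * p) \<le> w" "w \<le> 1 / 2"
  shows "\<exists>U' V' Q' P'. (diag odo_obs + diag Q' + E) * U' = U' * (diag odo_obs + P')
    \<and> U' * V' = 1 \<and> V' * U' = 1 \<and> kbound t P' (6 * p * (A + w))
    \<and> kbound t (U' - 1) (A + 4 * w) \<and> kbound t (V' - 1) (A + 4 * w)
    \<and> norm (U' - U) \<le> 4 * w \<and> norm (V' - V) \<le> 4 * w \<and> norm (Q' - Q) \<le> p"
proof -
  have s: "0 \<le> s" using st by simp
  have A0: "0 \<le> A" using U by (rule wbound_nonneg)
  have p0: "0 \<le> p" using P by (rule wbound_nonneg)
  define q where "q = - entry P 0"
  have qp: "norm q \<le> p" unfolding q_def using kbound_entry[OF s P, of 0] by simp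
  have q: "kbound s (diag q) p" by (rule wbound_mono[OF kbound_diag order_refl qp])
  have U1: "kbound s U (A + 1)" using kbound_add[OF U kbound_one] by simp
  have V1: "kbound s V (A + 1)" using kbound_add[OF V kbound_one] by simp
  \<comment> \<open>This is V (diag q) U - diag q: each term has a factor V - 1 or U - 1, so Z is of
    size A p. As q cancels the diagonal of P, the diagonal of R is that of Z, which is why it is
    small compared with p.\<close>
  define Z where "Z = (V - 1) * diag q * U + diag q * (U - 1)"
  have Z: "kbound s Z (A * p * (A + 1) + p * A)"
    unfolding Z_def by (intro kbound_add kbound_mult s U V q U1)
  define R where "R = P + V * diag q * U"
  have RZ: "R = P + diag q + Z" unfolding R_def Z_def by (simp add: algebra_simps)
  have R0: "entry R 0 = entry Z 0" by (simp add: RZ q_def entry_diag)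
  have Asq: "A * A \<le> 1 / 4 * (1 / 4)" using A A0 by (intro mult_mono) auto
  have Zle: "A * p * (A + 1) + p * A \<le> 3 * A * p"
  proof -
    have "A * p * (A + 1) \<le> A * p * 2"
      using A by (intro mult_left_mono mult_nonneg_nonneg A0 p0) simp
    then have "A * p * (A + 1) + p * A \<le> A * p * 2 + p * A" by (rule add_right_mono)
    also have "\<dots> = 3 * A * p" by simp
    finally show ?thesis .
  qed
  have dR: "kbound s (diag (entry R 0)) (3 * A * p)"
    unfolding R0 by (rule wbound_mono[OF kbound_diag order_refl order_trans[OF kbound_entry[OF s Z] Zle]])
  have R: "kbound s R (3 * p)"
  proof -
    have "kbound s R (p + (A + 1) * p * (A + 1))"
      unfolding R_def by (intro kbound_add kbound_mult s P V1 U1 q)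
    moreover have "(A + 1) * (A + 1) \<le> 2" using Asq A by (simp add: algebra_simps)
    then have "(A + 1) * (A + 1) * p \<le> 2 * p" using p0 by (intro mult_right_mono)
    then have "p + (A + 1) * p * (A + 1) \<le> 3 * p" by (simp add: algebra_simps)
    ultimately show ?thesis by (auto intro: wbound_mono)
  qed
  define R' where "R' = R - diag (entry R 0)"
  have "kbound s R' (3 * p)" unfolding R'_def by (rule kbound_offdiag[OF R])
  moreover have "entry R' 0 = 0" by (simp add: R'_def entry_diag)
  ultimately obtain W where comm: "diag odo_obs * W - W * diag odo_obs = - R'"
    and W': "kbound t W (divisor_const TYPE('d) / (s - t) ^ Suc CARD('d) * (3 * p))"
    using commutator_solve st by blast
  have W: "kbound t W w" by (rule wbound_mono[OF W' order_refl w(1)])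
  have w0: "0 \<le> w" using W by (rule wbound_nonneg)
  obtain X where X: "(1 + W) * X = 1" "X * (1 + W) = 1" "kbound t X 2" "kbound t (X - 1) (2 * w)"
    using kbound_inverse[OF st(1) W w(2)] by blast
  note lower = wbound_mono[OF _ less_imp_le[OF st(2)] order_refl]
  define P' where "P' = X * (diag (entry R 0) + R * W)"
  \<comment> \<open>Regrouped so that the commutator stands next to R'; their sum is zero by the
    choice of W.\<close>
  have "(diag odo_obs + R) * (1 + W) = diag odo_obs + (R - R') + (W * diag odo_obs + (diag odo_obs * W - W * diag odo_obs + R')) + R * W"
    by (simp add: algebra_simps)
  also have "\<dots> = (1 + W) * diag odo_obs + (diag (entry R 0) + R * W)"
    unfolding comm by (simp add: R'_def algebra_simps)
  also have "diag (entry R 0) + R * W = (1 + W) * P'"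
    unfolding P'_def mult.assoc[symmetric] X(1) by simp
  finally have key: "(diag odo_obs + R) * (1 + W) = (1 + W) * (diag odo_obs + P')"
    by (simp only: distrib_left)
  \<comment> \<open>Because U V = 1, the added potential satisfies q U = U (V q U), so on the right
    of U it contributes the second summand of R.\<close>
  have "(diag odo_obs + diag (Q + q) + E) * (U * (1 + W))
      = ((diag odo_obs + diag Q + E) * U + diag q * U) * (1 + W)"
    by (simp add: diag_add algebra_simps)
  also have "\<dots> = (U * (diag odo_obs + P) + (U * V) * diag q * U) * (1 + W)"
    unfolding eq inv by simp
  also have "\<dots> = U * ((diag odo_obs + R) * (1 + W))"
    unfolding R_def by (simp add: algebra_simps)
  also have "\<dots> = U * (1 + W) * (diag odo_obs + P')" unfolding key by (simp add: mult.assoc)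
  finally have eq': "(diag odo_obs + diag (Q + q) + E) * (U * (1 + W)) = U * (1 + W) * (diag odo_obs + P')" .
  have inv': "U * (1 + W) * (X * V) = 1" "X * V * (U * (1 + W)) = 1"
  proof -
    have "U * (1 + W) * (X * V) = U * ((1 + W) * X) * V" by (simp only: mult.assoc)
    then show "U * (1 + W) * (X * V) = 1" by (simp add: X inv)
    have "X * V * (U * (1 + W)) = X * (V * U) * (1 + W)" by (simp only: mult.assoc)
    then show "X * V * (U * (1 + W)) = 1" by (simp add: X inv)
  qed
  have bP': "kbound t P' (6 * p * (A + w))"
  proof -
    have "kbound t P' (2 * (3 * A * p + 3 * p * w))"
      unfolding P'_def by (intro kbound_mult kbound_add st X W lower[OF dR] lower[OF R])
    then show ?thesis by (simp add: algebra_simps)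
  qed
  have bU': "kbound t (U * (1 + W) - 1) (A + 4 * w)"
  proof -
    have "kbound t ((U - 1) * (1 + W) + W) (A * (1 + w) + w)"
      by (intro kbound_mult kbound_add st W lower[OF U] kbound_one)
    moreover have "A * (1 + w) + w \<le> A + 4 * w"
      using mult_right_mono[OF A w0] w0 by (simp add: algebra_simps)
    ultimately show ?thesis by (simp add: algebra_simps) (auto intro: wbound_mono)
  qed
  have X1V: "kbound t ((X - 1) * V) (2 * w * (A + 1))"
    by (intro kbound_mult st X lower[OF V1])
  have le: "2 * w * (A + 1) \<le> 4 * w" "(A + 1) * w \<le> 4 * w"
    using mult_right_mono[OF A w0] w0 by (simp_all add: algebra_simps)
  have bV': "kbound t (X * V - 1) (A + 4 * w)"
  proof -
    have "kbound t ((V - 1) + (X - 1) * V) (A + 2 * w * (A + 1))"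
      by (intro kbound_add lower[OF V] X1V)
    then have "kbound t ((V - 1) + (X - 1) * V) (A + 4 * w)"
      by (rule wbound_mono) (use le in auto)
    then show ?thesis by (simp add: algebra_simps)
  qed
  have nU: "norm (U * (1 + W) - U) \<le> 4 * w"
  proof -
    have "kbound t (U * W) ((A + 1) * w)" by (intro kbound_mult st W lower[OF U1])
    then have "norm (U * W) \<le> 4 * w" using kbound_norm st le by (meson order_trans)
    then show ?thesis by (simp add: algebra_simps)
  qed
  have nV: "norm (X * V - V) \<le> 4 * w"
    using kbound_norm[OF st(1) X1V] le by (simp add: algebra_simps)
  have "norm (Q + q - Q) \<le> p" using qp by simp
  with eq' inv' bP' bU' bV' nU nV show ?thesis by blast
qed

section \<open>The iteration and its limit\<close>

lemma geometric_convergent: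
  fixes x :: "nat \<Rightarrow> 'a::banach"
  assumes "\<And>n. norm (x (Suc n) - x n) \<le> (1 / 2) ^ n"
  shows "\<exists>L. x \<longlonglongrightarrow> L"
proof -
  have "summable (\<lambda>n. x (Suc n) - x n)"
    by (rule summable_norm_cancel, rule summable_comparison_test'[OF summable_geometric[of "1 / 2 :: real"]])
      (use assms in auto)
  then have "(\<lambda>n. \<Sum>i<n. x (Suc i) - x i) \<longlonglongrightarrow> (\<Sum>i. x (Suc i) - x i)" by (rule summable_LIMSEQ)
  then have "(\<lambda>n. x n - x 0) \<longlonglongrightarrow> (\<Sum>i. x (Suc i) - x i)" by (simp add: sum_lessThan_telescope)
  from tendsto_add[OF this tendsto_const[of "x 0"]] show ?thesis by auto
qed

text \<open>The decay rate 1 + 2^-j drops from 2 to 1. The choice of a makes 8 a = 2^-(\<tau>+1) the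
  ratio of successive errors: 2^-\<tau> compensates the divisors, and the remaining 1/2 makes the
  corrections summable. The choice of \<eta> makes the bound w on the first correction equal to a /
  8.\<close>

lemma kam_iterate:
  fixes E :: "'d::finite ker"
  defines "\<tau> \<equiv> Suc CARD('d)"
  defines "a \<equiv> 1 / (16 * 2 ^ \<tau>)"
  defines "\<eta> \<equiv> a / (24 * divisor_const TYPE('d) * 2 ^ \<tau>)"
  assumes E: "kbound 2 E \<eta>"
  shows "\<exists>U V Q. (diag odo_obs + diag Q + E) * U = U * diag odo_obs \<and> U * V = 1 \<and> V * U = 1
    \<and> kbound 1 (U - 1) (1 / 2) \<and> kbound 1 (V - 1) (1 / 2)"
proof -
  let ?K = "divisor_const TYPE('d)"
  have t2: "(2::real) ^ \<tau> \<ge> 1" by simp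
  have K: "?K \<ge> 1"
  proof -
    have "1 * 1 \<le> (2 * odo_base TYPE('d)) * fact (Suc CARD('d))"
      by (intro mult_mono fact_ge_1) (use odo_base_ge[where 'd='d] in linarith)+
    then show ?thesis by simp
  qed
  have a: "0 < a" "a \<le> 1 / 16" using t2 by (simp_all add: a_def field_simps)
  have eta: "0 < \<eta>" "\<eta> \<le> 1" "?K * 2 ^ \<tau> * (3 * \<eta>) = a / 8"
  proof -
    have "1 * 1 \<le> ?K * 2 ^ \<tau>" using K t2 by (intro mult_mono) auto
    then have *: "1 \<le> ?K * 2 ^ \<tau>" by simp
    then have e: "\<eta> = a / (24 * (?K * 2 ^ \<tau>))" by (simp only: \<eta>_def mult.assoc)
    from * a show "0 < \<eta>" unfolding e by (intro divide_pos_pos) linarith+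
    have "a / (24 * (?K * 2 ^ \<tau>)) \<le> a / 1" using * a by (intro divide_left_mono) linarith+
    then show "\<eta> \<le> 1" using a unfolding e by linarith
    have "x * (3 * (a / (24 * x))) = a / 8" if "1 \<le> x" for x :: real using that by (simp add: field_simps)
    from this[OF *] show "?K * 2 ^ \<tau> * (3 * \<eta>) = a / 8" unfolding e .
  qed
  define x :: "nat \<Rightarrow> real" where "x j = (1 / 2) ^ j" for j
  have x: "0 < x j" "x j \<le> 1" "x (Suc j) = x j / 2" for j
    by (simp_all add: x_def power_le_one)
  \<comment> \<open>The factor \<open>x j ^ \<tau>\<close> cancels the loss (x j / 2)^-\<tau> in the
    commutator equation, whose solution is then bounded by w = a / 8 * x j.\<close>
  define p where "p j = \<eta> * (x j * x j ^ \<tau>)" for j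
  have p: "0 \<le> p j" "p j \<le> x j" for j
  proof -
    show "0 \<le> p j" using eta x[of j] by (simp add: p_def)
    have "\<eta> * (x j * x j ^ \<tau>) \<le> 1 * (x j * 1)"
      using eta x[of j] by (intro mult_mono power_le_one) (auto intro: less_imp_le)
    then show "p j \<le> x j" by (simp add: p_def)
  qed
  \<comment> \<open>The distance of U and V from 1 grows by 4 w = a * x j / 2 = a * (x j - x (Suc
    j)) in a step, which telescopes to a * (1 - x j).\<close>
  define Inv where "Inv j S = (case S of (U, V, Q, P) \<Rightarrow>
      (diag odo_obs + diag Q + E) * U = U * (diag odo_obs + P) \<and> U * V = 1 \<and> V * U = 1
      \<and> kbound (1 + x j) P (p j) \<and> kbound (1 + x j) (U - 1) (a * (1 - x j))
      \<and> kbound (1 + x j) (V - 1) (a * (1 - x j)))" for j and S :: "'d ker \<times> 'd ker \<times> 'd obs \<times> 'd ker"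
  define Next where "Next j S S' = (case S of (U, V, Q, P) \<Rightarrow> case S' of (U', V', Q', P') \<Rightarrow>
      norm (U' - U) \<le> x j \<and> norm (V' - V) \<le> x j \<and> norm (Q' - Q) \<le> x j)"
    for j and S S' :: "'d ker \<times> 'd ker \<times> 'd obs \<times> 'd ker"
  have step: "\<exists>S'. Inv (Suc j) S' \<and> Next j S S'" if S: "Inv j S" for j S
  proof -
    obtain U V Q P where S_eq: "S = (U, V, Q, P)" by (cases S)
    define w where "w = a / 8 * x j"
    have w0: "0 \<le> w" using a x[of j] by (simp add: w_def)
    have ax: "a * (1 - x j) \<le> a" "a * x j \<le> a" using a x[of j] by (simp_all add: algebra_simps)
    have d: "(1 + x j) - (1 + x (Suc j)) = x j / 2" by (simp add: x)
    have "?K / ((1 + x j) - (1 + x (Suc j))) ^ Suc CARD('d) * (3 * p j) = ?K * 2 ^ \<tau> * (3 * \<eta>) * x j"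
      using x(1)[of j] unfolding d p_def \<tau>_def[symmetric] power_divide by (simp add: field_simps)
    then have "?K / ((1 + x j) - (1 + x (Suc j))) ^ Suc CARD('d) * (3 * p j) \<le> w"
      unfolding eta(3) w_def by simp
    moreover have "w \<le> 1 / 2" "a * (1 - x j) \<le> 1 / 4"
      using a ax unfolding w_def by linarith+
    moreover have "0 \<le> 1 + x (Suc j)" "1 + x (Suc j) < 1 + x j"
      using x[of j] by auto
    ultimately obtain U' V' Q' P' where
      n: "(diag odo_obs + diag Q' + E) * U' = U' * (diag odo_obs + P')" "U' * V' = 1" "V' * U' = 1"
      "kbound (1 + x (Suc j)) P' (6 * p j * (a * (1 - x j) + w))"
      "kbound (1 + x (Suc j)) (U' - 1) (a * (1 - x j) + 4 * w)"
      "kbound (1 + x (Suc j)) (V' - 1) (a * (1 - x j) + 4 * w)"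
      "norm (U' - U) \<le> 4 * w" "norm (V' - V) \<le> 4 * w" "norm (Q' - Q) \<le> p j"
      using kam_step[of Q E U P V "1 + x (Suc j)" "1 + x j" "p j" "a * (1 - x j)" w] S
      unfolding Inv_def S_eq by auto
    have 1: "a * (1 - x j) + 4 * w = a * (1 - x (Suc j))" by (simp add: w_def x algebra_simps)
    \<comment> \<open>6 (a + a / 8) <= 8 a, and multiplying p j by 8 a gives p (Suc j)
      exactly.\<close>
    have 2: "6 * p j * (a * (1 - x j) + w) \<le> p (Suc j)"
    proof -
      have "6 * p j * (a * (1 - x j) + w) \<le> 6 * p j * (a + a / 8)"
        using p ax by (intro mult_left_mono add_mono) (auto simp: w_def)
      also have "\<dots> \<le> p j * (8 * a)"
      proof -
        have "6 * (a + a / 8) \<le> 8 * a" using a by simp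
        from mult_left_mono[OF this p(1)[of j]] show ?thesis by (simp only: mult_ac)
      qed
      also have "\<dots> = p (Suc j)" by (simp add: p_def x a_def power_divide field_simps)
      finally show ?thesis .
    qed
    have 3: "4 * w \<le> x j" using a mult_right_mono[of a 1 "x j"] x[of j] by (simp add: w_def)
    have "Inv (Suc j) (U', V', Q', P')"
      unfolding Inv_def using n 1 wbound_mono[OF n(4) order_refl 2] by simp
    moreover have "Next j S (U', V', Q', P')"
      unfolding Next_def S_eq using n 3 p[of j] by auto
    ultimately show ?thesis by blast
  qed
  \<comment> \<open>The start is U = V = 1 and Q = 0, with E itself as the error.\<close>
  have "Inv 0 (1, 1, 0, E)"
  proof -
    have "diag 0 = (0 :: 'd ker)" by (rule ker_eqI) (simp add: entry_diag)
    then show ?thesis using E by (simp add: Inv_def x_def p_def wbound_def)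
  qed
  then obtain S where S: "\<And>j. Inv j (S j)" "\<And>j. Next j (S j) (S (Suc j))"
    using dependent_nat_choice[of Inv Next] step by blast
  define U V Q P where "U j = fst (S j)" and "V j = fst (snd (S j))"
    and "Q j = fst (snd (snd (S j)))" and "P j = snd (snd (snd (S j)))" for j
  have S_eq: "S j = (U j, V j, Q j, P j)" for j by (simp add: U_def V_def Q_def P_def)
  have nx: "norm (U (Suc j) - U j) \<le> (1 / 2) ^ j" "norm (V (Suc j) - V j) \<le> (1 / 2) ^ j"
    "norm (Q (Suc j) - Q j) \<le> (1 / 2) ^ j" for j
    using S(2)[of j] by (simp_all add: S_eq Next_def x_def)
  obtain U' where U': "U \<longlonglongrightarrow> U'" using geometric_convergent[OF nx(1)] by blast
  obtain V' where V': "V \<longlonglongrightarrow> V'" using geometric_convergent[OF nx(2)] by blast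
  obtain Q' where Q': "Q \<longlonglongrightarrow> Q'" using geometric_convergent[OF nx(3)] by blast
  have inv: "(diag odo_obs + diag (Q j) + E) * U j = U j * (diag odo_obs + P j)"
    "U j * V j = 1" "V j * U j = 1" "kbound (1 + x j) (P j) (p j)"
    "kbound (1 + x j) (U j - 1) (a * (1 - x j))" "kbound (1 + x j) (V j - 1) (a * (1 - x j))" for j
    using S(1)[of j] unfolding S_eq Inv_def by auto
  have P': "P \<longlonglongrightarrow> 0"
  proof (rule tendsto_norm_zero_cancel, rule tendsto_sandwich[OF _ _ tendsto_const])
    show "x \<longlonglongrightarrow> 0" unfolding x_def by (rule LIMSEQ_power_zero) simp
    show "\<forall>\<^sub>F j in sequentially. norm (P j) \<le> x j"
    proof (intro always_eventually allI)
      fix j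
      have "norm (P j) \<le> p j" using inv(4)[of j] x[of j] by (intro kbound_norm) auto
      then show "norm (P j) \<le> x j" using p(2)[of j] by linarith
    qed
  qed auto
  have "(\<lambda>j. (diag odo_obs + diag (Q j) + E) * U j) \<longlonglongrightarrow> (diag odo_obs + diag Q' + E) * U'"
    by (intro tendsto_intros tendsto_diag U' Q')
  moreover have "(\<lambda>j. U j * (diag odo_obs + P j)) \<longlonglongrightarrow> U' * (diag odo_obs + 0)"
    by (intro tendsto_intros U' P')
  ultimately have "(diag odo_obs + diag Q' + E) * U' = U' * diag odo_obs"
    using LIMSEQ_unique by (auto simp: inv(1))
  moreover have "U' * V' = 1"
    using tendsto_mult[OF U' V'] by (simp add: inv LIMSEQ_const_iff)
  moreover have "V' * U' = 1"
    using tendsto_mult[OF V' U'] by (simp add: inv LIMSEQ_const_iff)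
  moreover have half: "kbound 1 Y (1 / 2)" if "kbound (1 + x j) Y (a * (1 - x j))" for Y :: "'d ker" and j
    using that
  proof (rule wbound_mono)
    show "a * (1 - x j) \<le> 1 / 2" using mult_mono[of a "1 / 16" "1 - x j" 1] a x[of j] by simp
  qed (use x[of j] in simp)
  have "kbound 1 (U' - 1) (1 / 2)"
    by (rule kbound_tendsto[where A = "\<lambda>j. U j - 1"], rule half, rule inv(5))
      (intro tendsto_diff tendsto_const U')
  moreover have "kbound 1 (V' - 1) (1 / 2)"
    by (rule kbound_tendsto[where A = "\<lambda>j. V j - 1"], rule half, rule inv(6))
      (intro tendsto_diff tendsto_const V')
  ultimately show ?thesis by blast
qed


section \<open>Localized bases of eigenfunctions\<close>

lemma summable_on_tail:
  fixes f :: "'a \<Rightarrow> real"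
  assumes "f summable_on UNIV" "\<And>x. 0 \<le> f x" "e > 0"
  obtains F where "finite F" "\<And>F'. finite F' \<Longrightarrow> F' \<inter> F = {} \<Longrightarrow> sum f F' \<le> e"
proof -
  have "(sum f \<longlongrightarrow> infsum f UNIV) (finite_subsets_at_top UNIV)"
    using has_sum_infsum[OF assms(1)] by (simp add: has_sum_def)
  then have "\<forall>\<^sub>F F in finite_subsets_at_top UNIV. dist (sum f F) (infsum f UNIV) < e"
    using assms(3) by (rule tendstoD)
  then obtain F where F: "finite F" "dist (sum f F) (infsum f UNIV) < e"
    unfolding eventually_finite_subsets_at_top by blast
  have "sum f F' \<le> e" if "finite F'" "F' \<inter> F = {}" for F'
  proof -
    have "sum f (F \<union> F') \<le> infsum f UNIV"
      using F that assms by (intro finite_sum_le_infsum) auto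
    moreover have "sum f (F \<union> F') = sum f F + sum f F'"
      using F that by (intro sum.union_disjoint) auto
    ultimately show ?thesis using F(2) by (simp add: dist_real_def)
  qed
  with F(1) show ?thesis by (rule that)
qed

lemma ell2_fun_add [simp]: "ell2_fun (x + y) n = ell2_fun x n + ell2_fun y n"
  by (simp add: plus_ell2.rep_eq)
lemma ell2_fun_diff [simp]: "ell2_fun (x - y) n = ell2_fun x n - ell2_fun y n"
  by (simp add: minus_ell2.rep_eq)
lemma ell2_fun_zero [simp]: "ell2_fun 0 n = 0"
  by (simp add: zero_ell2.rep_eq)
lemma ell2_fun_scaleC [simp]: "ell2_fun (c *\<^sub>C x) n = c * ell2_fun x n"
  by (simp add: scaleC_ell2.rep_eq)
lemma ell2_fun_scaleR [simp]: "ell2_fun (r *\<^sub>R x) n = complex_of_real r * ell2_fun x n"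
  by (simp add: scaleR_ell2.rep_eq)
lemma ell2_fun_delta [simp]: "ell2_fun (delta_ell2 n) k = (if k = n then 1 else 0)"
  by (simp add: delta_ell2.rep_eq)
lemma ell2_fun_sum [simp]: "ell2_fun (\<Sum>i\<in>F. x i) n = (\<Sum>i\<in>F. ell2_fun (x i) n)"
  by (induction F rule: infinite_finite_induct) auto

lemma norm_scaleC: "norm (c *\<^sub>C x) = cmod c * norm x"
  by transfer (rule l2norm_cmult)

lemma scaleR_scaleC: "r *\<^sub>R x = complex_of_real r *\<^sub>C x"
  by (rule ell2_eqI) simp

lemma norm_ell2_fun_le: "cmod (ell2_fun x n) \<le> norm x"
  using L2_set_le_l2norm[of "ell2_fun x" "{n}"] ell2_fun[of x]
  by (simp add: norm_ell2.rep_eq L2_set_def)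

lemma cinner_delta: "cinner_ell2 (delta_ell2 n) x = ell2_fun x n"
proof -
  have "cinner_ell2 (delta_ell2 n) x = (\<Sum>\<^sub>\<infinity>k. cnj (if k = n then 1 else 0) * ell2_fun x k)"
    by (simp add: cinner_ell2.rep_eq)
  also have "\<dots> = ell2_fun x n" by (subst infsum_single[of n]) auto
  finally show ?thesis .
qed

text \<open>The superpositions built below are in l1, where the triangle inequality suffices; this
  transfers the estimates to l2.\<close>

lemma l1_imp_ell2:
  assumes "\<And>F. finite F \<Longrightarrow> (\<Sum>n\<in>F. cmod (f n)) \<le> b"
  shows "square_summable f" "norm (Abs_ell2 f) \<le> b"
proof -
  have "L2_set (\<lambda>x. cmod (f x)) F \<le> b" if "finite F" for F
    using assms[OF that] L2_set_le_sum[of F "\<lambda>x. cmod (f x)"] by auto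
  then show "square_summable f" "norm (Abs_ell2 f) \<le> b"
    using square_summable_bound[of f b] by (auto simp: norm_ell2.rep_eq Abs_ell2_inverse)
qed

lemma closure_span_add:
  assumes "x \<in> closure (ell2.span S)" "y \<in> closure (ell2.span S)"
  shows "x + y \<in> closure (ell2.span S)"
proof -
  obtain X Y where "\<forall>n. X n \<in> ell2.span S" "X \<longlonglongrightarrow> x" "\<forall>n. Y n \<in> ell2.span S" "Y \<longlonglongrightarrow> y"
    using assms unfolding closure_sequential by blast
  then show ?thesis
    unfolding closure_sequential
    by (intro exI[of _ "\<lambda>n. X n + Y n"]) (auto intro: ell2.span_add tendsto_add)
qed

lemma tendsto_scaleC:
  assumes "(X \<longlongrightarrow> x) F"
  shows "((\<lambda>n. c *\<^sub>C X n) \<longlongrightarrow> c *\<^sub>C x) F"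
proof (rule LIM_zero_cancel, rule tendsto_norm_zero_cancel)
  have "((\<lambda>n. cmod c * norm (X n - x)) \<longlongrightarrow> cmod c * 0) F"
    using assms by (intro tendsto_mult tendsto_const tendsto_norm_zero LIM_zero)
  then show "((\<lambda>n. norm (c *\<^sub>C X n - c *\<^sub>C x)) \<longlongrightarrow> 0) F"
    by (simp add: ell2.scale_right_diff_distrib[symmetric] norm_scaleC)
qed

lemma closure_span_scaleC:
  assumes "x \<in> closure (ell2.span S)"
  shows "c *\<^sub>C x \<in> closure (ell2.span S)"
proof -
  obtain X where "\<forall>n. X n \<in> ell2.span S" "X \<longlonglongrightarrow> x"
    using assms unfolding closure_sequential by blast
  then show ?thesis
    unfolding closure_sequential
    by (intro exI[of _ "\<lambda>n. c *\<^sub>C X n"]) (auto intro: ell2.span_scale tendsto_scaleC)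
qed

lemma closure_span_sum:
  "(\<And>i. i \<in> F \<Longrightarrow> x i \<in> closure (ell2.span S)) \<Longrightarrow> sum x F \<in> closure (ell2.span S)"
  by (induction F rule: infinite_finite_induct)
    (auto intro: closure_span_add subsetD[OF closure_subset ell2.span_zero])

lemma complete_setI:
  assumes "\<And>n. delta_ell2 n \<in> closure (ell2.span S)"
  shows "complete_set S"
proof -
  have "x \<in> closure (ell2.span S)" for x :: "'a ell2"
  proof (rule closed_approachable[OF closed_closure, THEN iffD1], intro allI impI)
    fix e :: real assume e: "e > 0"
    have ss: "(\<lambda>n. (cmod (ell2_fun x n))\<^sup>2) summable_on UNIV"
      using ell2_fun[of x] by (simp add: square_summable_def)
    obtain F where F: "finite F"
      "\<And>F'. finite F' \<Longrightarrow> F' \<inter> F = {} \<Longrightarrow> (\<Sum>n\<in>F'. (cmod (ell2_fun x n))\<^sup>2) \<le> (e / 2)\<^sup>2"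
      using summable_on_tail[OF ss, of "(e / 2)\<^sup>2"] e by auto
    define y where "y = (\<Sum>n\<in>F. ell2_fun x n *\<^sub>C delta_ell2 n)"
    have y: "ell2_fun y n = (if n \<in> F then ell2_fun x n else 0)" for n
      using F(1) by (simp add: y_def if_distrib[of "\<lambda>z. _ * z"] sum.delta cong: if_cong)
    have "norm (y - x) \<le> e / 2"
      unfolding norm_ell2.rep_eq
    proof (rule square_summable_bound(2))
      fix F' :: "'a set" assume F': "finite F'"
      have "(\<Sum>n\<in>F'. (cmod (ell2_fun (y - x) n))\<^sup>2) = (\<Sum>n\<in>F' - F. (cmod (ell2_fun x n))\<^sup>2)"
        by (intro sum.mono_neutral_cong_right F') (auto simp: y)
      also have "\<dots> \<le> (e / 2)\<^sup>2" using F' by (intro F) auto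
      finally show "L2_set (\<lambda>n. cmod (ell2_fun (y - x) n)) F' \<le> e / 2"
        unfolding L2_set_def using e by (intro real_le_lsqrt) (auto simp: sum_nonneg)
    qed
    then have "dist y x < e" using e by (simp add: dist_norm)
    moreover have "y \<in> closure (ell2.span S)"
      unfolding y_def by (intro closure_span_sum closure_span_scaleC assms)
    ultimately show "\<exists>y\<in>closure (ell2.span S). dist y x < e" by blast
  qed
  then show ?thesis unfolding complete_set_def by blast
qed

text \<open>Term by term the tail of the series at z is dominated by the tail at B. The bound
  depends on z only through B, hence is uniform over all eigenvalues in
  \<open>op_exp_synth\<close>.\<close>

lemma exp_partial_sum_dist:
  fixes z :: complex
  assumes "cmod z \<le> B"
  shows "cmod (exp z - (\<Sum>k<K. z ^ k /\<^sub>R fact k)) \<le> exp B - (\<Sum>k<K. B ^ k /\<^sub>R fact k)"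
proof -
  have s: "summable (\<lambda>k. w ^ k /\<^sub>R fact k)" for w :: "'a :: {banach, real_normed_algebra_1}"
    by (rule summable_exp_generic)
  have tail: "exp w - (\<Sum>k<K. w ^ k /\<^sub>R fact k) = (\<Sum>k. w ^ (k + K) /\<^sub>R fact (k + K))"
    for w :: "'a :: {banach, real_normed_algebra_1}"
    unfolding exp_def using suminf_split_initial_segment[OF s, of w K] by simp
  have le: "cmod (z ^ (k + K) /\<^sub>R fact (k + K)) \<le> B ^ (k + K) /\<^sub>R fact (k + K)" for k
    using assms by (auto simp: norm_power intro!: mult_left_mono power_mono)
  have sB: "summable (\<lambda>k. B ^ (k + K) /\<^sub>R fact (k + K))"
    using s[of B] by (subst summable_iff_shift)
  have sz: "summable (\<lambda>k. cmod (z ^ (k + K) /\<^sub>R fact (k + K)))"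
    by (rule summable_comparison_test'[OF sB]) (use le in auto)
  show ?thesis
    unfolding tail by (rule order_trans[OF summable_norm[OF sz] suminf_le[OF le sz sB]])
qed

text \<open>The vector \<open>u p\<close> is an eigenfunction with eigenvalue \<open>lam p\<close>
  localized near p, and \<open>v m p\<close> is the coefficient of \<open>u m\<close> in the
  expansion of the delta at p; \<open>a\<close> and \<open>b\<close> are decay profiles that do not
  depend on the centre. The assumption \<open>expand\<close> takes the place of
  orthogonality.\<close>

locale localized_basis =
  fixes u v :: "int ^ 'd \<Rightarrow> int ^ 'd \<Rightarrow> complex" and a b :: "int ^ 'd \<Rightarrow> real"
    and lam V :: "int ^ 'd \<Rightarrow> real" and \<beta> M N :: real
  assumes V_bound: "\<bar>V n\<bar> \<le> \<beta>" and lam_bound: "\<bar>lam n\<bar> \<le> \<beta>"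
    and eigen: "(\<Sum>l | l1_norm l = 1. u p (n + l)) + complex_of_real (V n) * u p n
      = complex_of_real (lam p) * u p n"
    and u_le: "cmod (u p n) \<le> a (p - n)" and v_le: "cmod (v m p) \<le> b (p - m)"
    and a: "wbound 1 a M" and b: "wbound 1 b N"
    and expand: "(\<Sum>\<^sub>\<infinity>m. v m p * u m n) = (if n = p then 1 else 0)"
    and u_diag: "1 / 2 \<le> cmod (u p p)"
begin

section \<open>Superpositions of eigenfunctions\<close>

abbreviation "wt k \<equiv> exp (real_of_int (max_norm (k :: int ^ 'd)))"

lemma a_wt: "a k * wt k \<le> M"
proof -
  have "a k * wt k \<le> \<bar>a k\<bar> * wt k" by (intro mult_right_mono) auto
  also have "\<dots> \<le> M" using wbound_entry[OF a, of k] by simp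
  finally show ?thesis .
qed

lemma a0: "0 \<le> a k"
  using order_trans[OF norm_ge_zero u_le[of k 0]] by simp

lemma b0: "0 \<le> b k"
  using order_trans[OF norm_ge_zero v_le[of 0 k]] by simp

lemma M0: "0 \<le> M" by (rule wbound_nonneg[OF a])

lemma a_sum: "finite F \<Longrightarrow> (\<Sum>n\<in>F. a (m - n)) \<le> M"
proof -
  assume F: "finite F"
  have "(\<Sum>n\<in>F. a (m - n)) = (\<Sum>k\<in>(\<lambda>n. m - n) ` F. a k)"
    by (subst sum.reindex) (auto simp: inj_on_def)
  also have "\<dots> \<le> M"
    using wbound_mono[OF a, of 0 M] F a0 unfolding wbound_def by simp
  finally show ?thesis .
qed

lemma u_le_M: "cmod (u p n) \<le> M"
  using u_le[of p n] a_sum[of "{n}" p] by simp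

text \<open>The superposition of the eigenfunctions with coefficients c, used for c in l1. On it the
  operator acts as multiplication of c by the eigenvalues
  (\<open>schrodinger_synth\<close>).\<close>

definition synth :: "(int ^ 'd \<Rightarrow> complex) \<Rightarrow> (int ^ 'd) ell2" where
  "synth c = Abs_ell2 (\<lambda>n. \<Sum>\<^sub>\<infinity>m. c m * u m n)"

lemma synth_summable:
  assumes "wbound 0 c B"
  shows "(\<lambda>m. norm (c m * u m n)) summable_on UNIV" "(\<lambda>m. c m * u m n) summable_on UNIV"
proof -
  show "(\<lambda>m. norm (c m * u m n)) summable_on UNIV"
    by (rule Infinite_Sum.abs_summable_on_comparison_test'[OF
          summable_on_cmult_left[OF wbound_0_summable[OF assms], of M]])
      (auto simp: norm_mult intro: mult_left_mono u_le_M)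
  then show "(\<lambda>m. c m * u m n) summable_on UNIV" by (rule abs_summable_summable)
qed

lemma synth_l1:
  assumes c: "wbound 0 c B" and F: "finite F"
  shows "(\<Sum>n\<in>F. cmod (\<Sum>\<^sub>\<infinity>m. c m * u m n)) \<le> B * M"
proof -
  note cs = wbound_0_summable[OF c]
  have am: "(\<lambda>m. norm (c m) * a (m - n)) summable_on UNIV" for n
  proof (rule summable_on_comparison_test[OF summable_on_cmult_left[OF cs, of M]])
    show "norm (c m) * a (m - n) \<le> norm (c m) * M" for m
      using a_sum[of "{n}" m] by (intro mult_left_mono) auto
  qed (simp add: a0)
  have "cmod (\<Sum>\<^sub>\<infinity>m. c m * u m n) \<le> (\<Sum>\<^sub>\<infinity>m. norm (c m) * a (m - n))" for n
  proof -
    have "cmod (\<Sum>\<^sub>\<infinity>m. c m * u m n) \<le> (\<Sum>\<^sub>\<infinity>m. norm (c m * u m n))"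
      by (rule norm_infsum_bound[OF synth_summable(1)[OF c]])
    also have "\<dots> \<le> (\<Sum>\<^sub>\<infinity>m. norm (c m) * a (m - n))"
      by (intro infsum_mono synth_summable(1)[OF c] am)
        (auto simp: norm_mult intro: mult_left_mono u_le)
    finally show ?thesis .
  qed
  then have "(\<Sum>n\<in>F. cmod (\<Sum>\<^sub>\<infinity>m. c m * u m n)) \<le> (\<Sum>n\<in>F. \<Sum>\<^sub>\<infinity>m. norm (c m) * a (m - n))"
    by (rule sum_mono)
  also have "\<dots> = (\<Sum>\<^sub>\<infinity>m. \<Sum>n\<in>F. norm (c m) * a (m - n))"
    by (intro infsum_finite_sum[symmetric] am F)
  also have "\<dots> \<le> (\<Sum>\<^sub>\<infinity>m. norm (c m) * M)"
  proof (rule infsum_mono)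
    show "(\<lambda>m. \<Sum>n\<in>F. norm (c m) * a (m - n)) summable_on UNIV"
      by (intro summable_on_finite_sum am F)
    show "(\<lambda>m. norm (c m) * M) summable_on UNIV" by (rule summable_on_cmult_left[OF cs])
    show "(\<Sum>n\<in>F. norm (c m) * a (m - n)) \<le> norm (c m) * M" for m
      unfolding sum_distrib_left[symmetric] by (intro mult_left_mono a_sum F) auto
  qed
  also have "\<dots> = (\<Sum>\<^sub>\<infinity>m. norm (c m)) * M" by (rule infsum_cmult_left) (use cs in auto)
  also have "\<dots> \<le> B * M" using wbound_infsum_le[OF c] M0 by (intro mult_right_mono) auto
  finally show ?thesis .
qed

lemma synth_apply: "wbound 0 c B \<Longrightarrow> ell2_fun (synth c) n = (\<Sum>\<^sub>\<infinity>m. c m * u m n)"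
  unfolding synth_def using l1_imp_ell2(1)[OF synth_l1] by (simp add: Abs_ell2_inverse)

lemma norm_synth: "wbound 0 c B \<Longrightarrow> norm (synth c) \<le> B * M"
  unfolding synth_def by (rule l1_imp_ell2(2)[OF synth_l1])

lemma wbound_mult:
  assumes "wbound 0 c B" "\<And>m. cmod (h m) \<le> K"
  shows "wbound 0 (\<lambda>m. h m * c m) (K * B)"
proof (rule wbound_dominated[OF assms(1)])
  show "0 \<le> K" using assms(2) order_trans norm_ge_zero by blast
qed (use assms(2) in \<open>simp add: norm_mult mult_right_mono\<close>)

lemma synth_add:
  assumes "wbound 0 c B" "wbound 0 d B'"
  shows "synth (\<lambda>m. c m + d m) = synth c + synth d"
  by (rule ell2_eqI)
    (simp add: synth_apply[OF assms(1)] synth_apply[OF assms(2)] synth_apply[OF wbound_add[OF assms]]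
      distrib_right infsum_add synth_summable(2)[OF assms(1)] synth_summable(2)[OF assms(2)])

lemma synth_cmult:
  assumes "wbound 0 c B"
  shows "synth (\<lambda>m. z * c m) = z *\<^sub>C synth c"
  by (rule ell2_eqI)
    (simp add: synth_apply[OF assms] synth_apply[OF wbound_mult[OF assms order_refl]] mult.assoc
      infsum_cmult_right')

text \<open>The finite hopping sum passes through the absolutely convergent series, after which
  \<open>eigen\<close> applies to each term.\<close>

lemma schrodinger_synth:
  assumes c: "wbound 0 c B"
  shows "schrodinger V (synth c) = synth (\<lambda>m. complex_of_real (lam m) * c m)"
proof (rule ell2_eqI)
  fix n
  have lc: "wbound 0 (\<lambda>m. complex_of_real (lam m) * c m) (\<beta> * B)"
    by (rule wbound_mult[OF c]) (simp add: lam_bound)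
  let ?S = "{l :: int ^ 'd. l1_norm l = 1}"
  have "ell2_fun (schrodinger V (synth c)) n
      = (\<Sum>l\<in>?S. \<Sum>\<^sub>\<infinity>m. c m * u m (n + l)) + complex_of_real (V n) * (\<Sum>\<^sub>\<infinity>m. c m * u m n)"
    by (simp add: schrodinger_apply[OF V_bound] synth_apply[OF c])
  also have "\<dots> = (\<Sum>\<^sub>\<infinity>m. \<Sum>l\<in>?S. c m * u m (n + l)) + (\<Sum>\<^sub>\<infinity>m. complex_of_real (V n) * (c m * u m n))"
    by (subst infsum_finite_sum[OF finite_unit_sphere synth_summable(2)[OF c]]) (simp add: infsum_cmult_right')
  also have "\<dots> = (\<Sum>\<^sub>\<infinity>m. (\<Sum>l\<in>?S. c m * u m (n + l)) + complex_of_real (V n) * (c m * u m n))"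
    by (intro infsum_add[symmetric] summable_on_finite_sum finite_unit_sphere
        summable_on_cmult_right synth_summable(2)[OF c])
  also have "\<dots> = (\<Sum>\<^sub>\<infinity>m. complex_of_real (lam m) * c m * u m n)"
  proof (rule infsum_cong)
    fix m
    have "(\<Sum>l\<in>?S. c m * u m (n + l)) + complex_of_real (V n) * (c m * u m n)
        = c m * ((\<Sum>l\<in>?S. u m (n + l)) + complex_of_real (V n) * u m n)"
      by (simp add: sum_distrib_left algebra_simps)
    then show "(\<Sum>l\<in>?S. c m * u m (n + l)) + complex_of_real (V n) * (c m * u m n)
        = complex_of_real (lam m) * c m * u m n"
      by (simp add: eigen mult_ac)
  qed
  also have "\<dots> = ell2_fun (synth (\<lambda>m. complex_of_real (lam m) * c m)) n"
    by (simp add: synth_apply[OF lc])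
  finally show "ell2_fun (schrodinger V (synth c)) n
      = ell2_fun (synth (\<lambda>m. complex_of_real (lam m) * c m)) n" .
qed

abbreviation unit_coeff :: "int ^ 'd \<Rightarrow> int ^ 'd \<Rightarrow> complex" where
  "unit_coeff p m \<equiv> (if m = p then 1 else 0)"

lemma wbound_unit: "wbound 0 (unit_coeff p) 1"
  unfolding wbound_def by (auto simp: sum.delta if_distrib[of norm] cong: if_cong)

definition eigenvector :: "int ^ 'd \<Rightarrow> (int ^ 'd) ell2" where
  "eigenvector p = synth (unit_coeff p)"

lemma eigenvector_apply: "ell2_fun (eigenvector p) n = u p n"
  unfolding eigenvector_def synth_apply[OF wbound_unit] by (subst infsum_single[of p]) auto

lemma schrodinger_eigenvector:
  "schrodinger V (eigenvector p) = complex_of_real (lam p) *\<^sub>C eigenvector p"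
  unfolding eigenvector_def schrodinger_synth[OF wbound_unit] synth_cmult[OF wbound_unit, symmetric]
  by (rule arg_cong[where f = synth]) auto

lemma synth_in_closure:
  assumes c: "wbound 0 c B"
  shows "synth c \<in> closure (ell2.span (range eigenvector))"
proof (rule closure_approachable[THEN iffD2], intro allI impI)
  fix e :: real assume e: "e > 0"
  \<comment> \<open>The \<open>M + 1\<close> keeps the denominator positive when M = 0.\<close>
  define e' where "e' = e / (2 * (M + 1))"
  have e': "e' > 0" "e' * M < e"
  proof -
    show "e' > 0" using e M0 by (simp add: e'_def)
    then have "e' * M < e' * (2 * (M + 1))" using M0 by (intro mult_strict_left_mono) auto
    also have "\<dots> = e" using M0 by (simp add: e'_def)
    finally show "e' * M < e" .
  qed
  obtain F where F: "finite F" "\<And>F'. finite F' \<Longrightarrow> F' \<inter> F = {} \<Longrightarrow> (\<Sum>m\<in>F'. norm (c m)) \<le> e'"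
    using summable_on_tail[OF wbound_0_summable[OF c] norm_ge_zero e'(1)] by blast
  \<comment> \<open>Minus the tail of c, so that c + d has finite support and \<open>synth d\<close>
    is the error of the truncation.\<close>
  define d where "d m = (if m \<in> F then 0 else - c m)" for m
  have d: "wbound 0 d e'"
    unfolding wbound_def
  proof (intro allI impI)
    fix F' :: "(int ^ 'd) set" assume F': "finite F'"
    have "(\<Sum>k\<in>F'. norm (d k) * exp (0 * real_of_int (max_norm k))) = (\<Sum>k\<in>F' - F. norm (c k))"
      by (intro sum.mono_neutral_cong_right F') (auto simp: d_def)
    also have "\<dots> \<le> e'" using F' by (intro F) auto
    finally show "(\<Sum>k\<in>F'. norm (d k) * exp (0 * real_of_int (max_norm k))) \<le> e'" .
  qed
  define y where "y = (\<Sum>m\<in>F. c m *\<^sub>C eigenvector m)"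
  have "synth (\<lambda>m. c m + d m) = y"
  proof (rule ell2_eqI)
    fix n
    have "ell2_fun (synth (\<lambda>m. c m + d m)) n = (\<Sum>\<^sub>\<infinity>m. (c m + d m) * u m n)"
      by (rule synth_apply[OF wbound_add[OF c d]])
    also have "\<dots> = (\<Sum>\<^sub>\<infinity>m\<in>F. c m * u m n)"
      by (rule infsum_cong_neutral) (auto simp: d_def)
    also have "\<dots> = ell2_fun y n" using F(1) by (simp add: y_def eigenvector_apply)
    finally show "ell2_fun (synth (\<lambda>m. c m + d m)) n = ell2_fun y n" .
  qed
  then have "y = synth c + synth d" by (simp only: synth_add[OF c d])
  then have "y - synth c = synth d" by simp
  then have "dist y (synth c) < e"
    using norm_synth[OF d] e' by (simp add: dist_norm)
  moreover have "y \<in> ell2.span (range eigenvector)"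
    unfolding y_def by (intro ell2.span_sum ell2.span_scale ell2.span_base) auto
  ultimately show "\<exists>y\<in>ell2.span (range eigenvector). dist y (synth c) < e" by blast
qed

lemma wbound_v: "wbound 0 (\<lambda>m. v m p) N"
  unfolding wbound_def
proof (intro allI impI)
  fix F :: "(int ^ 'd) set" assume F: "finite F"
  have "(\<Sum>m\<in>F. norm (v m p) * exp (0 * real_of_int (max_norm m))) \<le> (\<Sum>m\<in>F. b (p - m))"
    by (intro sum_mono) (simp add: v_le)
  also have "\<dots> = (\<Sum>k\<in>(\<lambda>m. p - m) ` F. b k)"
    by (subst sum.reindex) (auto simp: inj_on_def)
  also have "\<dots> \<le> N"
    using wbound_mono[OF b, of 0 N] F b0 unfolding wbound_def by simp
  finally show "(\<Sum>m\<in>F. norm (v m p) * exp (0 * real_of_int (max_norm m))) \<le> N" .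
qed

text \<open>This is where \<open>expand\<close> enters. The coefficients of a delta are in l1 by
  \<open>wbound_v\<close>, and both completeness and the formula for the evolution follow from
  that.\<close>

lemma synth_v: "synth (\<lambda>m. v m p) = delta_ell2 p"
  by (rule ell2_eqI) (simp add: synth_apply[OF wbound_v] expand)

text \<open>A lower bound uniform in p, so that normalizing an eigenvector costs a factor of at most
  2; hence the constant \<open>2 * M\<close>.\<close>

lemma norm_eigenvector: "1 / 2 \<le> norm (eigenvector p)"
  using norm_ell2_fun_le[of "eigenvector p" p] u_diag[of p] by (simp add: eigenvector_apply)

lemma u_decay: "cmod (u p n) \<le> M * exp (- real_of_int (max_norm (n - p)))"
proof -
  have "cmod (u p n) * wt (p - n) \<le> M"
    using order_trans[OF mult_right_mono[OF u_le] a_wt] by simp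
  then show ?thesis
    using max_norm_minus[of "p - n"] by (simp add: exp_minus field_simps)
qed

theorem schrodinger_has_ULE: "has_ULE (schrodinger V) 1 (2 * M)"
proof -
  define S where "S = range (\<lambda>p. eigenvector p /\<^sub>R norm (eigenvector p))"
  have pos: "norm (eigenvector p) > 0" for p using norm_eigenvector[of p] by linarith
  have lin: "schrodinger V (r *\<^sub>R x) = r *\<^sub>R schrodinger V x" for r x
    by (rule ell2_eqI) (simp add: schrodinger_apply[OF V_bound] sum_distrib_left algebra_simps)
  have eig: "eigenfunction (schrodinger V) (r *\<^sub>R eigenvector p)" if "r \<noteq> 0" for r p
    unfolding eigenfunction_def lin schrodinger_eigenvector
    using that pos[of p] by (auto simp: scaleR_scaleC ell2.scale_left_commute)
  have "eigenfunction (schrodinger V) w \<and> norm w = 1" if "w \<in> S" for w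
    using that pos eig by (auto simp: S_def)
  moreover have "complete_set S"
  proof (rule complete_setI)
    fix p :: "int ^ 'd"
    have "eigenvector q \<in> ell2.span S" for q
    proof -
      have "complex_of_real (norm (eigenvector q)) *\<^sub>C (eigenvector q /\<^sub>R norm (eigenvector q)) \<in> ell2.span S"
        by (intro ell2.span_scale ell2.span_base) (simp add: S_def)
      then show ?thesis using pos[of q] by (simp add: scaleR_scaleC[symmetric])
    qed
    then have "ell2.span (range eigenvector) \<subseteq> ell2.span S"
      by (intro ell2.span_minimal) (auto simp: ell2.subspace_span)
    then show "delta_ell2 p \<in> closure (ell2.span S)"
      using synth_in_closure[OF wbound_v[of p]] closure_mono unfolding synth_v by blast
  qed
  moreover have "uniformly_localized S 1 (2 * M)"
    unfolding uniformly_localized_def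
  proof (intro conjI ballI)
    fix w assume "w \<in> S"
    then obtain p where w: "w = eigenvector p /\<^sub>R norm (eigenvector p)" by (auto simp: S_def)
    have "cmod (ell2_fun w k) \<le> 2 * M * exp (- 1 * real_of_int (max_norm (k - p)))" for k
    proof -
      have "inverse (norm (eigenvector p)) \<le> inverse (1 / 2)"
        using norm_eigenvector[of p] by (intro le_imp_inverse_le) auto
      then have "inverse (norm (eigenvector p)) * cmod (u p k)
          \<le> 2 * (M * exp (- real_of_int (max_norm (k - p))))"
        using u_decay[of p k] pos[of p] by (intro mult_mono) auto
      then show ?thesis using pos[of p] by (simp add: w eigenvector_apply norm_mult norm_inverse)
    qed
    then show "\<exists>m. \<forall>k. cmod (ell2_fun w k) \<le> 2 * M * exp (- 1 * real_of_int (max_norm (k - m)))"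
      by blast
  qed simp
  ultimately show ?thesis unfolding has_ULE_def by blast
qed

section \<open>Dynamical localization\<close>

abbreviation evol :: "real \<Rightarrow> (int ^ 'd) ell2 \<Rightarrow> (int ^ 'd) ell2" where
  "evol t \<equiv> \<lambda>x. (- \<i> * complex_of_real t) *\<^sub>C schrodinger V x"

abbreviation phase :: "real \<Rightarrow> int ^ 'd \<Rightarrow> complex" where
  "phase t m \<equiv> - \<i> * complex_of_real (t * lam m)"

lemma phase_le: "cmod (phase t m) \<le> \<bar>t\<bar> * \<beta>"
  using mult_left_mono[OF lam_bound[of m] abs_ge_zero[of t]] by (simp add: norm_mult abs_mult)

lemma evol_funpow:
  assumes c: "wbound 0 c B"
  shows "(evol t ^^ k) (synth c) = synth (\<lambda>m. phase t m ^ k * c m)"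
    and "wbound 0 (\<lambda>m. phase t m ^ k * c m) ((\<bar>t\<bar> * \<beta>) ^ k * B)"
proof -
  show w: "wbound 0 (\<lambda>m. phase t m ^ k * c m) ((\<bar>t\<bar> * \<beta>) ^ k * B)" for k
    by (rule wbound_mult[OF c]) (simp only: norm_power power_mono phase_le norm_ge_zero)
  show "(evol t ^^ k) (synth c) = synth (\<lambda>m. phase t m ^ k * c m)"
  proof (induction k)
    case (Suc k)
    have lw: "wbound 0 (\<lambda>m. complex_of_real (lam m) * (phase t m ^ k * c m)) (\<beta> * ((\<bar>t\<bar> * \<beta>) ^ k * B))"
      by (rule wbound_mult[OF w]) (simp add: lam_bound)
    have "(evol t ^^ Suc k) (synth c) = evol t (synth (\<lambda>m. phase t m ^ k * c m))"
      by (simp only: funpow.simps o_apply Suc)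
    also have "\<dots> = synth (\<lambda>m. (- \<i> * complex_of_real t) * (complex_of_real (lam m) * (phase t m ^ k * c m)))"
      unfolding schrodinger_synth[OF w] synth_cmult[OF lw] ..
    also have "\<dots> = synth (\<lambda>m. phase t m ^ Suc k * c m)"
      by (simp add: mult_ac)
    finally show ?case .
  qed simp
qed

text \<open>The partial sums of the exponential series multiply the coefficients by partial sums of
  the series for e^(-it lam m). These converge uniformly in m because the eigenvalues are bounded,
  so the error tends to 0 in l1 and hence in l2.\<close>

lemma op_exp_synth:
  assumes c: "wbound 0 c B"
  shows "op_exp (evol t) (synth c) = synth (\<lambda>m. exp (phase t m) * c m)"
proof -
  define R where "R = \<bar>t\<bar> * \<beta>"
  have ex: "cmod (exp (phase t m)) \<le> 1" for m by (simp only: norm_exp_eq_Re) simp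
  have we: "wbound 0 (\<lambda>m. exp (phase t m) * c m) (1 * B)" by (rule wbound_mult[OF c ex])
  have B: "0 \<le> B" by (rule wbound_nonneg[OF c])
  define err where "err K = exp R - (\<Sum>k<K. R ^ k /\<^sub>R fact k)" for K
  define pe where "pe K m = (\<Sum>k<K. phase t m ^ k /\<^sub>R fact k)" for K m
  have d: "cmod (exp (phase t m) - pe K m) \<le> err K" for K m
    unfolding err_def pe_def R_def by (rule exp_partial_sum_dist[OF phase_le])
  have pe: "cmod (pe K m) \<le> 1 + err K" for K m
    using norm_triangle_ineq4[of "exp (phase t m)" "exp (phase t m) - pe K m"] ex[of m] d[of m K] by simp
  have wpe: "wbound 0 (\<lambda>m. pe K m * c m) ((1 + err K) * B)" for K by (rule wbound_mult[OF c pe])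
  have partial: "(\<Sum>k<K. (evol t ^^ k) (synth c) /\<^sub>R fact k) = synth (\<lambda>m. pe K m * c m)" for K
  proof (induction K)
    case 0
    show ?case by (rule ell2_eqI) (simp add: pe_def synth_apply[OF wpe[of 0, unfolded pe_def, simplified]])
  next
    case (Suc K)
    let ?r = "complex_of_real (inverse (fact K))"
    have wr: "wbound 0 (\<lambda>m. ?r * (phase t m ^ K * c m)) (cmod ?r * ((\<bar>t\<bar> * \<beta>) ^ K * B))"
      by (rule wbound_mult[OF evol_funpow(2)[OF c] order_refl])
    have "(evol t ^^ K) (synth c) /\<^sub>R fact K = synth (\<lambda>m. ?r * (phase t m ^ K * c m))"
      unfolding evol_funpow(1)[OF c] scaleR_scaleC synth_cmult[OF evol_funpow(2)[OF c]] ..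
    then have "(\<Sum>k<Suc K. (evol t ^^ k) (synth c) /\<^sub>R fact k)
        = synth (\<lambda>m. pe K m * c m) + synth (\<lambda>m. ?r * (phase t m ^ K * c m))"
      by (simp only: sum.lessThan_Suc Suc)
    also have "\<dots> = synth (\<lambda>m. pe K m * c m + ?r * (phase t m ^ K * c m))"
      by (rule synth_add[OF wpe wr, symmetric])
    also have "(\<lambda>m. pe K m * c m + ?r * (phase t m ^ K * c m)) = (\<lambda>m. pe (Suc K) m * c m)"
      by (simp add: pe_def scaleR_conv_of_real algebra_simps)
    finally show ?case .
  qed
  have "(\<lambda>k. (evol t ^^ k) (synth c) /\<^sub>R fact k) sums synth (\<lambda>m. exp (phase t m) * c m)"
    unfolding sums_def partial
  proof (rule LIM_zero_cancel, rule tendsto_norm_zero_cancel, rule tendsto_sandwich[OF _ _ tendsto_const])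
    show "\<forall>\<^sub>F K in sequentially. norm (synth (\<lambda>m. pe K m * c m) - synth (\<lambda>m. exp (phase t m) * c m)) \<le> err K * B * M"
    proof (intro always_eventually allI)
      fix K
      have w: "wbound 0 (\<lambda>m. (exp (phase t m) - pe K m) * c m) (err K * B)" by (rule wbound_mult[OF c d])
      have "synth (\<lambda>m. pe K m * c m) + synth (\<lambda>m. (exp (phase t m) - pe K m) * c m)
          = synth (\<lambda>m. exp (phase t m) * c m)"
        unfolding synth_add[OF wpe w, symmetric] by (simp add: algebra_simps)
      then have "synth (\<lambda>m. pe K m * c m) - synth (\<lambda>m. exp (phase t m) * c m)
          = - synth (\<lambda>m. (exp (phase t m) - pe K m) * c m)" by (simp add: algebra_simps eq_diff_eq)
      then show "norm (synth (\<lambda>m. pe K m * c m) - synth (\<lambda>m. exp (phase t m) * c m)) \<le> err K * B * M"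
        using norm_synth[OF w] by simp
    qed
    have "(\<lambda>K. \<Sum>k<K. R ^ k /\<^sub>R fact k) \<longlonglongrightarrow> exp R"
      unfolding exp_def by (rule summable_LIMSEQ[OF summable_exp_generic])
    then have "err \<longlonglongrightarrow> exp R - exp R" unfolding err_def[abs_def] by (intro tendsto_diff tendsto_const)
    then have "(\<lambda>K. err K * B * M) \<longlonglongrightarrow> (exp R - exp R) * B * M" by (intro tendsto_mult tendsto_const)
    then show "(\<lambda>K. err K * B * M) \<longlonglongrightarrow> 0" by simp
  qed auto
  then show ?thesis unfolding op_exp_def by (rule sums_unique[symmetric])
qed

text \<open>The matrix element is the sum over m of e^(-it lam m) v m p u m n, with phases of
  modulus 1, which makes the bound uniform in t. By the triangle inequality e^-|n-m| <= e^|p-m|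
  e^-|n-p|, and the weighted bound on b absorbs e^|p-m|.\<close>

theorem dynamical_localization:
  "cmod (cinner_ell2 (delta_ell2 n) (op_exp (evol t) (delta_ell2 p)))
    \<le> M * N * exp (- real_of_int (max_norm (n - p)))"
proof -
  have ex: "cmod (exp (phase t m)) \<le> 1" for m by (simp only: norm_exp_eq_Re) simp
  have we: "wbound 0 (\<lambda>m. exp (phase t m) * v m p) (1 * N)" by (rule wbound_mult[OF wbound_v ex])
  let ?e = "exp (- real_of_int (max_norm (n - p)))"
  have eq: "cinner_ell2 (delta_ell2 n) (op_exp (evol t) (delta_ell2 p)) = (\<Sum>\<^sub>\<infinity>m. exp (phase t m) * v m p * u m n)"
    using op_exp_synth[OF wbound_v[of p], of t] unfolding synth_v by (simp only: cinner_delta synth_apply[OF we])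
  have le: "norm (exp (phase t m) * v m p * u m n) \<le> norm (b (p - m)) * exp (1 * real_of_int (max_norm (p - m))) * (M * ?e)" for m
  proof -
    have "norm (exp (phase t m) * v m p * u m n) \<le> 1 * b (p - m) * (M * exp (- real_of_int (max_norm (n - m))))"
      unfolding norm_mult by (intro mult_mono ex v_le u_decay mult_nonneg_nonneg b0) auto
    also have "exp (- real_of_int (max_norm (n - m))) \<le> wt (p - m) * ?e"
      using max_norm_triangle[of "n - m" "m - p"] max_norm_minus[of "p - m"]
      unfolding exp_add[symmetric] by simp
    then have "1 * b (p - m) * (M * exp (- real_of_int (max_norm (n - m)))) \<le> 1 * b (p - m) * (M * (wt (p - m) * ?e))"
      by (intro mult_left_mono M0) (simp_all add: b0)
    also have "1 * b (p - m) * (M * (wt (p - m) * ?e)) = norm (b (p - m)) * exp (1 * real_of_int (max_norm (p - m))) * (M * ?e)"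
      by (simp add: b0)
    finally show ?thesis .
  qed
  have bij: "bij_betw (\<lambda>m. p - m) UNIV UNIV"
    by (rule bij_betw_byWitness[of _ "\<lambda>m. p - m"]) auto
  let ?f = "\<lambda>k. norm (b k) * exp (1 * real_of_int (max_norm k))"
  have sb: "(\<lambda>m. ?f (p - m)) summable_on UNIV"
    using summable_on_reindex_bij_betw[OF bij, of ?f] wbound_summable[OF b] by simp
  have "cmod (\<Sum>\<^sub>\<infinity>m. exp (phase t m) * v m p * u m n) \<le> (\<Sum>\<^sub>\<infinity>m. norm (exp (phase t m) * v m p * u m n))"
    by (rule norm_infsum_bound[OF synth_summable(1)[OF we]])
  also have "\<dots> \<le> (\<Sum>\<^sub>\<infinity>m. ?f (p - m) * (M * ?e))"
    by (intro infsum_mono synth_summable(1)[OF we] summable_on_cmult_left[OF sb] le)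
  also have "\<dots> = (\<Sum>\<^sub>\<infinity>m. ?f (p - m)) * (M * ?e)"
    by (rule infsum_cmult_left) (use sb in auto)
  also have "(\<Sum>\<^sub>\<infinity>m. ?f (p - m)) = (\<Sum>\<^sub>\<infinity>k. ?f k)" by (rule infsum_reindex_bij_betw[OF bij])
  also have "(\<Sum>\<^sub>\<infinity>k. ?f k) * (M * ?e) \<le> N * (M * ?e)"
    using M0 by (intro mult_right_mono wbound_infsum_le[OF b]) auto
  finally show ?thesis unfolding eq by (simp add: mult_ac)
qed

end


section \<open>Localization over the odometer\<close>

lemma wbound_finite_support:
  assumes "finite S" "\<And>k. k \<notin> S \<Longrightarrow> A k = 0"
  shows "wbound s A (\<Sum>k\<in>S. norm (A k) * exp (s * real_of_int (max_norm k)))"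
  unfolding wbound_def
proof (intro allI impI)
  fix F :: "(int ^ 'a) set" assume F: "finite F"
  have "(\<Sum>k\<in>F. norm (A k) * exp (s * real_of_int (max_norm k)))
      = (\<Sum>k\<in>F \<inter> S. norm (A k) * exp (s * real_of_int (max_norm k)))"
    using F assms(2) by (intro sum.mono_neutral_right) auto
  also have "\<dots> \<le> (\<Sum>k\<in>S. norm (A k) * exp (s * real_of_int (max_norm k)))"
    using assms(1) by (intro sum_mono2) auto
  finally show "(\<Sum>k\<in>F. norm (A k) * exp (s * real_of_int (max_norm k)))
      \<le> (\<Sum>k\<in>S. norm (A k) * exp (s * real_of_int (max_norm k)))" .
qed

definition hopping_fun :: "int ^ 'd \<Rightarrow> 'd::finite obs" where
  "hopping_fun k = (if l1_norm k = 1 then const_bcontfun 1 else 0)"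

lift_definition hopping :: "'d::finite ker" is hopping_fun
  by (rule exI, rule wbound_finite_support[OF finite_unit_sphere]) (simp add: hopping_fun_def)

lemma entry_hopping: "entry hopping k = (if l1_norm k = 1 then const_bcontfun 1 else 0)"
  by (simp add: hopping.rep_eq hopping_fun_def)

lemma kbound_hopping: "\<exists>M>0. kbound s (hopping :: 'd::finite ker) M"
proof -
  let ?h = "hopping :: 'd ker"
  have "\<exists>M. kbound s ?h M"
    by (rule exI, rule wbound_finite_support[OF finite_unit_sphere]) (simp add: entry_hopping)
  then obtain M where M: "kbound s ?h M" by blast
  then have "kbound s ?h (M + 1)" by (rule wbound_mono) auto
  moreover have "M + 1 > 0" using wbound_nonneg[OF M] by simp
  ultimately show ?thesis by blast
qed

lemma bounded_linear_apply: "bounded_linear (\<lambda>f :: 'a::topological_space \<Rightarrow>\<^sub>C real. f x)"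
proof (rule bounded_linear_intro[where K = 1])
  show "norm (f x) \<le> norm f * 1" for f :: "'a \<Rightarrow>\<^sub>C real" using norm_bounded[of f x] by simp
qed (simp_all add: plus_bcontfun.rep_eq scaleR_bcontfun.rep_eq)

lemma entry_times_apply:
  "entry (A * B) m x = (\<Sum>\<^sub>\<infinity>k. entry A k x * entry B (m - k) (x + odo_of k))"
  unfolding entry_times infsum_bounded_linear[OF bounded_linear_apply entry_times_summable, symmetric]
  by (simp add: twist_apply)

lemma entry_hopping_times:
  "entry (hopping * A) m x = (\<Sum>l | l1_norm l = 1. entry A (m - l) (x + odo_of l))"
proof -
  have "entry (hopping * A) m x = (\<Sum>\<^sub>\<infinity>l\<in>{l. l1_norm l = 1}. entry A (m - l) (x + odo_of l))"
    unfolding entry_times_apply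
    by (rule infsum_cong_neutral) (auto simp: entry_hopping const_bcontfun.rep_eq)
  then show ?thesis by (simp add: finite_unit_sphere)
qed

text \<open>The eigenfunction \<open>u p\<close> is column p of U at phase \<omega>: its value at n
  is entry p - n of U at the point \<omega> + n, and its eigenvalue is D(\<omega> + p) / \<epsilon>.
  The weighted norms of U and V are at most 1 + 1/2 = 3/2, from which both constants come.\<close>

theorem odometer_localization:
  "\<exists>(f :: 'd::finite odo \<Rightarrow> real) C C'. continuous_on UNIV f \<and> C' > 0 \<and>
    (\<forall>\<omega>. has_ULE (schrodinger (\<lambda>n. f (\<omega> + odo_of n))) 1 C \<and>
      (\<forall>n m t. cmod (cinner_ell2 (delta_ell2 n)
        (op_exp (\<lambda>u. (- \<i> * complex_of_real t) *\<^sub>C schrodinger (\<lambda>k. f (\<omega> + odo_of k)) u) (delta_ell2 m)))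
        \<le> C' * exp (- real_of_int (max_norm (n - m)))))"
proof -
  obtain \<eta> :: real where \<eta>: "\<eta> > 0" and kam: "\<And>E :: 'd ker. kbound 2 E \<eta> \<Longrightarrow>
      \<exists>U V Q. (diag odo_obs + diag Q + E) * U = U * diag odo_obs \<and> U * V = 1 \<and> V * U = 1
        \<and> kbound 1 (U - 1) (1 / 2) \<and> kbound 1 (V - 1) (1 / 2)"
    using kam_iterate[where 'd='d] by (intro that[rotated]) (assumption, simp)
  obtain K where K: "K > 0" "kbound 2 (hopping :: 'd ker) K" using kbound_hopping by blast
  \<comment> \<open>This gives the hopping term a weighted norm of at most \<eta>, as the iteration
    demands.\<close>
  define \<epsilon> where "\<epsilon> = \<eta> / K"
  have \<epsilon>: "\<epsilon> > 0" using \<eta> K by (simp add: \<epsilon>_def)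
  have "kbound 2 (\<epsilon> *\<^sub>R (hopping :: 'd ker)) \<eta>"
    using kbound_scaleR[OF K(2), of \<epsilon>] \<eta> K(1) by (simp add: \<epsilon>_def)
  then obtain U V :: "'d ker" and Q where eq: "(diag odo_obs + diag Q + \<epsilon> *\<^sub>R hopping) * U = U * diag odo_obs"
    and UV: "U * V = 1" and U1: "kbound 1 (U - 1) (1 / 2)" and V1: "kbound 1 (V - 1) (1 / 2)"
    using kam by blast
  have U: "kbound 1 U (3 / 2)" using kbound_add[OF U1 kbound_one] by simp
  have V: "kbound 1 V (3 / 2)" using kbound_add[OF V1 kbound_one] by simp
  define f where "f x = (odo_real x + Q x) / \<epsilon>" for x
  have f: "continuous_on UNIV f"
    unfolding f_def by (intro continuous_intros continuous_odo_real continuous_on_apply_bcontfun) (use \<epsilon> in auto)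
  define \<beta> where "\<beta> = (norm (odo_obs :: 'd obs) + norm Q) / \<epsilon>"
  have D: "\<bar>odo_real x\<bar> \<le> norm (odo_obs :: 'd obs)" for x :: "'d odo" using norm_bounded[of odo_obs x] by simp
  have Q: "\<bar>Q x\<bar> \<le> norm Q" for x using norm_bounded[of Q x] by simp
  have E: "odo_real x * entry U k x + Q x * entry U k x
      + \<epsilon> * (\<Sum>l | l1_norm l = 1. entry U (k - l) (x + odo_of l)) = entry U k x * odo_real (x + odo_of k)" for k x
  proof -
    have "entry ((diag odo_obs + diag Q + \<epsilon> *\<^sub>R hopping) * U) k x = entry (U * diag odo_obs) k x"
      unfolding eq ..
    then show ?thesis
      by (simp add: distrib_right entry_diag_times entry_times_diag twist_apply entry_hopping_times)
  qed
  have basis: "localized_basis (\<lambda>p n. complex_of_real (entry U (p - n) (\<omega> + odo_of n)))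
      (\<lambda>m p. complex_of_real (entry V (p - m) (\<omega> + odo_of m)))
      (\<lambda>k. norm (entry U k)) (\<lambda>k. norm (entry V k))
      (\<lambda>n. odo_real (\<omega> + odo_of n) / \<epsilon>) (\<lambda>n. f (\<omega> + odo_of n)) \<beta> (3 / 2) (3 / 2)" for \<omega>
  proof
    fix n p m :: "int ^ 'd"
    have "\<bar>odo_real x + Q x\<bar> \<le> norm (odo_obs :: 'd obs) + norm Q" for x
      using D[of x] Q[of x] by linarith
    then show "\<bar>f (\<omega> + odo_of n)\<bar> \<le> \<beta>"
      using \<epsilon> by (simp add: f_def \<beta>_def divide_right_mono)
    show "\<bar>odo_real (\<omega> + odo_of n) / \<epsilon>\<bar> \<le> \<beta>"
      using \<epsilon> D[of "\<omega> + odo_of n"] norm_ge_zero[of Q]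
      by (simp add: \<beta>_def divide_right_mono del: norm_ge_zero)
    have "(\<Sum>l | l1_norm l = 1. entry U (p - (n + l)) (\<omega> + odo_of (n + l)))
        + f (\<omega> + odo_of n) * entry U (p - n) (\<omega> + odo_of n)
        = odo_real (\<omega> + odo_of p) / \<epsilon> * entry U (p - n) (\<omega> + odo_of n)"
    proof -
      have "\<omega> + odo_of n + odo_of (p - n) = \<omega> + odo_of p"
        unfolding add.assoc odo_of_add[symmetric] by simp
      moreover have "p - (n + l) = p - n - l" "\<omega> + odo_of (n + l) = \<omega> + odo_of n + odo_of l" for l
        by (simp_all add: odo_of_add add.assoc diff_diff_eq)
      ultimately show ?thesis
        using E[of "\<omega> + odo_of n" "p - n"] \<epsilon> by (simp add: f_def field_simps)
    qed
    then show "(\<Sum>l | l1_norm l = 1. complex_of_real (entry U (p - (n + l)) (\<omega> + odo_of (n + l))))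
        + complex_of_real (f (\<omega> + odo_of n)) * complex_of_real (entry U (p - n) (\<omega> + odo_of n))
        = complex_of_real (odo_real (\<omega> + odo_of p) / \<epsilon>) * complex_of_real (entry U (p - n) (\<omega> + odo_of n))"
      unfolding of_real_sum[symmetric] of_real_mult[symmetric] of_real_add[symmetric] by (rule arg_cong)
    show "cmod (complex_of_real (entry U (p - n) (\<omega> + odo_of n))) \<le> norm (entry U (p - n))"
      using norm_bounded[of "entry U (p - n)"] by simp
    show "cmod (complex_of_real (entry V (p - m) (\<omega> + odo_of m))) \<le> norm (entry V (p - m))"
      using norm_bounded[of "entry V (p - m)"] by simp
    show "wbound 1 (\<lambda>k. norm (entry U k)) (3 / 2)" "wbound 1 (\<lambda>k. norm (entry V k)) (3 / 2)"
      using U V by (simp_all add: wbound_def)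
    \<comment> \<open>The substitution k = m - n turns the expansion of the delta into entry p - n
      of U V = 1 at the point \<omega> + n.\<close>
    have bij: "bij_betw (\<lambda>m. m - n) UNIV UNIV"
      by (rule bij_betw_byWitness[of _ "\<lambda>k. k + n"]) auto
    have "(\<Sum>\<^sub>\<infinity>m. complex_of_real (entry V (p - m) (\<omega> + odo_of m)) * complex_of_real (entry U (m - n) (\<omega> + odo_of n)))
        = complex_of_real (\<Sum>\<^sub>\<infinity>m. entry U (m - n) (\<omega> + odo_of n) * entry V (p - m) (\<omega> + odo_of m))"
      by (subst infsum_bounded_linear_strong[OF
            summable_on_bounded_linear_iff[OF bounded_linear_of_real bounded_linear_Re Re_complex_of_real]
            bounded_linear_of_real, symmetric])
        (simp add: mult.commute)
    also have "(\<Sum>\<^sub>\<infinity>m. entry U (m - n) (\<omega> + odo_of n) * entry V (p - m) (\<omega> + odo_of m))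
        = (\<Sum>\<^sub>\<infinity>m. entry U (m - n) (\<omega> + odo_of n) * entry V (p - n - (m - n)) (\<omega> + odo_of n + odo_of (m - n)))"
      by (simp add: add.assoc odo_of_add[symmetric])
    also have "\<dots> = entry (U * V) (p - n) (\<omega> + odo_of n)"
      unfolding entry_times_apply
      by (rule infsum_reindex_bij_betw[OF bij, of "\<lambda>k. entry U k (\<omega> + odo_of n) * entry V (p - n - k) (\<omega> + odo_of n + odo_of k)"])
    also have "complex_of_real \<dots> = (if n = p then 1 else 0)"
      unfolding UV by (simp add: entry_one const_bcontfun.rep_eq)
    finally show "(\<Sum>\<^sub>\<infinity>m. complex_of_real (entry V (p - m) (\<omega> + odo_of m)) * complex_of_real (entry U (m - n) (\<omega> + odo_of n)))
        = (if n = p then 1 else 0)" .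
    have "\<bar>entry (U - 1) 0 (\<omega> + odo_of p)\<bar> \<le> 1 / 2"
      using norm_bounded[of "entry (U - 1) 0" "\<omega> + odo_of p"] kbound_entry[OF _ U1, of 0] by simp
    then have "\<bar>entry U 0 (\<omega> + odo_of p) - 1\<bar> \<le> 1 / 2"
      by (simp add: entry_one const_bcontfun.rep_eq)
    then have "1 / 2 \<le> \<bar>entry U 0 (\<omega> + odo_of p)\<bar>" by linarith
    then show "1 / 2 \<le> cmod (complex_of_real (entry U (p - p) (\<omega> + odo_of p)))" by simp
  qed
  show ?thesis
    using f localized_basis.schrodinger_has_ULE[OF basis] localized_basis.dynamical_localization[OF basis]
    by (intro exI[of _ f] exI[of _ "2 * (3 / 2) :: real"] exI[of _ "3 / 2 * (3 / 2) :: real"]) auto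
qed

section \<open>The odometer as a Cantor group\<close>

text \<open>The theorem places its group on \<open>nat => nat\<close> for every d, so each residue
  is coded as a natural number. The topology becomes that of sequences with discrete
  coordinates.\<close>

definition odo_code_seq :: "'d::finite odo \<Rightarrow> nat \<Rightarrow> nat" where
  "odo_code_seq x i = to_nat (residue x i)"

lemma odo_code_seq_eq_iff: "odo_code_seq x i = odo_code_seq y i \<longleftrightarrow> residue x i = residue y i"
  by (simp add: odo_code_seq_def)

lemma inj_odo_code_seq: "inj odo_code_seq"
  by (rule injI) (metis odo_eqI odo_code_seq_eq_iff)

abbreviation odo_decode :: "(nat \<Rightarrow> nat) \<Rightarrow> 'd::finite odo" where
  "odo_decode \<equiv> inv_into UNIV odo_code_seq"

lemma odo_decode [simp]: "odo_decode (odo_code_seq x) = x"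
  by (rule inv_f_f[OF inj_odo_code_seq])

lemma open_coordinate: "open {w :: nat \<Rightarrow> nat. P (w i)}"
proof -
  have "open ((\<lambda>w :: nat \<Rightarrow> nat. w i) -` {n. P n})"
    by (rule open_vimage) (auto simp: open_discrete continuous_on_product_coordinates)
  then show ?thesis by (simp add: vimage_def)
qed

lemma continuous_odo_code_seq: "continuous_on UNIV odo_code_seq"
proof (rule continuous_on_coordinatewise_then_product)
  fix i
  show "continuous_on UNIV (\<lambda>x :: 'a odo. odo_code_seq x i)"
    unfolding continuous_on_topological
  proof (intro ballI allI impI)
    fix x :: "'a odo" and B :: "nat set" assume B: "odo_code_seq x i \<in> B"
    obtain e where e: "e > 0" "\<And>y. dist y x < e \<Longrightarrow> residue y i = residue x i"
      using residue_close by blast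
    have "odo_code_seq y i \<in> B" if "y \<in> ball x e" for y
      using e(2)[of y] that B by (simp add: dist_commute odo_code_seq_def)
    moreover have "open (ball x e)" "x \<in> ball x e" using e(1) by auto
    ultimately show "\<exists>A. open A \<and> x \<in> A \<and> (\<forall>y\<in>UNIV. y \<in> A \<longrightarrow> odo_code_seq y i \<in> B)" by blast
  qed
qed

lemma continuous_odo_decode: "continuous_on (range (odo_code_seq :: 'd::finite odo \<Rightarrow> _)) (odo_decode :: _ \<Rightarrow> 'd odo)"
  unfolding continuous_on_topological
proof (intro ballI allI impI)
  fix z and B :: "'d odo set"
  assume "z \<in> range (odo_code_seq :: 'd odo \<Rightarrow> _)" "open B" "odo_decode z \<in> B"
  then obtain x where x: "z = odo_code_seq x" "x \<in> B" by auto
  obtain e where e: "e > 0" "\<And>y. dist y x < e \<Longrightarrow> y \<in> B"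
    using \<open>open B\<close> x(2) unfolding open_dist by blast
  obtain i where i: "\<And>y. residue y i = residue x i \<Longrightarrow> dist y x < e"
    using close_residue[OF e(1)] by blast
  show "\<exists>A. open A \<and> z \<in> A \<and> (\<forall>y\<in>range (odo_code_seq :: 'd odo \<Rightarrow> _). y \<in> A \<longrightarrow> odo_decode y \<in> B)"
  proof (intro exI[of _ "{w. w i = z i}"] conjI ballI impI)
    fix y assume "y \<in> range (odo_code_seq :: 'd odo \<Rightarrow> _)" "y \<in> {w. w i = z i}"
    then obtain y' :: "'d odo" where "y = odo_code_seq y'" "residue y' i = residue x i"
      by (auto simp: x odo_code_seq_eq_iff)
    then show "odo_decode y \<in> B" using e(2) i by simp
  qed (simp_all add: open_coordinate[of "\<lambda>n. n = z i"])
qed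

lemma continuous_odo_plus: "continuous_on UNIV (\<lambda>p :: 'd::finite odo \<times> 'd odo. fst p + snd p)"
  unfolding continuous_on_iff
proof (intro ballI allI impI)
  fix p :: "'d odo \<times> 'd odo" and e :: real assume e: "e > 0"
  obtain x y where p: "p = (x, y)" by (cases p)
  obtain i where i: "\<And>z. residue z i = residue (x + y) i \<Longrightarrow> dist z (x + y) < e"
    using close_residue[OF e] by blast
  obtain d1 where d1: "d1 > 0" "\<And>z. dist z x < d1 \<Longrightarrow> residue z i = residue x i"
    using residue_close by blast
  obtain d2 where d2: "d2 > 0" "\<And>z. dist z y < d2 \<Longrightarrow> residue z i = residue y i"
    using residue_close by blast
  have "dist (fst q + snd q) (fst p + snd p) < e" if q: "dist q p < min d1 d2" for q
  proof -
    have "dist (fst q) x < d1" "dist (snd q) y < d2"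
      using q dist_fst_le[of q p] dist_snd_le[of q p] by (simp_all add: p)
    then have "residue (fst q + snd q) i = residue (x + y) i"
      using d1(2)[of "fst q"] d2(2)[of "snd q"] by (simp add: plus_odo.rep_eq)
    then have "dist (fst q + snd q) (x + y) < e" by (rule i)
    then show ?thesis by (simp add: p)
  qed
  then show "\<exists>d>0. \<forall>q\<in>UNIV. dist q p < d \<longrightarrow> dist (fst q + snd q) (fst p + snd p) < e"
    using d1 d2 by (intro exI[of _ "min d1 d2"]) auto
qed

lemma continuous_odo_uminus: "continuous_on UNIV (uminus :: 'd::finite odo \<Rightarrow> 'd odo)"
  unfolding continuous_on_iff
proof (intro ballI allI impI)
  fix x :: "'d odo" and e :: real assume e: "e > 0"
  obtain i where i: "\<And>z. residue z i = residue (- x) i \<Longrightarrow> dist z (- x) < e"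
    using close_residue[OF e] by blast
  obtain d where d: "d > 0" "\<And>z. dist z x < d \<Longrightarrow> residue z i = residue x i"
    using residue_close by blast
  have "dist (- y) (- x) < e" if "dist y x < d" for y
    using i[of "- y"] d(2)[OF that] by (simp add: uminus_odo.rep_eq)
  with d(1) show "\<exists>d>0. \<forall>y\<in>UNIV. dist y x < d \<longrightarrow> dist (- y) (- x) < e" by blast
qed

text \<open>Each condition involves at most two coordinates and is therefore clopen. The first
  confines z i to a finite set and makes it a genuine code, since \<open>from_nat\<close> also has
  values off the range of \<open>to_nat\<close>.\<close>

lemma range_odo_code_seq:
  "range (odo_code_seq :: 'd::finite odo \<Rightarrow> _)
    = (\<Inter>i. {z. z i \<in> to_nat ` range (red i :: int ^ 'd \<Rightarrow> _)}
        \<inter> {z. (from_nat (z i) :: int ^ 'd) = red i (from_nat (z (Suc i)))})" (is "_ = ?R")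
proof
  show "range (odo_code_seq :: 'd odo \<Rightarrow> _) \<subseteq> ?R"
  proof (clarsimp simp: odo_code_seq_def, intro conjI)
    fix x :: "'d odo" and i
    show "to_nat (residue x i) \<in> to_nat ` range (red i :: int ^ 'd \<Rightarrow> _)"
      by (metis imageI rangeI residue_Suc)
    show "residue x i = red i (residue x (Suc i))" by (simp add: residue_Suc)
  qed
  show "?R \<subseteq> range (odo_code_seq :: 'd odo \<Rightarrow> _)"
  proof
    fix z assume z: "z \<in> ?R"
    define x :: "nat \<Rightarrow> int ^ 'd" where "x i = from_nat (z i)" for i
    have "x i = red i (x (Suc i))" for i using z unfolding x_def by blast
    then have "residue (Abs_odo x) = x" by (intro Abs_odo_inverse) blast
    moreover have "to_nat (x i) = z i" for i
    proof -
      have "z i \<in> to_nat ` range (red i :: int ^ 'd \<Rightarrow> _)" using z by blast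
      then show ?thesis by (auto simp: x_def)
    qed
    ultimately have "z = odo_code_seq (Abs_odo x)" by (simp add: odo_code_seq_def fun_eq_iff)
    then show "z \<in> range (odo_code_seq :: 'd odo \<Rightarrow> _)" by blast
  qed
qed

text \<open>By Tychonoff a product of finite sets is compact, and the range is closed in it: the
  coordinates are discrete, so every condition on two of them is closed.\<close>

lemma compact_range_odo_code_seq: "compact (range (odo_code_seq :: 'd::finite odo \<Rightarrow> _))"
proof -
  let ?S = "\<lambda>i. to_nat ` range (red i :: int ^ 'd \<Rightarrow> _)"
  have "compactin (product_topology (\<lambda>_. euclidean) UNIV) (PiE UNIV ?S)"
    unfolding compactin_PiE by (auto intro!: finite_imp_compact finite_imageI finite_range_red)
  then have K: "compact (PiE UNIV ?S)"
    by (simp add: euclidean_product_topology)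
  have "closed {z :: nat \<Rightarrow> nat. P (z i) (z j)}" for P i j
  proof -
    have "open (- {z :: nat \<Rightarrow> nat. P (z i) (z j)})"
    proof (subst open_subopen, intro ballI)
      fix z :: "nat \<Rightarrow> nat" assume "z \<in> - {z. P (z i) (z j)}"
      then show "\<exists>T. open T \<and> z \<in> T \<and> T \<subseteq> - {z. P (z i) (z j)}"
        using open_Int[OF open_coordinate[of "\<lambda>n. n = z i" i] open_coordinate[of "\<lambda>n. n = z j" j]]
        by (intro exI[of _ "{w. w i = z i} \<inter> {w. w j = z j}"]) auto
    qed
    then show ?thesis by (simp add: closed_def)
  qed
  note this[of "\<lambda>m n. m \<in> ?S _"] this
  then have "closed (range (odo_code_seq :: 'd odo \<Rightarrow> _))"
    unfolding range_odo_code_seq by (intro closed_INT ballI closed_Int) blast+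
  moreover have "range (odo_code_seq :: 'd odo \<Rightarrow> _) \<subseteq> PiE UNIV ?S"
    unfolding range_odo_code_seq by auto
  ultimately show ?thesis using K compact_Int_closed[OF K] by (metis inf.absorb_iff2)
qed

definition odo_monoid :: "'d::finite itself \<Rightarrow> (nat \<Rightarrow> nat) monoid" where
  "odo_monoid _ = \<lparr>carrier = range (odo_code_seq :: 'd odo \<Rightarrow> _),
     mult = (\<lambda>a b. odo_code_seq ((odo_decode a :: 'd odo) + odo_decode b)),
     one = odo_code_seq (0 :: 'd odo)\<rparr>"

abbreviation odo_top :: "'d::finite itself \<Rightarrow> (nat \<Rightarrow> nat) topology" where
  "odo_top _ \<equiv> top_of_set (range (odo_code_seq :: 'd odo \<Rightarrow> _))"

lemma odo_monoid_simps:
  "carrier (odo_monoid TYPE('d::finite)) = range (odo_code_seq :: 'd odo \<Rightarrow> _)"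
  "a \<otimes>\<^bsub>odo_monoid TYPE('d)\<^esub> b = odo_code_seq ((odo_decode a :: 'd odo) + odo_decode b)"
  "\<one>\<^bsub>odo_monoid TYPE('d)\<^esub> = odo_code_seq (0 :: 'd odo)"
  by (simp_all add: odo_monoid_def)

lemma comm_group_odo: "comm_group (odo_monoid TYPE('d::finite))"
proof (rule comm_groupI)
  fix x assume "x \<in> carrier (odo_monoid TYPE('d))"
  then obtain a :: "'d odo" where "x = odo_code_seq a" by (auto simp: odo_monoid_simps)
  then show "\<exists>y\<in>carrier (odo_monoid TYPE('d)). y \<otimes>\<^bsub>odo_monoid TYPE('d)\<^esub> x = \<one>\<^bsub>odo_monoid TYPE('d)\<^esub>"
    by (intro bexI[of _ "odo_code_seq (- a)"]) (auto simp: odo_monoid_simps)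
qed (auto simp: odo_monoid_simps add_ac)

lemma odo_inv:
  "inv\<^bsub>odo_monoid TYPE('d::finite)\<^esub> (odo_code_seq x) = odo_code_seq (- x :: 'd odo)"
proof -
  interpret comm_group "odo_monoid TYPE('d)" by (rule comm_group_odo)
  show ?thesis by (rule inv_equality) (auto simp: odo_monoid_simps)
qed

text \<open>The small divisor bound at x = 0 separates 0 from \<open>odo_of (k - l)\<close>.\<close>

lemma odo_of_inj: "odo_of k = odo_of l \<longleftrightarrow> k = l" for k l :: "int ^ 'd"
proof
  assume eq: "odo_of k = odo_of l"
  show "k = l"
  proof (rule ccontr)
    assume "k \<noteq> l"
    then have kl: "k - l \<noteq> 0" by simp
    have "odo_of (k - l) = odo_of k + - odo_of l"
      unfolding odo_of_minus[symmetric] odo_of_add[symmetric] by simp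
    then have "odo_of (k - l) = 0" by (simp add: eq)
    moreover have "1 / (2 * odo_base TYPE('d) * real_of_int (max_norm (k - l)) ^ Suc CARD('d)) > 0"
      using max_norm_pos[OF kl] by (intro divide_pos_pos mult_pos_pos zero_less_power) auto
    ultimately show False using odo_real_shift_apart[OF kl, of 0] by simp
  qed
qed simp

lemma cantor_group_odo: "cantor_group (odo_monoid TYPE('d::finite)) (odo_top TYPE('d))"
  unfolding cantor_group_def
proof (intro conjI)
  let ?G = "odo_monoid TYPE('d)" and ?S = "range (odo_code_seq :: 'd odo \<Rightarrow> _)"
  interpret comm_group ?G by (rule comm_group_odo)
  show "comm_group ?G" by (rule comm_group_odo)
  show "topological_group_on ?G (odo_top TYPE('d))"
    unfolding topological_group_on_def
  proof (intro conjI)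
    show "group ?G" by (rule group_axioms)
    show "topspace (odo_top TYPE('d)) = carrier ?G" by (simp add: odo_monoid_simps)
    have "continuous_on (?S \<times> ?S) (\<lambda>p. odo_code_seq ((odo_decode (fst p) :: 'd odo) + odo_decode (snd p)))"
    proof (rule continuous_on_compose2[OF continuous_odo_code_seq])
      have "continuous_on (?S \<times> ?S) (\<lambda>p. (odo_decode (fst p) :: 'd odo, odo_decode (snd p) :: 'd odo))"
        by (intro continuous_on_Pair continuous_on_compose2[OF continuous_odo_decode] continuous_intros) auto
      from continuous_on_compose2[OF continuous_odo_plus this]
      show "continuous_on (?S \<times> ?S) (\<lambda>p. (odo_decode (fst p) :: 'd odo) + odo_decode (snd p))" by simp
    qed auto
    then show "continuous_map (prod_topology (odo_top TYPE('d)) (odo_top TYPE('d))) (odo_top TYPE('d))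
        (\<lambda>(x, y). x \<otimes>\<^bsub>?G\<^esub> y)"
      by (auto simp: prod_topology_subtopology_eu continuous_map_subtopology_eu odo_monoid_simps case_prod_unfold)
    have "continuous_on ?S (\<lambda>z. odo_code_seq (- odo_decode z :: 'd odo))"
      by (rule continuous_on_compose2[OF continuous_odo_code_seq
            continuous_on_compose2[OF continuous_odo_uminus continuous_odo_decode]]) auto
    then have "continuous_on ?S (\<lambda>z. inv\<^bsub>?G\<^esub> z)"
      by (rule continuous_on_cong[THEN iffD1, rotated 2]) (auto simp: odo_inv)
    then show "continuous_map (odo_top TYPE('d)) (odo_top TYPE('d)) (\<lambda>x. inv\<^bsub>?G\<^esub> x)"
      by (auto simp: continuous_map_subtopology_eu odo_inv)
  qed
  show "infinite (carrier ?G)"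
  proof -
    have "inj (\<lambda>n :: nat. odo_code_seq (odo_of (\<chi> j :: 'd. int n)))"
      by (rule injI) (auto simp: inj_eq[OF inj_odo_code_seq] odo_of_inj vec_eq_iff)
    then have "infinite (range (\<lambda>n :: nat. odo_code_seq (odo_of (\<chi> j :: 'd. int n))))"
      by (rule range_inj_infinite)
    then show ?thesis by (rule infinite_super[rotated]) (auto simp: odo_monoid_simps)
  qed
  show "totally_disconnected_space (odo_top TYPE('d))"
    unfolding totally_disconnected_space_def
  proof (intro allI impI)
    fix S assume "connectedin (odo_top TYPE('d)) S"
    then have S: "connected S" by (simp add: connectedin_subtopology)
    \<comment> \<open>The condition that coordinate i equals \<open>z i\<close> and its negation are
      both open, so a connected set cannot contain points that differ at i.\<close>
    have "w = z" if "w \<in> S" "z \<in> S" for w z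
    proof
      fix i
      show "w i = z i"
        using connectedD[OF S open_coordinate[of "\<lambda>n. n = z i" i] open_coordinate[of "\<lambda>n. n \<noteq> z i" i]] that
        by auto
    qed
    then show "\<exists>a. S \<subseteq> {a}" by blast
  qed
  show "metrizable_space (odo_top TYPE('d))"
  proof -
    have "homeomorphic_maps (euclidean :: 'd odo topology) (odo_top TYPE('d)) odo_code_seq odo_decode"
      unfolding homeomorphic_maps_def
      using continuous_odo_code_seq continuous_odo_decode by (auto simp: continuous_map_in_subtopology)
    then have "(euclidean :: 'd odo topology) homeomorphic_space odo_top TYPE('d)"
      unfolding homeomorphic_space_def by blast
    then show ?thesis using homeomorphic_metrizable_space metrizable_space_euclidean by blast
  qed
  show "compact_space (odo_top TYPE('d))"
    using compact_range_odo_code_seq[where 'd='d] by (simp add: compact_space_subtopology)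
qed

section \<open>The action of the lattice\<close>

abbreviation odo_translation :: "int ^ 'd \<Rightarrow> (nat \<Rightarrow> nat) \<Rightarrow> nat \<Rightarrow> nat" where
  "odo_translation n \<omega> \<equiv> odo_code_seq (odo_decode \<omega> + odo_of n)"

lemma odo_nat_pow:
  "odo_code_seq (odo_of k) [^]\<^bsub>odo_monoid TYPE('d)\<^esub> (n::nat) = odo_code_seq (odo_of (\<chi> j. int n * k $ j))"
  for k :: "int ^ 'd"
proof (induction n)
  case 0
  have "(\<chi> j. (0::int)) = (0 :: int ^ 'd)" by (simp add: vec_eq_iff)
  then show ?case by (simp add: odo_monoid_simps)
next
  case (Suc n)
  have "(\<chi> j. int n * k $ j) + k = (\<chi> j. int (Suc n) * k $ j)" by (simp add: vec_eq_iff algebra_simps)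
  then show ?case using Suc by (simp add: odo_monoid_simps odo_of_add[symmetric])
qed

lemma odo_int_pow:
  "odo_code_seq (odo_of k) [^]\<^bsub>odo_monoid TYPE('d)\<^esub> (z::int) = odo_code_seq (odo_of (\<chi> j. z * k $ j))"
  for k :: "int ^ 'd"
proof -
  have "- (\<chi> j. int (nat (- z)) * k $ j) = (\<chi> j. z * k $ j)" if "z < 0"
    using that by (simp add: vec_eq_iff)
  then show ?thesis
    by (simp add: int_pow_def2 odo_nat_pow odo_inv odo_of_minus[symmetric])
qed

lemma odo_finprod:
  fixes g :: "'i \<Rightarrow> int ^ 'd"
  assumes "finite A"
  shows "(\<Otimes>\<^bsub>odo_monoid TYPE('d)\<^esub>j\<in>A. odo_code_seq (odo_of (g j))) = odo_code_seq (odo_of (\<Sum>j\<in>A. g j))"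
proof -
  interpret comm_group "odo_monoid TYPE('d)" by (rule comm_group_odo)
  show ?thesis
    using assms
  proof (induction A)
    case (insert i A)
    then show ?case
      by (subst finprod_insert) (auto simp: odo_monoid_simps odo_of_add)
  qed (simp add: odo_monoid_simps)
qed

lemma translation_action_odo: "translation_action (odo_monoid TYPE('d)) (odo_translation :: int ^ 'd \<Rightarrow> _)"
  unfolding translation_action_def
proof (intro exI conjI allI ballI)
  fix j :: 'd
  show "odo_code_seq (odo_of (axis j 1 :: int ^ 'd)) \<in> carrier (odo_monoid TYPE('d))"
    by (simp add: odo_monoid_simps)
next
  fix n :: "int ^ 'd" and \<omega>
  have "(\<Sum>j\<in>UNIV. \<chi> i. n $ j * axis j 1 $ i) = n"
    by (simp add: vec_eq_iff axis_def if_distrib[of "\<lambda>x. _ * x"] sum.delta' cong: if_cong)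
  then show "odo_translation n \<omega> = \<omega> \<otimes>\<^bsub>odo_monoid TYPE('d)\<^esub>
      (\<Otimes>\<^bsub>odo_monoid TYPE('d)\<^esub>j\<in>UNIV. odo_code_seq (odo_of (axis j 1 :: int ^ 'd)) [^]\<^bsub>odo_monoid TYPE('d)\<^esub> (n $ j))"
    by (simp add: odo_int_pow odo_finprod odo_monoid_simps)
qed

lemma minimal_action_odo: "minimal_action (odo_top TYPE('d)) (odo_translation :: int ^ 'd \<Rightarrow> _)"
  unfolding minimal_action_def
proof (intro ballI equalityI)
  let ?S = "range (odo_code_seq :: 'd odo \<Rightarrow> _)"
  fix \<omega> assume "\<omega> \<in> topspace (odo_top TYPE('d))"
  let ?R = "range (\<lambda>n :: int ^ 'd. odo_translation n \<omega>)"
  show "odo_top TYPE('d) closure_of ?R \<subseteq> topspace (odo_top TYPE('d))"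
    by (rule closure_of_subset_topspace)
  show "topspace (odo_top TYPE('d)) \<subseteq> odo_top TYPE('d) closure_of ?R"
  proof
    fix z assume z: "z \<in> topspace (odo_top TYPE('d))"
    then obtain x :: "'d odo" where x: "z = odo_code_seq x" by auto
    have "\<exists>y. y \<in> ?R \<and> y \<in> B" if B: "z \<in> B" "openin (odo_top TYPE('d)) B" for B
    proof -
      obtain W where W: "open W" "B = ?S \<inter> W" using B(2) by (auto simp: openin_open)
      have "open (odo_code_seq -` W :: 'd odo set)" by (rule open_vimage[OF W(1) continuous_odo_code_seq])
      moreover have "x \<in> odo_code_seq -` W" using B(1) W x by auto
      ultimately obtain e where e: "e > 0" "\<And>y. dist y x < e \<Longrightarrow> odo_code_seq y \<in> W"
        unfolding open_dist by blast
      obtain i where i: "\<And>y. residue y i = residue x i \<Longrightarrow> dist y x < e"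
        using close_residue[OF e(1)] by blast
      \<comment> \<open>A residue of the difference is itself a lattice vector: translating \<omega>
        by it reaches the residue of x at level i, hence the given neighbourhood.\<close>
      let ?n = "residue (x - odo_decode \<omega>) i"
      have "residue (odo_decode \<omega> + odo_of ?n) i = residue (odo_decode \<omega> + (x - odo_decode \<omega>)) i"
        by (simp only: plus_odo.rep_eq odo_of.rep_eq red_residue order_refl)
      then have "odo_translation ?n \<omega> \<in> W" using e(2) i by simp
      then show ?thesis using W by blast
    qed
    then show "z \<in> odo_top TYPE('d) closure_of ?R" using z unfolding in_closure_of by blast
  qed
qed

theorem theorem1p3:
  shows "\<exists>(G :: (nat \<Rightarrow> nat) monoid) X (T :: int ^ 'd \<Rightarrow> (nat \<Rightarrow> nat) \<Rightarrow> (nat \<Rightarrow> nat)) f r C.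
    cantor_group G X \<and> translation_action G T \<and> minimal_action X T \<and>
    continuous_map X euclideanreal f \<and> r > 0 \<and>
    (\<forall>\<omega>\<in>carrier G. has_ULE (schrodinger (\<lambda>n. f (T n \<omega>))) r C) \<and>
    (\<exists>C' r'. C' > 0 \<and> r' > 0 \<and>
      (\<forall>\<omega>\<in>carrier G. \<forall>n m.
        (SUP t :: real. ereal (cmod (cinner_ell2 (delta_ell2 n)
            (op_exp (\<lambda>u. (- \<i> * complex_of_real t) *\<^sub>C schrodinger (\<lambda>k. f (T k \<omega>)) u)
              (delta_ell2 m)))))
        \<le> ereal (C' * exp (- r' * real_of_int (max_norm (n - m))))))"
proof -
  obtain F :: "'d odo \<Rightarrow> real" and C C' where F: "continuous_on UNIV F" and C': "C' > 0"
    and ULE: "\<And>\<omega>. has_ULE (schrodinger (\<lambda>n. F (\<omega> + odo_of n))) 1 C"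
    and dyn: "\<And>\<omega> n m t. cmod (cinner_ell2 (delta_ell2 n)
        (op_exp (\<lambda>u. (- \<i> * complex_of_real t) *\<^sub>C schrodinger (\<lambda>k. F (\<omega> + odo_of k)) u) (delta_ell2 m)))
        \<le> C' * exp (- real_of_int (max_norm (n - m)))"
    using odometer_localization by blast
  define f where "f \<omega> = F (odo_decode \<omega>)" for \<omega>
  have fT: "f (odo_translation n \<omega>) = F (odo_decode \<omega> + odo_of n)" for n :: "int ^ 'd" and \<omega> by (simp add: f_def)
  have "continuous_map (odo_top TYPE('d)) euclideanreal f"
    unfolding f_def by (simp add: continuous_on_compose2[OF F continuous_odo_decode])
  moreover have "(SUP t. ereal (cmod (cinner_ell2 (delta_ell2 n)
        (op_exp (\<lambda>u. (- \<i> * complex_of_real t) *\<^sub>C schrodinger (\<lambda>k. f (odo_translation k \<omega>)) u) (delta_ell2 m)))))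
      \<le> ereal (C' * exp (- 1 * real_of_int (max_norm (n - m))))" for \<omega> and n m :: "int ^ 'd"
    unfolding fT by (rule SUP_least) (use dyn in simp)
  moreover have "has_ULE (schrodinger (\<lambda>n :: int ^ 'd. f (odo_translation n \<omega>))) 1 C" for \<omega>
    unfolding fT by (rule ULE)
  ultimately show ?thesis
    using cantor_group_odo[where 'd='d] translation_action_odo[where 'd='d] minimal_action_odo[where 'd='d] C'
    by (intro exI[of _ "odo_monoid TYPE('d)"] exI[of _ "odo_top TYPE('d)"]
        exI[of _ "odo_translation :: int ^ 'd \<Rightarrow> _"] exI[of _ f] exI[of _ "1 :: real"] exI[of _ C]
        conjI exI[of _ C'] ballI allI) auto
qed

end
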